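(* Let $(\pi,\mathcal H)$ be a smooth unitary representation of a Lie group $G$ with exponential function and Lie algebra $\mathfrak g$, and let $A\in B(\mathcal H)$. Consider the assertions: (i) The map $G\to B(\mathcal H)$, $g\mapsto \pi(g)A$ is smooth (with respect to the norm topology on $B(\mathcal H)$). (ii) The map $G\to B(\mathcal H)$, $g\mapsto A^*\pi(g)$ is smooth (with respect to the norm topology on $B(\mathcal H)$). (iii) $A\mathcal H\subseteq \mathcal H^\infty$. (iv) $A\mathcal H\subseteq \mathcal D^\infty$. (v) All operators $A^*\mathrm{d}\pi(D)$, $D\in U(\mathfrak g_{\mathbb C})$, are bounded on $\mathcal H^\infty$. Then (i) $\Leftrightarrow$ (ii) $\Rightarrow$ (iii) $\Rightarrow$ (iv) $\Leftrightarrow$ (v). If $\mathfrak g$ is metrizable, then (iii) implies (i) and (ii); and if, in addition, $\mathfrak g$ is a Baire space (e.g. if $\mathfrak g$ is Fréchet), then (i)–(v) are all equivalent. Moreover, condition (iii) implies that all operators $\mathrm{d}\pi(D)A$, $D\in U(\mathfrak g_{\mathbb C})$, are bounded.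
   Context: For locally convex spaces $E,F$ and $U\subseteq E$ open, a map $f:U\to F$ is $C^k$ ($k\in\mathbb N\cup\{\infty\}$) if it is continuous, the iterated directional derivatives $\mathrm d^jf(x)(h_1,\dots,h_j)$ exist for all $1\le j\le k$, $x\in U$, $h_i\in E$, and all maps $\mathrm d^jf:U\times E^j\to F$ are continuous; smooth means $C^\infty$. A Lie group is a group that is a smooth manifold modeled on a locally convex space, with smooth multiplication and inversion; its Lie algebra is $\mathfrak g=T_{\mathbf 1}(G)$. An exponential function is a smooth map $\exp:\mathfrak g\to G$ such that each $t\mapsto\exp(tx)$ is a one-parameter group with derivative $x$ at $t=0$. A unitary representation $(\pi,\mathcal H)$ of $G$ is a homomorphism $\pi$ from $G$ to the unitary group of a complex Hilbert space $\mathcal H$ such that $G\times\mathcal H\to\mathcal H$, $(g,v)\mapsto\pi(g)v$ is continuous. $\mathcal H^\infty$ is the space of $v\in\mathcal H$ for which $g\mapsto\pi(g)v$ is smooth; $\pi$ is smooth if $\mathcal H^\infty$ is dense. For $x\in\mathfrak g$, $\overline{\mathrm d\pi}(x)$ is the infinitesimal generator of $t\mapsto\pi(\exp tx)$, i.e. $\overline{\mathrm d\pi}(x)v=\frac{d}{dt}|_{t=0}\pi(\exp tx)v$ with domain $\mathcal D(\overline{\mathrm d\pi}(x))$ the set of $v$ with $C^1$ orbit map $t\mapsto \pi(\exp tx)v$. $\mathrm d\pi(x)$ denotes its restriction to $\mathcal H^\infty$; $\mathrm d\pi:\mathfrak g\to\mathrm{End}(\mathcal H^\infty)$ is a Lie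 algebra representation, extended to the enveloping algebra $U(\mathfrak g_{\mathbb C})$ of the complexification $\mathfrak g_{\mathbb C}$. Put $\mathcal D^n=\bigcap_{x_1,\dots,x_n\in\mathfrak g}\mathcal D(\overline{\mathrm d\pi}(x_n)\cdots\overline{\mathrm d\pi}(x_1))$ (compositions with their natural domains) and $\mathcal D^\infty=\bigcap_{n\in\mathbb N}\mathcal D^n$. *)

theory Defs
  imports
    "HOL-Analysis.Analysis"
    "HOL-Algebra.Group"
    "HOL-Library.Extended_Nat"
    "HOL-Library.Poly_Mapping"
begin

section \<open>Locally convex spaces\<close>

text \<open>
  Real Hausdorff locally convex topological vector spaces. The second axiom spells out
  \<open>convex V\<close>, because that constant cannot be used inside a class specification; see
  \<open>convex_nhds_base_0\<close> below.
\<close>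

class locally_convex_space = real_vector + topological_ab_group_add + t2_space +
  assumes tendsto_scaleR_lcs:
      "((\<lambda>p. fst p *\<^sub>R snd p) \<longlongrightarrow> r *\<^sub>R x) (nhds r \<times>\<^sub>F nhds x)"
    and convex_nhds_base_0_raw:
      "open U \<Longrightarrow> 0 \<in> U \<Longrightarrow> \<exists>V. open V \<and>
         (\<forall>x\<in>V. \<forall>y\<in>V. \<forall>u\<ge>0. \<forall>v\<ge>0. u + v = 1 \<longrightarrow> u *\<^sub>R x + v *\<^sub>R y \<in> V) \<and>
         0 \<in> V \<and> V \<subseteq> U"

lemma convex_nhds_base_0:
  fixes U :: "'e::locally_convex_space set"
  assumes "open U" "0 \<in> U"
  obtains V where "open V" "convex V" "0 \<in> V" "V \<subseteq> U"
  using convex_nhds_base_0_raw[OF assms] that unfolding convex_def by metis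

instance real_normed_vector \<subseteq> locally_convex_space
proof
  fix r :: real and x :: 'a
  have "((\<lambda>p. fst p *\<^sub>R snd p) \<longlongrightarrow> fst (r, x) *\<^sub>R snd (r, x)) (nhds (r, x))"
    by (intro tendsto_intros filterlim_ident)
  then show "((\<lambda>p. fst p *\<^sub>R snd p) \<longlongrightarrow> r *\<^sub>R x) (nhds r \<times>\<^sub>F nhds x)"
    by (simp add: nhds_prod)
next
  fix U :: "'a set"
  assume "open U" "0 \<in> U"
  then obtain e where "e > 0" "ball 0 e \<subseteq> U"
    using open_contains_ball by blast
  then have "open (ball (0::'a) e) \<and> convex (ball (0::'a) e) \<and> (0::'a) \<in> ball 0 e \<and> ball 0 e \<subseteq> U"
    by simp
  then show "\<exists>V. open V \<and>
      (\<forall>x\<in>V. \<forall>y\<in>V. \<forall>u\<ge>0. \<forall>v\<ge>0. u + v = 1 \<longrightarrow> u *\<^sub>R x + v *\<^sub>R y \<in> V) \<and> 0 \<in> V \<and> V \<subseteq> U"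
    unfolding convex_def by (rule exI)
qed

instance prod :: (topological_monoid_add, topological_monoid_add) topological_monoid_add
proof
  fix a b :: "'a \<times> 'b"
  have f: "filterlim fst (nhds a) (nhds a \<times>\<^sub>F nhds b)"
    and s: "filterlim snd (nhds b) (nhds a \<times>\<^sub>F nhds b)"
    by (rule filterlim_fst filterlim_snd)+
  have "((\<lambda>x. (fst (fst x) + fst (snd x), snd (fst x) + snd (snd x)))
      \<longlongrightarrow> (fst a + fst b, snd a + snd b)) (nhds a \<times>\<^sub>F nhds b)"
    by (intro tendsto_Pair tendsto_add tendsto_fst tendsto_snd f s)
  then show "((\<lambda>x. fst x + snd x) \<longlongrightarrow> a + b) (nhds a \<times>\<^sub>F nhds b)"
    by (simp add: plus_prod_def)
qed

instance prod :: (topological_group_add, topological_group_add) topological_group_add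
proof
  fix a :: "'a \<times> 'b"
  have "((\<lambda>x. (- fst x, - snd x)) \<longlongrightarrow> (- fst a, - snd a)) (nhds a)"
    by (intro tendsto_Pair tendsto_minus tendsto_fst tendsto_snd filterlim_ident)
  then show "(uminus \<longlongrightarrow> - a) (nhds a)"
    by (simp add: uminus_prod_def[abs_def])
qed

instance prod :: (topological_ab_group_add, topological_ab_group_add) topological_ab_group_add ..

instance prod :: (locally_convex_space, locally_convex_space) locally_convex_space
proof
  fix r :: real and x :: "'a \<times> 'b"
  have f: "filterlim fst (nhds r) (nhds r \<times>\<^sub>F nhds x)"
    and s: "filterlim snd (nhds x) (nhds r \<times>\<^sub>F nhds x)"
    by (rule filterlim_fst filterlim_snd)+
  have 1: "((\<lambda>p. fst p *\<^sub>R fst (snd p)) \<longlongrightarrow> r *\<^sub>R fst x) (nhds r \<times>\<^sub>F nhds x)"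
    using filterlim_compose[OF tendsto_scaleR_lcs[of r "fst x"]
        filterlim_Pair[OF f tendsto_fst[OF s]]] by simp
  have 2: "((\<lambda>p. fst p *\<^sub>R snd (snd p)) \<longlongrightarrow> r *\<^sub>R snd x) (nhds r \<times>\<^sub>F nhds x)"
    using filterlim_compose[OF tendsto_scaleR_lcs[of r "snd x"]
        filterlim_Pair[OF f tendsto_snd[OF s]]] by simp
  show "((\<lambda>p. fst p *\<^sub>R snd p) \<longlongrightarrow> r *\<^sub>R x) (nhds r \<times>\<^sub>F nhds x)"
    using tendsto_Pair[OF 1 2] by (simp add: scaleR_prod_def)
next
  fix U :: "('a \<times> 'b) set"
  assume "open U" "0 \<in> U"
  then obtain A B where AB: "open A" "open B" "(0::'a) \<in> A" "(0::'b) \<in> B" "A \<times> B \<subseteq> U"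
    by (metis open_prod_elim mem_Times_iff fst_zero snd_zero)
  obtain A' where "open A'" "convex A'" "0 \<in> A'" "A' \<subseteq> A"
    using convex_nhds_base_0[OF AB(1,3)] by blast
  moreover obtain B' where "open B'" "convex B'" "0 \<in> B'" "B' \<subseteq> B"
    using convex_nhds_base_0[OF AB(2,4)] by blast
  ultimately have "open (A' \<times> B') \<and> convex (A' \<times> B') \<and> 0 \<in> A' \<times> B' \<and> A' \<times> B' \<subseteq> U"
    using AB(5) by (simp add: open_Times convex_Times zero_prod_def) blast
  then show "\<exists>V. open V \<and>
      (\<forall>x\<in>V. \<forall>y\<in>V. \<forall>u\<ge>0. \<forall>v\<ge>0. u + v = 1 \<longrightarrow> u *\<^sub>R x + v *\<^sub>R y \<in> V) \<and> 0 \<in> V \<and> V \<subseteq> U"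
    unfolding convex_def by (rule exI)
qed

text \<open>Frechet spaces: the topology comes from a complete translation-invariant metric.\<close>

definition frechet_space :: "'e::locally_convex_space itself \<Rightarrow> bool" where
  "frechet_space _ \<longleftrightarrow>
     (\<exists>d. Metric_space (UNIV :: 'e set) d \<and> Metric_space.mcomplete UNIV d \<and>
          Metric_space.mtopology UNIV d = (euclidean :: 'e topology) \<and>
          (\<forall>x y z. d (x + z) (y + z) = d x y))"

definition Baire_space :: "'a topology \<Rightarrow> bool" where
  "Baire_space X \<longleftrightarrow>
     (\<forall>\<G>. countable \<G> \<and> (\<forall>T\<in>\<G>. openin X T \<and> X closure_of T = topspace X)
        \<longrightarrow> X closure_of (topspace X \<inter> \<Inter>\<G>) = topspace X)"

section \<open>Differentiable maps between locally convex spaces\<close>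

definition dir_quot ::
    "('e::locally_convex_space \<Rightarrow> 'f::locally_convex_space) \<Rightarrow> 'e \<Rightarrow> 'e \<Rightarrow> real \<Rightarrow> 'f" where
  "dir_quot f x h t = (1 / t) *\<^sub>R (f (x + t *\<^sub>R h) - f x)"

definition dir_differentiable ::
    "('e::locally_convex_space \<Rightarrow> 'f::locally_convex_space) \<Rightarrow> 'e \<Rightarrow> 'e \<Rightarrow> bool" where
  "dir_differentiable f x h \<longleftrightarrow> (\<exists>l. (dir_quot f x h \<longlongrightarrow> l) (at 0))"

definition dir_deriv ::
    "('e::locally_convex_space \<Rightarrow> 'f::locally_convex_space) \<Rightarrow> 'e \<Rightarrow> 'e \<Rightarrow> 'f" where
  "dir_deriv f x h = Lim (at 0) (dir_quot f x h)"

text \<open>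
  The iterated directional derivative of order \<open>j\<close> at \<open>x\<close> in the directions
  \<open>h 0, \<dots>, h (j - 1)\<close>. The directions are taken from a sequence of which only the first
  \<open>j\<close> entries matter; since \<open>nat \<Rightarrow> 'e\<close> carries the product topology, joint continuity
  in \<open>(x, h)\<close> is the same as continuity on the product of \<open>U\<close> with the \<open>j\<close>-th power of \<open>'e\<close>.
\<close>

primrec iter_deriv ::
    "nat \<Rightarrow> ('e::locally_convex_space \<Rightarrow> 'f::locally_convex_space) \<Rightarrow> 'e \<Rightarrow> (nat \<Rightarrow> 'e) \<Rightarrow> 'f"
where
  "iter_deriv 0 f x h = f x"
| "iter_deriv (Suc j) f x h = dir_deriv (\<lambda>y. iter_deriv j f y h) x (h j)"

definition Ck_on ::
    "enat \<Rightarrow> 'e::locally_convex_space set \<Rightarrow> ('e \<Rightarrow> 'f::locally_convex_space) \<Rightarrow> bool" where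
  "Ck_on k U f \<longleftrightarrow>
     open U \<and>
     (\<forall>j. enat (Suc j) \<le> k \<longrightarrow>
        (\<forall>x\<in>U. \<forall>h. dir_differentiable (\<lambda>y. iter_deriv j f y h) x (h j))) \<and>
     (\<forall>j. enat j \<le> k \<longrightarrow> continuous_on (U \<times> UNIV) (\<lambda>(x, h). iter_deriv j f x h))"

section \<open>Manifolds and Lie groups\<close>

text \<open>A chart is given by its domain together with its coordinate map.\<close>

type_synonym ('g, 'e) chart = "'g set \<times> ('g \<Rightarrow> 'e)"

definition smooth_atlas ::
    "('g::t2_space, 'e::locally_convex_space) chart set \<Rightarrow> bool" where
  "smooth_atlas \<A> \<longleftrightarrow>
     (\<forall>(U, \<phi>)\<in>\<A>. open U \<and> open (\<phi> ` U) \<and> homeomorphism U (\<phi> ` U) \<phi> (inv_into U \<phi>)) \<and>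
     \<Union> (fst ` \<A>) = UNIV \<and>
     (\<forall>(U, \<phi>)\<in>\<A>. \<forall>(V, \<psi>)\<in>\<A>. Ck_on \<infinity> (\<phi> ` (U \<inter> V)) (\<psi> \<circ> inv_into U \<phi>))"

definition lcs_atlas :: "('e::locally_convex_space, 'e) chart set" where
  "lcs_atlas = {(UNIV, id)}"

definition prod_atlas ::
    "('g, 'e) chart set \<Rightarrow> ('h, 'f) chart set \<Rightarrow> ('g \<times> 'h, 'e \<times> 'f) chart set" where
  "prod_atlas \<A> \<B> = {(U \<times> V, map_prod \<phi> \<psi>) | U \<phi> V \<psi>. (U, \<phi>) \<in> \<A> \<and> (V, \<psi>) \<in> \<B>}"

definition smooth_map ::
    "('g::t2_space, 'e::locally_convex_space) chart set \<Rightarrow>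
     ('h::t2_space, 'f::locally_convex_space) chart set \<Rightarrow> ('g \<Rightarrow> 'h) \<Rightarrow> bool" where
  "smooth_map \<A> \<B> f \<longleftrightarrow>
     continuous_on UNIV f \<and>
     (\<forall>(U, \<phi>)\<in>\<A>. \<forall>(V, \<psi>)\<in>\<B>.
        Ck_on \<infinity> (\<phi> ` (U \<inter> f -` V)) (\<psi> \<circ> f \<circ> inv_into U \<phi>))"

locale lie_group = group G for G :: "('g::t2_space) monoid" (structure) +
  fixes \<A> :: "('g, 'e::locally_convex_space) chart set"
  assumes carrier_UNIV: "carrier G = UNIV"
    and atlas: "smooth_atlas \<A>"
    and smooth_mult: "smooth_map (prod_atlas \<A> \<A>) \<A> (\<lambda>(g, h). g \<otimes> h)"
    and smooth_inv: "smooth_map \<A> \<A> (m_inv G)"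

text \<open>
  The tangent space at the identity is identified with the model space \<open>'e\<close> by means of a
  chart \<open>c\<close> around the identity: a tangent vector is represented by its coordinates in \<open>c\<close>.
  The choice of \<open>c\<close> is arbitrary. The last axiom says that \<open>x\<close> is the velocity of
  \<open>t \<mapsto> ex (t x)\<close> at \<open>t = 0\<close>.
\<close>

locale lie_group_exp = lie_group G \<A>
  for G :: "('g::t2_space) monoid" (structure)
    and \<A> :: "('g, 'e::locally_convex_space) chart set" +
  fixes c :: "('g, 'e) chart" and ex :: "'e \<Rightarrow> 'g"
  assumes chart_at_one: "c \<in> \<A>" "\<one> \<in> fst c"
    and smooth_ex: "smooth_map lcs_atlas \<A> ex"
    and ex_add: "ex ((s + t) *\<^sub>R x) = ex (s *\<^sub>R x) \<otimes> ex (t *\<^sub>R x)"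
    and ex_velocity:
      "((\<lambda>t. (1 / t) *\<^sub>R (snd c (ex (t *\<^sub>R x)) - snd c \<one>)) \<longlongrightarrow> x) (at 0)"

text \<open>
  Coordinates, at the point with coordinates \<open>a\<close>, of the left-invariant vector field whose
  value at the identity is \<open>x\<close>, and the Lie bracket obtained from the bracket
  \<open>[X, Y] = dY(X) - dX(Y)\<close> of such vector fields, evaluated at the identity.
\<close>

definition left_inv_field ::
    "'g monoid \<Rightarrow> ('g, 'e::locally_convex_space) chart \<Rightarrow> 'e \<Rightarrow> 'e \<Rightarrow> 'e" where
  "left_inv_field G c x a =
     (let p = inv_into (fst c) (snd c)
      in dir_deriv (\<lambda>b. snd c (p a \<otimes>\<^bsub>G\<^esub> p b)) (snd c \<one>\<^bsub>G\<^esub>) x)"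

definition lie_bracket ::
    "'g monoid \<Rightarrow> ('g, 'e::locally_convex_space) chart \<Rightarrow> 'e \<Rightarrow> 'e \<Rightarrow> 'e" where
  "lie_bracket G c x y =
     dir_deriv (left_inv_field G c y) (snd c \<one>\<^bsub>G\<^esub>) x
     - dir_deriv (left_inv_field G c x) (snd c \<one>\<^bsub>G\<^esub>) y"

section \<open>The enveloping algebra of the complexification\<close>

text \<open>A pair \<open>(x, y)\<close> stands for \<open>x + i y\<close> in the complexification.\<close>

definition cplx_scale :: "complex \<Rightarrow> 'e::real_vector \<times> 'e \<Rightarrow> 'e \<times> 'e" where
  "cplx_scale a = (\<lambda>(x, y). (Re a *\<^sub>R x - Im a *\<^sub>R y, Re a *\<^sub>R y + Im a *\<^sub>R x))"

definition cplx_bracket ::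
    "('e \<Rightarrow> 'e \<Rightarrow> 'e) \<Rightarrow> 'e::real_vector \<times> 'e \<Rightarrow> 'e \<times> 'e \<Rightarrow> 'e \<times> 'e" where
  "cplx_bracket br = (\<lambda>(x, y) (x', y'). (br x x' - br y y', br x y' + br y x'))"

text \<open>
  Words under concatenation, written additively so that finitely supported functions on words
  with the convolution product of \<open>poly_mapping\<close> are the free associative algebra.
\<close>

datatype 'a word_monoid = Word (letters: "'a list")

instantiation word_monoid :: (type) monoid_add
begin

definition zero_word_monoid :: "'a word_monoid" where
  "zero_word_monoid = Word []"

definition plus_word_monoid :: "'a word_monoid \<Rightarrow> 'a word_monoid \<Rightarrow> 'a word_monoid" where
  "plus_word_monoid u w = Word (letters u @ letters w)"

instance
  by standard (simp_all add: zero_word_monoid_def plus_word_monoid_def)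

end

type_synonym 'a free_algebra = "'a word_monoid \<Rightarrow>\<^sub>0 complex"

definition gen :: "'a \<Rightarrow> 'a free_algebra" where
  "gen u = Poly_Mapping.single (Word [u]) 1"

text \<open>
  The enveloping algebra is the free complex algebra on the set underlying the complexified
  Lie algebra modulo the two-sided ideal generated by the complex linearity relations and the
  relations \<open>u w - w u = [u, w]\<close>. Linearity relations and free algebra together give the
  tensor algebra.
\<close>

inductive_set env_ideal :: "('e \<Rightarrow> 'e \<Rightarrow> 'e) \<Rightarrow> ('e::real_vector \<times> 'e) free_algebra set"
  for br :: "'e \<Rightarrow> 'e \<Rightarrow> 'e"
where
  rel_add: "gen (u + w) - gen u - gen w \<in> env_ideal br"
| rel_scale: "gen (cplx_scale a u) - Poly_Mapping.single (Word [u]) a \<in> env_ideal br"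
| rel_bracket: "gen u * gen w - gen w * gen u - gen (cplx_bracket br u w) \<in> env_ideal br"
| zero: "0 \<in> env_ideal br"
| add: "p \<in> env_ideal br \<Longrightarrow> q \<in> env_ideal br \<Longrightarrow> p + q \<in> env_ideal br"
| mult_left: "p \<in> env_ideal br \<Longrightarrow> q * p \<in> env_ideal br"
| mult_right: "p \<in> env_ideal br \<Longrightarrow> p * q \<in> env_ideal br"

definition env_rel ::
    "('e \<Rightarrow> 'e \<Rightarrow> 'e) \<Rightarrow> (('e::real_vector \<times> 'e) free_algebra \<times> ('e \<times> 'e) free_algebra) set" where
  "env_rel br = {(p, q). p - q \<in> env_ideal br}"

definition env_algebra ::
    "('e \<Rightarrow> 'e \<Rightarrow> 'e) \<Rightarrow> ('e::real_vector \<times> 'e) free_algebra set set" where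
  "env_algebra br = UNIV // env_rel br"

lemma equiv_env_rel: "equiv UNIV (env_rel br)"
proof (rule equivI)
  show "env_rel br \<subseteq> UNIV \<times> UNIV"
    by simp
  show "refl (env_rel br)"
    by (rule refl_onI) (simp add: env_rel_def env_ideal.zero)
  show "sym (env_rel br)"
  proof (rule symI)
    fix p q assume "(p, q) \<in> env_rel br"
    then have "- 1 * (p - q) \<in> env_ideal br"
      unfolding env_rel_def by (intro env_ideal.mult_left) simp
    moreover have "- 1 * (p - q) = q - p"
      by (simp only: mult_minus1 minus_diff_eq)
    ultimately show "(q, p) \<in> env_rel br"
      by (simp only: env_rel_def mem_Collect_eq prod.case)
  qed
  show "trans (env_rel br)"
  proof (rule transI)
    fix p q r assume "(p, q) \<in> env_rel br" "(q, r) \<in> env_rel br"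
    then have "(p - q) + (q - r) \<in> env_ideal br"
      unfolding env_rel_def by (intro env_ideal.add) simp_all
    moreover have "(p - q) + (q - r) = p - r"
      by (simp only: add_diff_eq diff_add_cancel)
    ultimately show "(p, r) \<in> env_rel br"
      by (simp only: env_rel_def mem_Collect_eq prod.case)
  qed
qed

section \<open>Complex Hilbert spaces and bounded operators\<close>

class complex_hilbert_space = banach +
  fixes scaleC :: "complex \<Rightarrow> 'a \<Rightarrow> 'a"  (infixr \<open>*\<^sub>C\<close> 75)
    and cinner :: "'a \<Rightarrow> 'a \<Rightarrow> complex"
  assumes scaleC_add_right: "a *\<^sub>C (x + y) = a *\<^sub>C x + a *\<^sub>C y"
    and scaleC_add_left: "(a + b) *\<^sub>C x = a *\<^sub>C x + b *\<^sub>C x"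
    and scaleC_scaleC: "a *\<^sub>C b *\<^sub>C x = (a * b) *\<^sub>C x"
    and scaleC_of_real: "complex_of_real r *\<^sub>C x = r *\<^sub>R x"
    and cinner_commute: "cinner x y = cnj (cinner y x)"
    and cinner_add_left: "cinner (x + y) z = cinner x z + cinner y z"
    and cinner_scaleC_left: "cinner (a *\<^sub>C x) y = a * cinner x y"
    and norm_eq_sqrt_cinner: "norm x = sqrt (Re (cinner x x))"

text \<open>
  Bounded operators on \<open>'h\<close> are the complex-linear elements of the real Banach space
  \<open>'h \<Rightarrow>\<^sub>L 'h\<close>. They form a closed subspace, on which the norm is the usual operator norm;
  hence smoothness of a map with values in this subspace does not depend on whether it is
  read in the subspace or in \<open>'h \<Rightarrow>\<^sub>L 'h\<close>.
\<close>

definition clinear_op :: "('h::complex_hilbert_space \<Rightarrow>\<^sub>L 'h) \<Rightarrow> bool" where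
  "clinear_op A \<longleftrightarrow> (\<forall>a v. A (a *\<^sub>C v) = a *\<^sub>C A v)"

definition cadjoint ::
    "('h::complex_hilbert_space \<Rightarrow>\<^sub>L 'h) \<Rightarrow> ('h \<Rightarrow>\<^sub>L 'h)" where
  "cadjoint A = (THE B. \<forall>v w. cinner (A v) w = cinner v (blinfun_apply B w))"

definition unitary_op :: "('h::complex_hilbert_space \<Rightarrow>\<^sub>L 'h) \<Rightarrow> bool" where
  "unitary_op U \<longleftrightarrow> clinear_op U \<and> surj (blinfun_apply U) \<and>
     (\<forall>v w. cinner (U v) (U w) = cinner v w)"

definition bounded_op_on :: "'h set \<Rightarrow> ('h::real_normed_vector \<Rightarrow> 'h) \<Rightarrow> bool" where
  "bounded_op_on S T \<longleftrightarrow> (\<exists>C. \<forall>v\<in>S. norm (T v) \<le> C * norm v)"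

section \<open>Unitary representations\<close>

definition unitary_rep ::
    "('g::topological_space) monoid \<Rightarrow> ('g \<Rightarrow> ('h::complex_hilbert_space \<Rightarrow>\<^sub>L 'h)) \<Rightarrow> bool" where
  "unitary_rep G \<pi> \<longleftrightarrow>
     (\<forall>g\<in>carrier G. unitary_op (\<pi> g)) \<and>
     (\<forall>g\<in>carrier G. \<forall>h\<in>carrier G. \<pi> (g \<otimes>\<^bsub>G\<^esub> h) = \<pi> g o\<^sub>L \<pi> h) \<and>
     continuous_on (carrier G \<times> UNIV) (\<lambda>(g, v). blinfun_apply (\<pi> g) v)"

definition smooth_vectors ::
    "('g::t2_space, 'e::locally_convex_space) chart set \<Rightarrow>
     ('g \<Rightarrow> ('h::complex_hilbert_space \<Rightarrow>\<^sub>L 'h)) \<Rightarrow> 'h set" where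
  "smooth_vectors \<A> \<pi> = {v. smooth_map \<A> lcs_atlas (\<lambda>g. blinfun_apply (\<pi> g) v)}"

definition smooth_unitary_rep ::
    "('g::t2_space) monoid \<Rightarrow> ('g, 'e::locally_convex_space) chart set \<Rightarrow>
     ('g \<Rightarrow> ('h::complex_hilbert_space \<Rightarrow>\<^sub>L 'h)) \<Rightarrow> bool" where
  "smooth_unitary_rep G \<A> \<pi> \<longleftrightarrow> unitary_rep G \<pi> \<and> closure (smooth_vectors \<A> \<pi>) = UNIV"

text \<open>
  The infinitesimal generator as a partial map, so that \<open>dom\<close> is its domain and
  \<open>\<circ>\<^sub>m\<close> is composition of unbounded operators with natural domains.
\<close>

definition dpi_bar ::
    "('e::locally_convex_space \<Rightarrow> 'g) \<Rightarrow> ('g \<Rightarrow> ('h::complex_hilbert_space \<Rightarrow>\<^sub>L 'h)) \<Rightarrow>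
     'e \<Rightarrow> 'h \<rightharpoonup> 'h" where
  "dpi_bar ex \<pi> x v =
     (let orb = (\<lambda>t::real. blinfun_apply (\<pi> (ex (t *\<^sub>R x))) v)
      in if Ck_on 1 UNIV orb then Some (vector_derivative orb (at 0)) else None)"

text \<open>For \<open>xs = [x\<^sub>1, \<dots>, x\<^sub>n]\<close> the operator below applies \<open>x\<^sub>1\<close> first and \<open>x\<^sub>n\<close> last.\<close>

definition dom_n ::
    "('e::locally_convex_space \<Rightarrow> 'g) \<Rightarrow> ('g \<Rightarrow> ('h::complex_hilbert_space \<Rightarrow>\<^sub>L 'h)) \<Rightarrow>
     nat \<Rightarrow> 'h set" where
  "dom_n ex \<pi> n =
     (\<Inter>xs\<in>{xs. length xs = n}. dom (fold (\<lambda>x T. dpi_bar ex \<pi> x \<circ>\<^sub>m T) xs Some))"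

definition dom_infty ::
    "('e::locally_convex_space \<Rightarrow> 'g) \<Rightarrow> ('g \<Rightarrow> ('h::complex_hilbert_space \<Rightarrow>\<^sub>L 'h)) \<Rightarrow> 'h set"
where
  "dom_infty ex \<pi> = (\<Inter>n. dom_n ex \<pi> n)"

text \<open>
  The derived representation. These operators are meaningful on smooth vectors only, and smooth
  vectors lie in the domain of every generator. \<open>dpi_free\<close> is the extension to the free
  algebra and \<open>dpi_env\<close> the induced map on the enveloping algebra.
\<close>

definition dpi ::
    "('e::locally_convex_space \<Rightarrow> 'g) \<Rightarrow> ('g \<Rightarrow> ('h::complex_hilbert_space \<Rightarrow>\<^sub>L 'h)) \<Rightarrow>
     'e \<Rightarrow> 'h \<Rightarrow> 'h" where
  "dpi ex \<pi> x v = the (dpi_bar ex \<pi> x v)"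

definition dpi_cplx ::
    "('e::locally_convex_space \<Rightarrow> 'g) \<Rightarrow> ('g \<Rightarrow> ('h::complex_hilbert_space \<Rightarrow>\<^sub>L 'h)) \<Rightarrow>
     'e \<times> 'e \<Rightarrow> 'h \<Rightarrow> 'h" where
  "dpi_cplx ex \<pi> = (\<lambda>(x, y) v. dpi ex \<pi> x v + \<i> *\<^sub>C dpi ex \<pi> y v)"

definition dpi_free ::
    "('e::locally_convex_space \<Rightarrow> 'g) \<Rightarrow> ('g \<Rightarrow> ('h::complex_hilbert_space \<Rightarrow>\<^sub>L 'h)) \<Rightarrow>
     ('e \<times> 'e) free_algebra \<Rightarrow> 'h \<Rightarrow> 'h" where
  "dpi_free ex \<pi> p v =
     (\<Sum>w\<in>Poly_Mapping.keys p. Poly_Mapping.lookup p w *\<^sub>C foldr (dpi_cplx ex \<pi>) (letters w) v)"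

definition dpi_env ::
    "('e::locally_convex_space \<Rightarrow> 'g) \<Rightarrow> ('g \<Rightarrow> ('h::complex_hilbert_space \<Rightarrow>\<^sub>L 'h)) \<Rightarrow>
     ('e \<times> 'e) free_algebra set \<Rightarrow> 'h \<Rightarrow> 'h" where
  "dpi_env ex \<pi> D = dpi_free ex \<pi> (SOME p. p \<in> D)"

end

theory Submission
  imports Defs
begin

text \<open>
  Taking adjoints and inverting the group element exchanges \<open>\<pi>(g) A\<close> and \<open>A\<^sup>* \<pi>(g)\<close>. The generators
  are skew-symmetric and the smooth vectors form a core of each of them, so that the operators
  \<open>A\<^sup>* d\<pi>(x\<^sub>1) \<dots> d\<pi>(x\<^sub>n)\<close> are bounded exactly when their adjoints, up to sign the products of
  generators applied to \<open>A\<close>, are defined everywhere; one direction is uniform boundedness and the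
  other Riesz representation.

  An operator-valued map that is strongly smooth, on a dense subspace, becomes smooth in norm as soon
  as each of its derivatives is locally bounded in operator norm. If the model space is metrizable, it
  suffices to bound the derivatives along convergent sequences. For \<open>\<pi>(g) A\<close> with \<open>A\<close> taking smooth
  values this is uniform boundedness. For \<open>A\<^sup>* \<pi>(g)\<close>, the boundedness of the operators
  \<open>A\<^sup>* d\<pi>(x\<^sub>1) \<dots> d\<pi>(x\<^sub>n)\<close> gives bounds on the derivatives at the identity in fixed directions, because
  differentiating along left-invariant vector fields is iterated differentiation up to lower order;
  the Baire property makes them locally uniform in the directions, and unitarity transports them to
  all other points.
\<close>

section \<open>Calculus in locally convex spaces\<close>

text \<open>Under (iv) the map \<open>\<lambda>g. \<pi> g o\<^sub>L A\<close> resists a direct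
  attack: a vector of \<open>dom_infty\<close> is differentiable along one-parameter groups only,
  and nothing yet says that its orbit map has jointly continuous derivatives in a chart. On the
  adjoint side the map is strongly smooth on the dense space of smooth vectors from the start, and
  only operator norm bounds are missing. The bounds that (iv) supplies hold for fixed directions,
  with constants that depend on the directions in an unknown way; this is the gap that the Baire
  property closes.

  The model space carries no norm, so increments are controlled by open convex sets in place of
  integrals. Hilbert space arguments use the real inner product, since operators are elements of a
  real Banach space.

  Statement (v) speaks of classes in the enveloping algebra. That the action respects the bracket
  rests on the symmetry of second derivatives, and it is needed to read off words of generators from
  (v).\<close>

lemma lcs_tendsto_scaleR:
  fixes x :: "'e::locally_convex_space"
  assumes "(f \<longlongrightarrow> r) F" "(g \<longlongrightarrow> x) F"
  shows "((\<lambda>t. f t *\<^sub>R g t) \<longlongrightarrow> r *\<^sub>R x) F"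
  using filterlim_compose[OF tendsto_scaleR_lcs[of r x] filterlim_Pair[OF assms]] by simp

lemma lcs_continuous_on_scaleR:
  fixes g :: "'a::topological_space \<Rightarrow> 'e::locally_convex_space"
  assumes "continuous_on S f" "continuous_on S g"
  shows "continuous_on S (\<lambda>t. f t *\<^sub>R g t)"
  using assms unfolding continuous_on_def by (auto intro: lcs_tendsto_scaleR)

lemma convex_open_nbhd:
  fixes x :: "'e::locally_convex_space"
  assumes "open S" "x \<in> S"
  obtains C where "open C" "convex C" "x \<in> C" "C \<subseteq> S"
proof -
  have "open ((\<lambda>y. x + y) -` S)"
    using assms(1) by (intro open_vimage) (auto intro!: continuous_intros)
  moreover have "0 \<in> (\<lambda>y. x + y) -` S"
    using assms(2) by simp
  ultimately obtain V where V: "open V" "convex V" "0 \<in> V" "V \<subseteq> (\<lambda>y. x + y) -` S"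
    by (rule convex_nhds_base_0)
  show thesis
  proof
    have eq: "(+) x ` V = (\<lambda>y. y - x) -` V"
    proof (intro Set.set_eqI iffI)
      fix y assume "y \<in> (\<lambda>y. y - x) -` V"
      then show "y \<in> (+) x ` V"
        by (intro image_eqI[of _ _ "y - x"]) auto
    qed auto
    show "open ((+) x ` V)"
      unfolding eq using V(1) by (intro open_vimage) (auto intro!: continuous_intros)
    show "convex ((+) x ` V)"
      using V(2) by simp
    show "x \<in> (+) x ` V"
      using V(3) by (intro image_eqI[of _ _ 0]) auto
    show "(+) x ` V \<subseteq> S"
      using V(4) by auto
  qed
qed

lemma tendsto_funI:
  assumes "\<And>i. ((\<lambda>t. f t i) \<longlongrightarrow> l i) F"
  shows "(f \<longlongrightarrow> l) F"
proof -
  have "limitin (product_topology (\<lambda>i. euclidean) UNIV) f l F"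
    using assms by (subst limitin_componentwise) (auto simp: PiE_def)
  then show ?thesis
    by (simp add: euclidean_product_topology)
qed

lemma tendsto_fst_snd_within:
  "(fst \<longlongrightarrow> x) (at (x, h) within A)" "(snd \<longlongrightarrow> h) (at (x, h) within A)"
  using tendsto_fst[OF tendsto_ident_at[of "(x, h)"]] tendsto_snd[OF tendsto_ident_at[of "(x, h)"]]
  by simp_all

lemma tendsto_fst_snd_nhds: "(fst \<longlongrightarrow> x) (nhds (x, h))" "(snd \<longlongrightarrow> h) (nhds (x, h))"
  using tendsto_fst[OF filterlim_ident, of "(x, h)"] tendsto_snd[OF filterlim_ident, of "(x, h)"] by simp_all

lemma tendsto_apply:
  assumes "(f \<longlongrightarrow> l) F"
  shows "((\<lambda>t. f t i) \<longlongrightarrow> l i) F"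
  by (rule continuous_on_tendsto_compose[of UNIV "\<lambda>f. f i", OF _ assms]) auto

text \<open>Slopes over intervals are convex combinations of slopes over
  subintervals, so a slope outside \<open>C\<close> would persist under bisection.\<close>

lemma mvt_convex:
  fixes \<gamma> :: "real \<Rightarrow> 'f::locally_convex_space"
  assumes C: "open C" "convex C"
    and d: "\<And>s. s \<in> {0..1} \<Longrightarrow> \<exists>l\<in>C. ((\<lambda>t. (1 / t) *\<^sub>R (\<gamma> (s + t) - \<gamma> s)) \<longlongrightarrow> l) (at 0)"
  shows "\<gamma> 1 - \<gamma> 0 \<in> C"
proof -
  \<comment> \<open>A degenerate interval satisfies \<open>P\<close> vacuously, so that gluing and
    the local condition can be stated with weak inequalities, as bisection requires.\<close>
  define P where "P a b \<longleftrightarrow> (a < b \<longrightarrow> (1 / (b - a)) *\<^sub>R (\<gamma> b - \<gamma> a) \<in> C)" for a b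
  have comb: "P a c" if "P a b" "P b c" "a \<le> b" "b \<le> c" for a b c
  proof (cases "a < b \<and> b < c")
    case True
    then have "a < c" by simp
    have "((b - a) / (c - a)) *\<^sub>R ((1 / (b - a)) *\<^sub>R (\<gamma> b - \<gamma> a))
        + ((c - b) / (c - a)) *\<^sub>R ((1 / (c - b)) *\<^sub>R (\<gamma> c - \<gamma> b)) \<in> C"
    proof (rule convexD[OF C(2)])
      show "(b - a) / (c - a) + (c - b) / (c - a) = 1"
        using \<open>a < c\<close> by (simp add: add_divide_distrib[symmetric])
    qed (use True that in \<open>auto simp: P_def\<close>)
    also have "((b - a) / (c - a)) *\<^sub>R ((1 / (b - a)) *\<^sub>R (\<gamma> b - \<gamma> a))
        + ((c - b) / (c - a)) *\<^sub>R ((1 / (c - b)) *\<^sub>R (\<gamma> c - \<gamma> b)) = (1 / (c - a)) *\<^sub>R (\<gamma> c - \<gamma> a)"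
    proof -
      have "((b - a) / (c - a)) * (1 / (b - a)) = 1 / (c - a)" "((c - b) / (c - a)) * (1 / (c - b)) = 1 / (c - a)"
        using True by (simp_all add: field_simps)
      moreover have "p *\<^sub>R q *\<^sub>R u + p' *\<^sub>R q' *\<^sub>R w = r *\<^sub>R (u + w)"
        if "p * q = r" "p' * q' = r" for p q p' q' r and u w :: 'f
        using that by (simp add: scaleR_add_right)
      ultimately show ?thesis
        by (metis diff_add_cancel add_diff_eq add.commute)
    qed
    finally show ?thesis by (simp add: P_def)
  next
    case False
    then have "a = b \<or> b = c" using that by auto
    then show ?thesis using that by auto
  qed
  have "P 0 1"
  proof (rule Bolzano)
    fix x :: real assume "0 \<le> x" "x \<le> 1"
    then obtain l where l: "l \<in> C" "((\<lambda>t. (1 / t) *\<^sub>R (\<gamma> (x + t) - \<gamma> x)) \<longlongrightarrow> l) (at 0)"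
      using d[of x] by auto
    then have "\<forall>\<^sub>F t in at 0. (1 / t) *\<^sub>R (\<gamma> (x + t) - \<gamma> x) \<in> C"
      using C(1) by (auto simp: tendsto_def)
    then obtain e where e: "e > 0" "\<And>t. t \<noteq> 0 \<Longrightarrow> \<bar>t\<bar> < e \<Longrightarrow> (1 / t) *\<^sub>R (\<gamma> (x + t) - \<gamma> x) \<in> C"
      by (auto simp: eventually_at dist_real_def)
    \<comment> \<open>The derivative at \<open>x\<close> controls only slopes with endpoint
      \<open>x\<close>; an interval around \<open>x\<close> is therefore cut there and glued
      again.\<close>
    have "P a b" if ab: "a \<le> x" "x \<le> b" "b - a < e" for a b
    proof -
      have "P a x"
        unfolding P_def
      proof
        assume "a < x"
        then have "(1 / (a - x)) *\<^sub>R (\<gamma> a - \<gamma> x) \<in> C"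
          using e(2)[of "a - x"] ab by auto
        also have "(1 / (a - x)) *\<^sub>R (\<gamma> a - \<gamma> x) = (1 / (x - a)) *\<^sub>R (\<gamma> x - \<gamma> a)"
        proof -
          have "1 / (a - x) = - (1 / (x - a))"
            by (metis minus_diff_eq minus_divide_right)
          moreover have "(- r) *\<^sub>R (u - w) = r *\<^sub>R (w - u)" for r and u w :: 'f
            by (simp add: scaleR_diff_right)
          ultimately show ?thesis by metis
        qed
        finally show "(1 / (x - a)) *\<^sub>R (\<gamma> x - \<gamma> a) \<in> C" .
      qed
      moreover have "P x b"
        unfolding P_def using e(2)[of "b - x"] ab by auto
      ultimately show ?thesis
        using comb ab by blast
    qed
    then show "\<exists>d>0. \<forall>a b. a \<le> x \<and> x \<le> b \<and> b - a < d \<longrightarrow> P a b"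
      using e(1) by blast
  qed (use comb in auto)
  then show ?thesis by (simp add: P_def)
qed

section \<open>Directional derivatives and smooth maps\<close>

lemma dir_deriv_eqI:
  "(dir_quot f x h \<longlongrightarrow> l) (at 0) \<Longrightarrow> dir_deriv f x h = l"
  unfolding dir_deriv_def by (rule tendsto_Lim) auto

lemma dir_differentiableI:
  "(dir_quot f x h \<longlongrightarrow> l) (at 0) \<Longrightarrow> dir_differentiable f x h"
  unfolding dir_differentiable_def by blast

lemma dir_quot_ident: "(dir_quot (\<lambda>y. y) x k \<longlongrightarrow> k) (at 0)"
  by (rule tendsto_eventually) (simp add: dir_quot_def eventually_at_filter)

lemma dir_deriv_tendsto:
  "dir_differentiable f x h \<Longrightarrow> (dir_quot f x h \<longlongrightarrow> dir_deriv f x h) (at 0)"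
  unfolding dir_differentiable_def using dir_deriv_eqI by metis

lemma eventually_line:
  fixes x h :: "'e::locally_convex_space"
  assumes "open U" "x \<in> U"
  shows "\<forall>\<^sub>F t in at 0. x + t *\<^sub>R h \<in> U"
proof -
  have "((\<lambda>t. x + t *\<^sub>R h) \<longlongrightarrow> x + 0 *\<^sub>R h) (at 0)"
    by (intro tendsto_add tendsto_const lcs_tendsto_scaleR tendsto_ident_at)
  then show ?thesis
    using assms by (auto simp: tendsto_def)
qed

lemma dir_quot_cong:
  assumes "open U" "x \<in> U" "\<And>y. y \<in> U \<Longrightarrow> f y = g y"
  shows "\<forall>\<^sub>F t in at 0. dir_quot f x h t = dir_quot g x h t"
  using eventually_line[OF assms(1,2), of h]
  by eventually_elim (simp add: dir_quot_def assms)

lemma dir_deriv_cong: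
  assumes "open U" "x \<in> U" "\<And>y. y \<in> U \<Longrightarrow> f y = g y"
  shows "dir_deriv f x h = dir_deriv g x h"
    and "dir_differentiable f x h \<longleftrightarrow> dir_differentiable g x h"
proof -
  have "(dir_quot f x h \<longlongrightarrow> l) (at 0) \<longleftrightarrow> (dir_quot g x h \<longlongrightarrow> l) (at 0)" for l
    using tendsto_cong[OF dir_quot_cong[OF assms]] by auto
  then show "dir_deriv f x h = dir_deriv g x h"
    and "dir_differentiable f x h \<longleftrightarrow> dir_differentiable g x h"
    unfolding dir_deriv_def dir_differentiable_def Topological_Spaces.Lim_def by auto
qed

lemma iter_deriv_cong:
  assumes "open U" "\<And>y. y \<in> U \<Longrightarrow> f y = g y" "x \<in> U"
  shows "iter_deriv j f x h = iter_deriv j g x h"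
  using assms(3)
proof (induction j arbitrary: x)
  case (Suc j)
  then show ?case
    using dir_deriv_cong(1)[OF assms(1), of x "\<lambda>y. iter_deriv j f y h" "\<lambda>y. iter_deriv j g y h" "h j"]
    by simp
qed (simp add: assms(2))

lemma iter_deriv_cong_dirs:
  assumes "\<And>i. i < j \<Longrightarrow> h i = h' i"
  shows "iter_deriv j f x h = iter_deriv j f x h'"
  using assms
proof (induction j arbitrary: x)
  case (Suc j)
  then have "(\<lambda>y. iter_deriv j f y h) = (\<lambda>y. iter_deriv j f y h')"
    by (metis less_SucI)
  then show ?case using Suc.prems[of j] by simp
qed simp

abbreviation smooth_on ::
    "'e::locally_convex_space set \<Rightarrow> ('e \<Rightarrow> 'f::locally_convex_space) \<Rightarrow> bool" where
  "smooth_on \<equiv> Ck_on \<infinity>"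

lemma smooth_on_def:
  "smooth_on U f \<longleftrightarrow> open U \<and>
    (\<forall>j. \<forall>x\<in>U. \<forall>h. dir_differentiable (\<lambda>y. iter_deriv j f y h) x (h j)) \<and>
    (\<forall>j. continuous_on (U \<times> UNIV) (\<lambda>(x, h). iter_deriv j f x h))"
  unfolding Ck_on_def by simp

lemma smooth_on_open: "smooth_on U f \<Longrightarrow> open U"
  by (simp add: smooth_on_def)

text \<open>The definition ties the next direction to the entry \<open>h j\<close>. As the
  derivative of order \<open>j\<close> ignores that entry, it may be overwritten by any
  \<open>k\<close>.\<close>

lemma smooth_on_differentiable:
  assumes "smooth_on U f" "x \<in> U"
  shows "dir_differentiable (\<lambda>y. iter_deriv j f y h) x k"
proof -
  have "dir_differentiable (\<lambda>y. iter_deriv j f y (h(j := k))) x ((h(j := k)) j)"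
    using assms unfolding smooth_on_def by blast
  moreover have "(\<lambda>y. iter_deriv j f y (h(j := k))) = (\<lambda>y. iter_deriv j f y h)"
    by (intro ext iter_deriv_cong_dirs) auto
  ultimately show ?thesis by simp
qed

lemma smooth_on_iter_continuous:
  "smooth_on U f \<Longrightarrow> continuous_on (U \<times> UNIV) (\<lambda>(x, h). iter_deriv j f x h)"
  by (simp add: smooth_on_def)

lemma smooth_on_cong:
  assumes "smooth_on U f" "\<And>x. x \<in> U \<Longrightarrow> f x = g x"
  shows "smooth_on U g"
proof -
  have U: "open U" using assms(1) by (rule smooth_on_open)
  have eq: "iter_deriv j g x h = iter_deriv j f x h" if "x \<in> U" for j x h
    using iter_deriv_cong[OF U _ that, of g f] assms(2) by simp
  show ?thesis
    unfolding smooth_on_def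
  proof (intro conjI allI ballI)
    fix j x h assume x: "x \<in> U"
    show "dir_differentiable (\<lambda>y. iter_deriv j g y h) x (h j)"
      using dir_deriv_cong(2)[OF U x, of "\<lambda>y. iter_deriv j g y h" "\<lambda>y. iter_deriv j f y h"] eq
        smooth_on_differentiable[OF assms(1) x] by blast
  next
    fix j
    show "continuous_on (U \<times> UNIV) (\<lambda>(x, h). iter_deriv j g x h)"
      using smooth_on_iter_continuous[OF assms(1), of j]
      by (rule continuous_on_eq) (auto simp: eq)
  qed (rule U)
qed

lemma smooth_on_local:
  assumes "\<And>x. x \<in> U \<Longrightarrow> \<exists>W. x \<in> W \<and> W \<subseteq> U \<and> smooth_on W f"
  shows "smooth_on U f"
proof -
  let ?\<W> = "{W. W \<subseteq> U \<and> smooth_on W f}"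
  have U: "U = \<Union>?\<W>"
    using assms by blast
  have op: "open W" if "W \<in> ?\<W>" for W
    using that smooth_on_open by blast
  have "continuous_on (\<Union>W\<in>?\<W>. W \<times> UNIV) (\<lambda>(x, h). iter_deriv j f x h)" for j
    by (rule continuous_on_open_UN) (auto intro: smooth_on_iter_continuous open_Times smooth_on_open)
  moreover have "(\<Union>W\<in>?\<W>. W \<times> UNIV) = U \<times> (UNIV :: (nat \<Rightarrow> 'a) set)"
    using U by auto
  ultimately have "continuous_on (U \<times> UNIV) (\<lambda>(x, h). iter_deriv j f x h)" for j
    by simp
  moreover have "open U"
    using op by (subst U) (rule open_Union, auto)
  moreover have "dir_differentiable (\<lambda>y. iter_deriv j f y h) x (h j)" if "x \<in> U" for j x h
    using assms[OF that] smooth_on_differentiable by blast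
  ultimately show ?thesis
    unfolding smooth_on_def by blast
qed

lemma smooth_on_subset:
  assumes "smooth_on U f" "open W" "W \<subseteq> U"
  shows "smooth_on W f"
  using assms unfolding smooth_on_def
  by (auto intro: continuous_on_subset[of "U \<times> UNIV"])

text \<open>Entries from \<open>m\<close> on are reset to 0, which gives convergence in the full
  product topology. In this form joint continuity applies to directions about which only the first
  \<open>m\<close> entries are known.\<close>

lemma smooth_on_tendsto:
  assumes f: "smooth_on U f" and x: "x \<in> U" and y: "(y \<longlongrightarrow> x) F"
    and z: "\<And>i. i < m \<Longrightarrow> ((\<lambda>t. z t i) \<longlongrightarrow> h i) F"
  shows "((\<lambda>t. iter_deriv m f (y t) (z t)) \<longlongrightarrow> iter_deriv m f x h) F"
proof -
  define z' where "z' t i = (if i < m then z t i else 0)" for t i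
  define h' where "h' i = (if i < m then h i else 0)" for i
  have "(z' \<longlongrightarrow> h') F"
    by (rule tendsto_funI) (auto simp: z'_def h'_def z)
  then have "((\<lambda>t. (y t, z' t)) \<longlongrightarrow> (x, h')) F"
    using y by (intro tendsto_Pair)
  moreover have "\<forall>\<^sub>F t in F. (y t, z' t) \<in> U \<times> UNIV"
    using y x smooth_on_open[OF f] by (auto simp: tendsto_def)
  ultimately have "((\<lambda>t. (\<lambda>(x, h). iter_deriv m f x h) (y t, z' t)) \<longlongrightarrow>
      (\<lambda>(x, h). iter_deriv m f x h) (x, h')) F"
    using x by (intro continuous_on_tendsto_compose[OF smooth_on_iter_continuous[OF f]]) auto
  then have "((\<lambda>t. iter_deriv m f (y t) (z' t)) \<longlongrightarrow> iter_deriv m f x h') F"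
    by simp
  moreover have "iter_deriv m f x h' = iter_deriv m f x h"
    by (rule iter_deriv_cong_dirs) (simp add: h'_def)
  moreover have "iter_deriv m f (y t) (z' t) = iter_deriv m f (y t) (z t)" for t
    by (rule iter_deriv_cong_dirs) (simp add: z'_def)
  ultimately show ?thesis by simp
qed

lemma smooth_on_continuous:
  assumes "smooth_on U f"
  shows "continuous_on U f"
proof -
  have "((\<lambda>y. iter_deriv 0 f y (\<lambda>_. 0)) \<longlongrightarrow> iter_deriv 0 f x (\<lambda>_. 0)) (at x within U)" if "x \<in> U" for x
    by (rule smooth_on_tendsto[OF assms that]) auto
  then show ?thesis
    by (simp add: continuous_on_def)
qed

lemma iter_deriv_iter_deriv:
  "iter_deriv j (\<lambda>y. iter_deriv m f y z) x h = iter_deriv (m + j) f x (\<lambda>i. if i < m then z i else h (i - m))"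
proof (induction j arbitrary: x)
  case 0
  show ?case by (simp, rule iter_deriv_cong_dirs) simp
qed simp

lemma smooth_on_iter_deriv:
  assumes "smooth_on U f"
  shows "smooth_on U (\<lambda>y. iter_deriv m f y z)"
  unfolding smooth_on_def
proof (intro conjI allI ballI)
  fix j x h assume "x \<in> U"
  then show "dir_differentiable (\<lambda>y. iter_deriv j (\<lambda>y. iter_deriv m f y z) y h) x (h j)"
    unfolding iter_deriv_iter_deriv by (rule smooth_on_differentiable[OF assms])
next
  fix j
  have "((\<lambda>p. iter_deriv (m + j) f (fst p) (\<lambda>i. if i < m then z i else snd p (i - m))) \<longlongrightarrow>
      iter_deriv (m + j) f x (\<lambda>i. if i < m then z i else h (i - m))) (at (x, h) within U \<times> UNIV)" if "x \<in> U" for x h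
  proof (rule smooth_on_tendsto[OF assms that])
    show "(fst \<longlongrightarrow> x) (at (x, h) within U \<times> UNIV)"
      by (rule tendsto_fst_snd_within)
    have "((\<lambda>p. snd p (i - m)) \<longlongrightarrow> h (i - m)) (at (x, h) within U \<times> UNIV)" for i
      by (rule tendsto_apply[OF tendsto_fst_snd_within(2)])
    then show "((\<lambda>p. if i < m then z i else snd p (i - m)) \<longlongrightarrow> (if i < m then z i else h (i - m)))
        (at (x, h) within U \<times> UNIV)" for i
      by auto
  qed
  then show "continuous_on (U \<times> UNIV) (\<lambda>(x, h). iter_deriv j (\<lambda>y. iter_deriv m f y z) x h)"
    unfolding iter_deriv_iter_deriv continuous_on_def by (simp add: case_prod_unfold cong: if_cong)
qed (use assms smooth_on_open in blast)

lemma dir_deriv_eq_iter_deriv: "dir_deriv f x k = iter_deriv 1 f x (\<lambda>_. k)"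
  by simp

lemma smooth_on_dir_deriv: "smooth_on U f \<Longrightarrow> smooth_on U (\<lambda>y. dir_deriv f y k)"
  unfolding dir_deriv_eq_iter_deriv by (rule smooth_on_iter_deriv)

lemma smooth_on_dir_differentiable:
  "smooth_on U f \<Longrightarrow> x \<in> U \<Longrightarrow> dir_differentiable f x k"
  using smooth_on_differentiable[of U f x 0] by simp

lemma smooth_on_dir_deriv_tendsto:
  assumes "smooth_on U f" "x \<in> U" "(y \<longlongrightarrow> x) F" "(k \<longlongrightarrow> h) F"
  shows "((\<lambda>t. dir_deriv f (y t) (k t)) \<longlongrightarrow> dir_deriv f x h) F"
  unfolding dir_deriv_eq_iter_deriv by (rule smooth_on_tendsto) (use assms in auto)

section \<open>Mean value estimates and strict differentiability\<close>

lemma filterlim_mult_at_0: "r \<noteq> 0 \<Longrightarrow> filterlim (\<lambda>t::real. t * r) (at 0) (at 0)"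
  by (auto simp: filterlim_at eventually_at_filter intro!: tendsto_eq_intros)

lemma filterlim_uminus_at_0: "filterlim (\<lambda>t::real. - t) (at 0) (at 0)"
  by (auto simp: filterlim_at eventually_at_filter intro!: tendsto_eq_intros)

lemma mvt_dir_quot:
  fixes f :: "'e::locally_convex_space \<Rightarrow> 'f::locally_convex_space"
  assumes C: "open C" "convex C" and t: "t \<noteq> 0"
    and d: "\<And>s. s \<in> {0..1} \<Longrightarrow>
      dir_differentiable f (x + (s * t) *\<^sub>R k) k \<and> dir_deriv f (x + (s * t) *\<^sub>R k) k \<in> C"
  shows "dir_quot f x k t \<in> C"
proof -
  \<comment> \<open>Dividing by \<open>t\<close> beforehand makes the derivative of the curve the
    directional derivative itself, and its increment over the unit interval the difference
    quotient.\<close>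
  define \<gamma> where "\<gamma> s = (1 / t) *\<^sub>R f (x + (s * t) *\<^sub>R k)" for s
  have "\<gamma> 1 - \<gamma> 0 \<in> C"
  proof (rule mvt_convex[OF C])
    fix s :: real assume s: "s \<in> {0..1}"
    let ?y = "x + (s * t) *\<^sub>R k"
    have "((\<lambda>r. dir_quot f ?y k (r * t)) \<longlongrightarrow> dir_deriv f ?y k) (at 0)"
      using d[OF s] by (intro filterlim_compose[OF dir_deriv_tendsto filterlim_mult_at_0[OF t]]) simp
    moreover have "dir_quot f ?y k (r * t) = (1 / r) *\<^sub>R (\<gamma> (s + r) - \<gamma> s)" for r
      by (simp add: dir_quot_def \<gamma>_def algebra_simps)
    ultimately show "\<exists>l\<in>C. ((\<lambda>r. (1 / r) *\<^sub>R (\<gamma> (s + r) - \<gamma> s)) \<longlongrightarrow> l) (at 0)"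
      using d[OF s] by auto
  qed
  then show ?thesis
    by (simp add: \<gamma>_def dir_quot_def algebra_simps)
qed

text \<open>Near \<open>(x, h)\<close> the first derivative stays in a convex neighbourhood
  \<open>C\<close> of its value, by joint continuity. The segment from \<open>y t\<close> to
  \<open>y t + \<tau> t *\<^sub>R k t\<close> lies in a convex neighbourhood of \<open>x\<close>, so
  the mean value estimate puts the quotient into \<open>C\<close> although base point, direction and
  step all vary.\<close>

lemma strictly_differentiable:
  fixes f :: "'e::locally_convex_space \<Rightarrow> 'f::locally_convex_space"
  assumes f: "smooth_on U f" and x: "x \<in> U" and y: "(y \<longlongrightarrow> x) F" and k: "(k \<longlongrightarrow> h) F"
    and \<tau>: "(\<tau> \<longlongrightarrow> 0) F" "\<forall>\<^sub>F t in F. \<tau> t \<noteq> 0"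
  shows "((\<lambda>t. dir_quot f (y t) (k t) (\<tau> t)) \<longlongrightarrow> dir_deriv f x h) F"
proof (rule topological_tendstoI)
  fix S assume "open S" "dir_deriv f x h \<in> S"
  then obtain C where C: "open C" "convex C" "dir_deriv f x h \<in> C" "C \<subseteq> S"
    by (rule convex_open_nbhd)
  have "((\<lambda>p. dir_deriv f (fst p) (snd p)) \<longlongrightarrow> dir_deriv f x h) (nhds (x, h))"
    by (rule smooth_on_dir_deriv_tendsto[OF f x])
      (rule tendsto_fst_snd_nhds)+
  then have "\<forall>\<^sub>F p in nhds (x, h). dir_deriv f (fst p) (snd p) \<in> C"
    using C by (auto simp: tendsto_def)
  then obtain T where T: "open T" "(x, h) \<in> T" "\<And>p. p \<in> T \<Longrightarrow> dir_deriv f (fst p) (snd p) \<in> C"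
    by (auto simp: eventually_nhds)
  obtain A B where AB: "open A" "open B" "x \<in> A" "h \<in> B" "A \<times> B \<subseteq> T"
    using open_prod_elim[OF T(1,2)] by (metis mem_Sigma_iff)
  obtain W where W: "open W" "convex W" "x \<in> W" "W \<subseteq> A \<inter> U"
    using convex_open_nbhd[of "A \<inter> U" x] AB(1,3) x smooth_on_open[OF f] by blast
  have "((\<lambda>t. y t + \<tau> t *\<^sub>R k t) \<longlongrightarrow> x + 0 *\<^sub>R h) F"
    by (intro tendsto_add y lcs_tendsto_scaleR \<tau> k)
  then have "\<forall>\<^sub>F t in F. y t + \<tau> t *\<^sub>R k t \<in> W"
    using W by (auto simp: tendsto_def)
  moreover have "\<forall>\<^sub>F t in F. y t \<in> W" "\<forall>\<^sub>F t in F. k t \<in> B"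
    using W AB y k by (auto simp: tendsto_def)
  ultimately show "\<forall>\<^sub>F t in F. dir_quot f (y t) (k t) (\<tau> t) \<in> S"
    using \<tau>(2)
  proof eventually_elim
    case (elim t)
    have "dir_quot f (y t) (k t) (\<tau> t) \<in> C"
    proof (rule mvt_dir_quot[OF C(1,2) elim(4)])
      fix s :: real assume "s \<in> {0..1}"
      then have "(1 - s) *\<^sub>R y t + s *\<^sub>R (y t + \<tau> t *\<^sub>R k t) \<in> W"
        using elim W(2) by (intro convexD) auto
      then have "y t + (s * \<tau> t) *\<^sub>R k t \<in> W"
        by (simp add: algebra_simps)
      then show "dir_differentiable f (y t + (s * \<tau> t) *\<^sub>R k t) (k t) \<and>
          dir_deriv f (y t + (s * \<tau> t) *\<^sub>R k t) (k t) \<in> C"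
        using W(4) AB(5) elim(3) T(3)[of "(y t + (s * \<tau> t) *\<^sub>R k t, k t)"]
          smooth_on_dir_differentiable[OF f] by (auto simp: subset_iff)
    qed
    then show ?case using C(4) by blast
  qed
qed

section \<open>Multilinearity of higher derivatives and the chain rule along curves\<close>

lemma dir_deriv_scaleR:
  assumes "dir_differentiable f x h"
  shows "dir_differentiable f x (r *\<^sub>R h)" "dir_deriv f x (r *\<^sub>R h) = r *\<^sub>R dir_deriv f x h"
proof -
  have "(dir_quot f x (r *\<^sub>R h) \<longlongrightarrow> r *\<^sub>R dir_deriv f x h) (at 0)"
  proof (cases "r = 0")
    case True
    then have "dir_quot f x (r *\<^sub>R h) = (\<lambda>t. 0)"
      by (simp add: dir_quot_def fun_eq_iff)
    then show ?thesis using True by simp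
  next
    case False
    have "((\<lambda>t. dir_quot f x h (t * r)) \<longlongrightarrow> dir_deriv f x h) (at 0)"
      by (rule filterlim_compose[OF dir_deriv_tendsto[OF assms] filterlim_mult_at_0[OF False]])
    then have "((\<lambda>t. r *\<^sub>R dir_quot f x h (t * r)) \<longlongrightarrow> r *\<^sub>R dir_deriv f x h) (at 0)"
      by (intro lcs_tendsto_scaleR tendsto_const)
    moreover have "r *\<^sub>R dir_quot f x h (t * r) = dir_quot f x (r *\<^sub>R h) t" for t
      using False by (simp add: dir_quot_def)
    ultimately show ?thesis by simp
  qed
  then show "dir_differentiable f x (r *\<^sub>R h)" "dir_deriv f x (r *\<^sub>R h) = r *\<^sub>R dir_deriv f x h"
    by (auto intro: dir_differentiableI dir_deriv_eqI)
qed

text \<open>Splitting the increment \<open>t (h + k)\<close> into two steps, the second step starts at the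
  moving point \<open>x + t h\<close>; this is why strict differentiability is needed.\<close>

lemma smooth_on_dir_deriv_add:
  assumes f: "smooth_on U f" and x: "x \<in> U"
  shows "dir_deriv f x (h + k) = dir_deriv f x h + dir_deriv f x k"
proof (rule dir_deriv_eqI)
  have "((\<lambda>t. dir_quot f (x + t *\<^sub>R h) k t) \<longlongrightarrow> dir_deriv f x k) (at 0)"
  proof (rule strictly_differentiable[OF f x])
    have "((\<lambda>t. x + t *\<^sub>R h) \<longlongrightarrow> x + 0 *\<^sub>R h) (at 0)"
      by (intro tendsto_add tendsto_const lcs_tendsto_scaleR tendsto_ident_at)
    then show "((\<lambda>t. x + t *\<^sub>R h) \<longlongrightarrow> x) (at 0)" by simp
  qed (auto simp: eventually_at_filter)
  moreover have "(dir_quot f x h \<longlongrightarrow> dir_deriv f x h) (at 0)"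
    using smooth_on_dir_differentiable[OF f x] by (rule dir_deriv_tendsto)
  ultimately have "((\<lambda>t. dir_quot f x h t + dir_quot f (x + t *\<^sub>R h) k t) \<longlongrightarrow> dir_deriv f x h + dir_deriv f x k) (at 0)"
    by (intro tendsto_add)
  moreover have "dir_quot f x h t + dir_quot f (x + t *\<^sub>R h) k t = dir_quot f x (h + k) t" for t
    by (simp add: dir_quot_def scaleR_add_right[symmetric] add.assoc del: scaleR_add_right)
  ultimately show "(dir_quot f x (h + k) \<longlongrightarrow> dir_deriv f x h + dir_deriv f x k) (at 0)"
    by simp
qed

lemma dir_quot_add: "dir_quot (\<lambda>y. f y + g y) x h t = dir_quot f x h t + dir_quot g x h t"
  by (simp add: dir_quot_def algebra_simps)

lemma dir_deriv_add:
  assumes "dir_differentiable f x h" "dir_differentiable g x h"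
  shows "dir_deriv (\<lambda>y. f y + g y) x h = dir_deriv f x h + dir_deriv g x h"
proof (rule dir_deriv_eqI)
  show "(dir_quot (\<lambda>y. f y + g y) x h \<longlongrightarrow> dir_deriv f x h + dir_deriv g x h) (at 0)"
    using tendsto_add[OF dir_deriv_tendsto[OF assms(1)] dir_deriv_tendsto[OF assms(2)]]
    by (simp add: dir_quot_add[abs_def])
qed

lemma dir_deriv_cmult:
  assumes "dir_differentiable f x h"
  shows "dir_deriv (\<lambda>y. r *\<^sub>R f y) x h = r *\<^sub>R dir_deriv f x h"
proof (rule dir_deriv_eqI)
  have "((\<lambda>t. r *\<^sub>R dir_quot f x h t) \<longlongrightarrow> r *\<^sub>R dir_deriv f x h) (at 0)"
    by (intro lcs_tendsto_scaleR tendsto_const dir_deriv_tendsto assms)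
  moreover have "r *\<^sub>R dir_quot f x h t = dir_quot (\<lambda>y. r *\<^sub>R f y) x h t" for t
    by (simp add: dir_quot_def scaleR_diff_right mult.commute)
  ultimately show "(dir_quot (\<lambda>y. r *\<^sub>R f y) x h \<longlongrightarrow> r *\<^sub>R dir_deriv f x h) (at 0)"
    by simp
qed

text \<open>In the last slot this is additivity of a single directional derivative; for an earlier
  slot the identity of lower order, valid on the open set \<open>U\<close>, is differentiated once
  more.\<close>

lemma iter_deriv_add_dir:
  assumes f: "smooth_on U f" and "x \<in> U" "i < m"
  shows "iter_deriv m f x (h(i := a + b)) = iter_deriv m f x (h(i := a)) + iter_deriv m f x (h(i := b))"
  using assms(2,3)
proof (induction m arbitrary: x)
  case (Suc m)
  let ?F = "\<lambda>c y. iter_deriv m f y (h(i := c))"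
  show ?case
  proof (cases "i = m")
    case True
    then have "?F c = (\<lambda>y. iter_deriv m f y h)" for c
      by (intro ext iter_deriv_cong_dirs) auto
    then show ?thesis
      using smooth_on_dir_deriv_add[OF smooth_on_iter_deriv[OF f] \<open>x \<in> U\<close>, of m h a b]
      unfolding True iter_deriv.simps by (simp only: fun_upd_same)
  next
    case False
    then have "i < m" using Suc.prems by simp
    then have "dir_deriv (?F (a + b)) x (h m) = dir_deriv (\<lambda>y. ?F a y + ?F b y) x (h m)"
      using Suc.IH by (intro dir_deriv_cong(1)[OF smooth_on_open[OF f] \<open>x \<in> U\<close>])
    also have "\<dots> = dir_deriv (?F a) x (h m) + dir_deriv (?F b) x (h m)"
      using smooth_on_differentiable[OF f \<open>x \<in> U\<close>] by (intro dir_deriv_add)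
    finally show ?thesis using not_sym[OF False] by (simp only: iter_deriv.simps fun_upd_other simp_thms)
  qed
qed simp

lemma iter_deriv_scaleR_dir:
  assumes f: "smooth_on U f" and "x \<in> U" "i < m"
  shows "iter_deriv m f x (h(i := r *\<^sub>R a)) = r *\<^sub>R iter_deriv m f x (h(i := a))"
  using assms(2,3)
proof (induction m arbitrary: x)
  case (Suc m)
  let ?F = "\<lambda>c y. iter_deriv m f y (h(i := c))"
  show ?case
  proof (cases "i = m")
    case True
    then have "?F c = (\<lambda>y. iter_deriv m f y h)" for c
      by (intro ext iter_deriv_cong_dirs) auto
    then show ?thesis
      using dir_deriv_scaleR(2)[OF smooth_on_differentiable[OF f \<open>x \<in> U\<close>], of m h r a]
      unfolding True iter_deriv.simps by (simp only: fun_upd_same)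
  next
    case False
    then have "i < m" using Suc.prems by simp
    then have "dir_deriv (?F (r *\<^sub>R a)) x (h m) = dir_deriv (\<lambda>y. r *\<^sub>R ?F a y) x (h m)"
      using Suc.IH by (intro dir_deriv_cong(1)[OF smooth_on_open[OF f] \<open>x \<in> U\<close>])
    also have "\<dots> = r *\<^sub>R dir_deriv (?F a) x (h m)"
      using smooth_on_differentiable[OF f \<open>x \<in> U\<close>] by (intro dir_deriv_cmult)
    finally show ?thesis using not_sym[OF False] by (simp only: iter_deriv.simps fun_upd_other simp_thms)
  qed
qed simp

lemma iter_deriv_diff_dir:
  assumes f: "smooth_on U f" and "x \<in> U" "i < m"
  shows "iter_deriv m f x (h(i := a - b)) = iter_deriv m f x (h(i := a)) - iter_deriv m f x (h(i := b))"
  using iter_deriv_add_dir[OF assms, of h "a - b" b] by simp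

text \<open>The directions are exchanged one at a time, and multilinearity turns each exchange into
  a derivative with the difference in one slot. This yields both the product rule for moving
  directions and norm continuity in the directions.\<close>

lemma iter_deriv_telescope:
  assumes f: "smooth_on U f" and x: "x \<in> U"
  shows "iter_deriv m f x z' - iter_deriv m f x z =
    (\<Sum>i<m. iter_deriv m f x ((\<lambda>l. if l < i then z' l else z l)(i := z' i - z i)))"
proof -
  define Z where "Z i = (\<lambda>l. if l < i then z' l else z l)" for i :: nat
  have "iter_deriv m f x (Z (Suc i)) - iter_deriv m f x (Z i) = iter_deriv m f x ((Z i)(i := z' i - z i))"
    if "i < m" for i
  proof -
    have "Z (Suc i) = (Z i)(i := z' i)" "Z i = (Z i)(i := z i)"
      by (auto simp: Z_def fun_eq_iff)
    then show ?thesis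
      using iter_deriv_diff_dir[OF f x that, of "Z i" "z' i" "z i"] by simp
  qed
  then have "(\<Sum>i<m. iter_deriv m f x ((Z i)(i := z' i - z i))) =
      (\<Sum>i<m. iter_deriv m f x (Z (Suc i)) - iter_deriv m f x (Z i))"
    by simp
  also have "\<dots> = iter_deriv m f x (Z m) - iter_deriv m f x (Z 0)"
    by (rule sum_lessThan_telescope)
  also have "iter_deriv m f x (Z m) = iter_deriv m f x z'"
    by (rule iter_deriv_cong_dirs) (simp add: Z_def)
  also have "iter_deriv m f x (Z 0) = iter_deriv m f x z"
    by (rule iter_deriv_cong_dirs) (simp add: Z_def)
  finally show ?thesis unfolding Z_def by (rule sym)
qed

text \<open>The increment is split at \<open>(y t, z0)\<close>: first the base point moves with
  frozen directions, which is strict differentiability, then the directions move at the base point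
  already reached, which is the telescope sum together with joint continuity.\<close>

lemma iter_deriv_curve:
  fixes f :: "'e::locally_convex_space \<Rightarrow> 'f::locally_convex_space"
  assumes f: "smooth_on U f" and x: "x \<in> U"
    and \<tau>: "(\<tau> \<longlongrightarrow> 0) F" "\<forall>\<^sub>F t in F. \<tau> t \<noteq> 0"
    and y: "((\<lambda>t. (1 / \<tau> t) *\<^sub>R (y t - x)) \<longlongrightarrow> k) F"
    and z: "\<And>i. i < m \<Longrightarrow> ((\<lambda>t. (1 / \<tau> t) *\<^sub>R (z t i - z0 i)) \<longlongrightarrow> w i) F"
  shows "((\<lambda>t. (1 / \<tau> t) *\<^sub>R (iter_deriv m f (y t) (z t) - iter_deriv m f x z0)) \<longlongrightarrow>
      iter_deriv (Suc m) f x (z0(m := k)) + (\<Sum>i<m. iter_deriv m f x (z0(i := w i)))) F"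
proof -
  \<comment> \<open>A convergent difference quotient forces convergence of the curve, because
    \<open>u t\<close> is \<open>a\<close> plus \<open>\<tau> t\<close> times the quotient.\<close>
  have lim: "(u \<longlongrightarrow> a) F" if "((\<lambda>t. (1 / \<tau> t) *\<^sub>R (u t - a)) \<longlongrightarrow> b) F" for u and a b :: 'e
  proof -
    have "((\<lambda>t. a + \<tau> t *\<^sub>R (1 / \<tau> t) *\<^sub>R (u t - a)) \<longlongrightarrow> a + 0 *\<^sub>R b) F"
      by (intro tendsto_add tendsto_const lcs_tendsto_scaleR \<tau> that)
    moreover have "\<forall>\<^sub>F t in F. a + \<tau> t *\<^sub>R (1 / \<tau> t) *\<^sub>R (u t - a) = u t"
      using \<tau>(2) by eventually_elim simp
    ultimately show ?thesis
      by (simp add: tendsto_cong)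
  qed
  have yx: "(y \<longlongrightarrow> x) F" using lim[OF y] .
  have zz: "((\<lambda>t. z t i) \<longlongrightarrow> z0 i) F" if "i < m" for i using lim[OF z[OF that]] .
  have yU: "\<forall>\<^sub>F t in F. y t \<in> U"
    using yx x smooth_on_open[OF f] by (auto simp: tendsto_def)
  define f' where "f' y = iter_deriv m f y z0" for y
  have f': "smooth_on U f'"
    unfolding f'_def using f by (rule smooth_on_iter_deriv)
  have "((\<lambda>t. dir_quot f' x ((1 / \<tau> t) *\<^sub>R (y t - x)) (\<tau> t)) \<longlongrightarrow> dir_deriv f' x k) F"
    by (rule strictly_differentiable[OF f' x tendsto_const y \<tau>])
  moreover have "dir_deriv f' x k = iter_deriv (Suc m) f x (z0(m := k))"
  proof -
    have "f' = (\<lambda>y. iter_deriv m f y (z0(m := k)))"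
      unfolding f'_def by (intro ext iter_deriv_cong_dirs) auto
    then show ?thesis by simp
  qed
  ultimately have 1: "((\<lambda>t. dir_quot f' x ((1 / \<tau> t) *\<^sub>R (y t - x)) (\<tau> t)) \<longlongrightarrow> iter_deriv (Suc m) f x (z0(m := k))) F"
    by simp
  have 2: "((\<lambda>t. \<Sum>i<m. iter_deriv m f (y t) ((\<lambda>l. if l < i then z t l else z0 l)(i := (1 / \<tau> t) *\<^sub>R (z t i - z0 i))))
      \<longlongrightarrow> (\<Sum>i<m. iter_deriv m f x (z0(i := w i)))) F"
  proof (rule tendsto_sum)
    fix i assume "i \<in> {..<m}"
    then have i: "i < m" by simp
    show "((\<lambda>t. iter_deriv m f (y t) ((\<lambda>l. if l < i then z t l else z0 l)(i := (1 / \<tau> t) *\<^sub>R (z t i - z0 i))))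
      \<longlongrightarrow> iter_deriv m f x (z0(i := w i))) F"
    proof (rule smooth_on_tendsto[OF f x yx])
      fix l assume "l < m"
      then show "((\<lambda>t. ((\<lambda>l. if l < i then z t l else z0 l)(i := (1 / \<tau> t) *\<^sub>R (z t i - z0 i))) l) \<longlongrightarrow> (z0(i := w i)) l) F"
        using z[OF i] zz[of l] by (cases "l = i"; cases "l < i") auto
    qed
  qed
  have "\<forall>\<^sub>F t in F. dir_quot f' x ((1 / \<tau> t) *\<^sub>R (y t - x)) (\<tau> t) +
      (\<Sum>i<m. iter_deriv m f (y t) ((\<lambda>l. if l < i then z t l else z0 l)(i := (1 / \<tau> t) *\<^sub>R (z t i - z0 i)))) =
      (1 / \<tau> t) *\<^sub>R (iter_deriv m f (y t) (z t) - iter_deriv m f x z0)"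
    using yU \<tau>(2)
  proof eventually_elim
    case (elim t)
    have "(\<Sum>i<m. iter_deriv m f (y t) ((\<lambda>l. if l < i then z t l else z0 l)(i := (1 / \<tau> t) *\<^sub>R (z t i - z0 i)))) =
        (1 / \<tau> t) *\<^sub>R (\<Sum>i<m. iter_deriv m f (y t) ((\<lambda>l. if l < i then z t l else z0 l)(i := z t i - z0 i)))"
      unfolding scaleR_sum_right
      by (intro sum.cong refl iter_deriv_scaleR_dir[OF f elim(1)]) auto
    also have "\<dots> = (1 / \<tau> t) *\<^sub>R (iter_deriv m f (y t) (z t) - iter_deriv m f (y t) z0)"
      using iter_deriv_telescope[OF f elim(1), of m "z t" z0] by simp
    finally show ?case
      using elim(2) by (simp add: dir_quot_def f'_def scaleR_add_right[symmetric] del: scaleR_add_right)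
  qed
  then show ?thesis
    using tendsto_cong tendsto_add[OF 1 2] by fast
qed

lemma smooth_on_chain:
  assumes "smooth_on U f" "x \<in> U" "(\<tau> \<longlongrightarrow> 0) F" "\<forall>\<^sub>F t in F. \<tau> t \<noteq> 0"
    and "((\<lambda>t. (1 / \<tau> t) *\<^sub>R (y t - x)) \<longlongrightarrow> k) F"
  shows "((\<lambda>t. (1 / \<tau> t) *\<^sub>R (f (y t) - f x)) \<longlongrightarrow> dir_deriv f x k) F"
  using iter_deriv_curve[OF assms, of 0 undefined undefined undefined] by simp

text \<open>The mean value estimate is used twice: in direction \<open>h\<close> for the increment
  of \<open>f\<close> along \<open>k\<close>, then in direction \<open>k\<close> for the derivative
  along \<open>h\<close>.\<close>

lemma second_difference:
  fixes f :: "'e::locally_convex_space \<Rightarrow> 'f::locally_convex_space"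
  assumes f: "smooth_on U f" and x: "x \<in> U"
  shows "((\<lambda>t. (1 / t) *\<^sub>R (1 / t) *\<^sub>R (f (x + t *\<^sub>R h + t *\<^sub>R k) - f (x + t *\<^sub>R h) - f (x + t *\<^sub>R k) + f x))
    \<longlongrightarrow> dir_deriv (\<lambda>y. dir_deriv f y h) x k) (at 0)"
proof (rule topological_tendstoI)
  let ?D = "\<lambda>y. dir_deriv (\<lambda>y. dir_deriv f y h) y k"
  fix S assume "open S" "?D x \<in> S"
  then obtain C where C: "open C" "convex C" "?D x \<in> C" "C \<subseteq> S"
    by (rule convex_open_nbhd)
  have sh: "smooth_on U (\<lambda>y. dir_deriv f y h)" using smooth_on_dir_deriv[OF f] .
  have "continuous_on U ?D"
    using smooth_on_continuous[OF smooth_on_dir_deriv[OF sh]] .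
  then have "open (?D -` C \<inter> U)"
    using C(1) smooth_on_open[OF f] by (simp add: continuous_on_open_vimage)
  moreover have "x \<in> ?D -` C \<inter> U" using x C by simp
  ultimately obtain W where W: "open W" "convex W" "x \<in> W" "W \<subseteq> ?D -` C \<inter> U"
    by (rule convex_open_nbhd)
  have ev: "\<forall>\<^sub>F t in at 0. x + t *\<^sub>R h \<in> W" "\<forall>\<^sub>F t in at 0. x + t *\<^sub>R k \<in> W"
    "\<forall>\<^sub>F t in at 0. x + t *\<^sub>R (h + k) \<in> W" "\<forall>\<^sub>F t in at 0. t \<noteq> (0::real)"
    using eventually_line[OF W(1,3)] by (auto simp: eventually_at_filter)
  then show "\<forall>\<^sub>F t in at 0. (1 / t) *\<^sub>R (1 / t) *\<^sub>R (f (x + t *\<^sub>R h + t *\<^sub>R k) - f (x + t *\<^sub>R h) - f (x + t *\<^sub>R k) + f x) \<in> S"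
  proof eventually_elim
    case (elim t)
    \<comment> \<open>The point is a bilinear interpolation of the four corners of the
      parallelogram, all of which lie in the convex set \<open>W\<close>.\<close>
    have WD: "x + (s * t) *\<^sub>R h + (r * t) *\<^sub>R k \<in> W" if sr: "s \<in> {0..1}" "r \<in> {0..1}" for s r
    proof -
      have "(1 - s) *\<^sub>R ((1 - r) *\<^sub>R x + r *\<^sub>R (x + t *\<^sub>R k)) +
          s *\<^sub>R ((1 - r) *\<^sub>R (x + t *\<^sub>R h) + r *\<^sub>R (x + t *\<^sub>R (h + k))) \<in> W"
        using elim sr W(2,3) by (intro convexD) auto
      then show ?thesis by (simp add: algebra_simps)
    qed
    define \<phi> where "\<phi> y = (1 / t) *\<^sub>R (f (y + t *\<^sub>R k) - f y)" for y
    have "dir_quot \<phi> x h t \<in> C"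
    proof (rule mvt_dir_quot[OF C(1,2) elim(4)])
      fix s :: real assume s: "s \<in> {0..1}"
      let ?y = "x + (s * t) *\<^sub>R h"
      have y: "?y \<in> U" "?y + t *\<^sub>R k \<in> U"
        using WD[OF s, of 0] WD[OF s, of 1] W(4) by auto
      have "(dir_quot (\<lambda>y. f (y + t *\<^sub>R k)) ?y h \<longlongrightarrow> dir_deriv f (?y + t *\<^sub>R k) h) (at 0)"
        using dir_deriv_tendsto[OF smooth_on_dir_differentiable[OF f y(2)], of h]
        by (simp add: dir_quot_def[abs_def] algebra_simps)
      moreover have "(dir_quot f ?y h \<longlongrightarrow> dir_deriv f ?y h) (at 0)"
        using dir_deriv_tendsto[OF smooth_on_dir_differentiable[OF f y(1)], of h] .
      ultimately have "((\<lambda>r. (1 / t) *\<^sub>R (dir_quot (\<lambda>y. f (y + t *\<^sub>R k)) ?y h r - dir_quot f ?y h r))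
          \<longlongrightarrow> (1 / t) *\<^sub>R (dir_deriv f (?y + t *\<^sub>R k) h - dir_deriv f ?y h)) (at 0)"
        by (intro lcs_tendsto_scaleR tendsto_const tendsto_diff)
      moreover have "(1 / t) *\<^sub>R (dir_quot (\<lambda>y. f (y + t *\<^sub>R k)) ?y h r - dir_quot f ?y h r) = dir_quot \<phi> ?y h r" for r
        by (simp add: dir_quot_def \<phi>_def scaleR_diff_right algebra_simps)
      ultimately have *: "(dir_quot \<phi> ?y h \<longlongrightarrow> dir_quot (\<lambda>y. dir_deriv f y h) ?y k t) (at 0)"
        by (simp add: dir_quot_def[abs_def])
      have "dir_quot (\<lambda>y. dir_deriv f y h) ?y k t \<in> C"
      proof (rule mvt_dir_quot[OF C(1,2) elim(4)])
        fix r :: real assume r: "r \<in> {0..1}"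
        show "dir_differentiable (\<lambda>y. dir_deriv f y h) (?y + (r * t) *\<^sub>R k) k \<and> ?D (?y + (r * t) *\<^sub>R k) \<in> C"
          using WD[OF s r] W(4) smooth_on_dir_differentiable[OF sh] by auto
      qed
      then show "dir_differentiable \<phi> ?y h \<and> dir_deriv \<phi> ?y h \<in> C"
        using dir_deriv_eqI[OF *] dir_differentiableI[OF *] by simp
    qed
    moreover have "dir_quot \<phi> x h t =
        (1 / t) *\<^sub>R (1 / t) *\<^sub>R (f (x + t *\<^sub>R h + t *\<^sub>R k) - f (x + t *\<^sub>R h) - (f (x + t *\<^sub>R k) - f x))"
      by (simp only: dir_quot_def \<phi>_def scaleR_diff_right[symmetric])
    moreover have "a - b - (c - d) = a - b - c + d" for a b c d :: 'f
      by simp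
    ultimately show ?case
      using C(4) by (simp only: subset_iff)
  qed
qed

text \<open>The second difference is symmetric in \<open>h\<close> and \<open>k\<close>, and both
  mixed derivatives are its limit.\<close>

lemma dir_deriv_commute:
  assumes f: "smooth_on U f" and x: "x \<in> U"
  shows "dir_deriv (\<lambda>y. dir_deriv f y h) x k = dir_deriv (\<lambda>y. dir_deriv f y k) x h"
proof -
  have eq: "f (x + t *\<^sub>R k + t *\<^sub>R h) - f (x + t *\<^sub>R k) - f (x + t *\<^sub>R h) + f x =
      f (x + t *\<^sub>R h + t *\<^sub>R k) - f (x + t *\<^sub>R h) - f (x + t *\<^sub>R k) + f x" for t
    by (simp add: algebra_simps)
  have "((\<lambda>t. (1 / t) *\<^sub>R (1 / t) *\<^sub>R (f (x + t *\<^sub>R h + t *\<^sub>R k) - f (x + t *\<^sub>R h) - f (x + t *\<^sub>R k) + f x))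
      \<longlongrightarrow> dir_deriv (\<lambda>y. dir_deriv f y k) x h) (at 0)"
    using second_difference[OF assms, of k h] by (simp only: eq)
  then show ?thesis
    using second_difference[OF assms, of h k] by (intro tendsto_unique[of "at (0::real)"]) auto
qed

section \<open>Sums, linear images, affine substitutions and slices\<close>

lemma iter_deriv_const:
  fixes c :: "'f::locally_convex_space"
  shows "iter_deriv j (\<lambda>_. c) x h = (if j = 0 then c else 0)"
proof (induction j arbitrary: x)
  case (Suc j)
  have "(\<lambda>y. iter_deriv j (\<lambda>_. c) y h) = (\<lambda>_. if j = 0 then c else 0)"
    using Suc by auto
  moreover have "dir_deriv (\<lambda>_. d) x k = 0" for d :: 'f and k
    by (rule dir_deriv_eqI) (simp add: dir_quot_def[abs_def])
  ultimately show ?case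
    by (simp only: iter_deriv.simps) simp
qed simp

lemma smooth_on_const: "open U \<Longrightarrow> smooth_on U (\<lambda>_. c)"
  unfolding smooth_on_def iter_deriv_const dir_differentiable_def dir_quot_def[abs_def]
  by (auto simp: case_prod_unfold)

lemma iter_deriv_add:
  assumes "smooth_on U f" "smooth_on U g" "x \<in> U"
  shows "iter_deriv j (\<lambda>y. f y + g y) x h = iter_deriv j f x h + iter_deriv j g x h"
  using assms(3)
proof (induction j arbitrary: x)
  case (Suc j)
  have "iter_deriv (Suc j) (\<lambda>y. f y + g y) x h = dir_deriv (\<lambda>y. iter_deriv j f y h + iter_deriv j g y h) x (h j)"
    unfolding iter_deriv.simps
    by (rule dir_deriv_cong(1)[OF smooth_on_open[OF assms(1)] Suc.prems Suc.IH])
  also have "\<dots> = iter_deriv (Suc j) f x h + iter_deriv (Suc j) g x h"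
    using smooth_on_differentiable[OF assms(1)] smooth_on_differentiable[OF assms(2)] Suc.prems
    by (simp add: dir_deriv_add)
  finally show ?case .
qed simp

lemma smooth_on_add:
  assumes "smooth_on U f" "smooth_on U g"
  shows "smooth_on U (\<lambda>y. f y + g y)"
  unfolding smooth_on_def
proof (intro conjI allI ballI)
  fix j x h assume x: "x \<in> U"
  let ?f = "\<lambda>y. iter_deriv j f y h" and ?g = "\<lambda>y. iter_deriv j g y h"
  have "(dir_quot (\<lambda>y. ?f y + ?g y) x (h j) \<longlongrightarrow> dir_deriv ?f x (h j) + dir_deriv ?g x (h j)) (at 0)"
    using tendsto_add[OF dir_deriv_tendsto[OF smooth_on_differentiable[OF assms(1) x]]
        dir_deriv_tendsto[OF smooth_on_differentiable[OF assms(2) x]], of j h "h j" j h "h j"]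
    by (simp only: dir_quot_add[abs_def])
  then have "dir_differentiable (\<lambda>y. ?f y + ?g y) x (h j)"
    by (rule dir_differentiableI)
  then show "dir_differentiable (\<lambda>y. iter_deriv j (\<lambda>y. f y + g y) y h) x (h j)"
    by (subst dir_deriv_cong(2)[OF smooth_on_open[OF assms(1)] x]) (simp_all add: iter_deriv_add[OF assms])
next
  fix j
  have "continuous_on (U \<times> UNIV) (\<lambda>p. iter_deriv j f (fst p) (snd p) + iter_deriv j g (fst p) (snd p))"
    using smooth_on_iter_continuous[OF assms(1)] smooth_on_iter_continuous[OF assms(2)]
    by (intro continuous_on_add) (simp_all add: case_prod_unfold)
  then show "continuous_on (U \<times> UNIV) (\<lambda>(x, h). iter_deriv j (\<lambda>y. f y + g y) x h)"
    by (rule continuous_on_eq) (auto simp: iter_deriv_add[OF assms])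
qed (use assms smooth_on_open in blast)

lemma iter_deriv_linear_post:
  assumes L: "linear L" "continuous_on UNIV L" and f: "smooth_on U f" and x: "x \<in> U"
  shows "iter_deriv j (\<lambda>y. L (f y)) x h = L (iter_deriv j f x h)"
    and "dir_differentiable (\<lambda>y. iter_deriv j (\<lambda>y. L (f y)) y h) x k"
proof -
  have lim: "(dir_quot (\<lambda>y. L (iter_deriv j f y h)) x k \<longlongrightarrow> L (dir_deriv (\<lambda>y. iter_deriv j f y h) x k)) (at 0)"
    if "x \<in> U" for j x k
  proof -
    have "((\<lambda>t. L (dir_quot (\<lambda>y. iter_deriv j f y h) x k t)) \<longlongrightarrow> L (dir_deriv (\<lambda>y. iter_deriv j f y h) x k)) (at 0)"
      by (rule continuous_on_tendsto_compose[OF L(2)])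
        (auto intro: dir_deriv_tendsto smooth_on_differentiable[OF f that])
    then show ?thesis
      by (simp add: dir_quot_def[abs_def] linear_diff[OF L(1)] linear_scale[OF L(1)])
  qed
  have eq: "iter_deriv j (\<lambda>y. L (f y)) x h = L (iter_deriv j f x h)" if "x \<in> U" for j x
    using that
  proof (induction j arbitrary: x)
    case (Suc j)
    have "iter_deriv (Suc j) (\<lambda>y. L (f y)) x h = dir_deriv (\<lambda>y. L (iter_deriv j f y h)) x (h j)"
      unfolding iter_deriv.simps
      by (rule dir_deriv_cong(1)[OF smooth_on_open[OF f] Suc.prems Suc.IH])
    then show ?case using dir_deriv_eqI[OF lim[OF Suc.prems]] by simp
  qed simp
  show "iter_deriv j (\<lambda>y. L (f y)) x h = L (iter_deriv j f x h)"
    using eq[OF x] .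
  show "dir_differentiable (\<lambda>y. iter_deriv j (\<lambda>y. L (f y)) y h) x k"
    by (subst dir_deriv_cong(2)[OF smooth_on_open[OF f] x eq]) (auto intro: dir_differentiableI[OF lim[OF x]])
qed

lemma iter_deriv_scaleR:
  assumes "smooth_on U f" "x \<in> U"
  shows "iter_deriv j (\<lambda>y. r *\<^sub>R f y) x h = r *\<^sub>R iter_deriv j f x h"
  by (rule iter_deriv_linear_post(1)[OF _ _ assms])
    (auto intro!: linearI lcs_continuous_on_scaleR continuous_intros simp: scaleR_add_right)

lemma smooth_on_linear_post:
  assumes L: "linear L" "continuous_on UNIV L" and f: "smooth_on U f"
  shows "smooth_on U (\<lambda>y. L (f y))"
  unfolding smooth_on_def
proof (intro conjI allI ballI)
  fix j
  have "continuous_on (U \<times> UNIV) (\<lambda>p. L (iter_deriv j f (fst p) (snd p)))"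
    using smooth_on_iter_continuous[OF f]
    by (intro continuous_on_compose2[OF L(2)]) (auto simp: case_prod_unfold)
  then show "continuous_on (U \<times> UNIV) (\<lambda>(x, h). iter_deriv j (\<lambda>y. L (f y)) x h)"
    by (rule continuous_on_eq) (auto simp: iter_deriv_linear_post[OF assms])
qed (use iter_deriv_linear_post[OF assms] smooth_on_open[OF f] in auto)

lemma dir_quot_affine:
  assumes "linear L"
  shows "dir_quot (\<lambda>y. f (L y + c)) x k = dir_quot f (L x + c) (L k)"
  by (simp add: dir_quot_def[abs_def] linear_add[OF assms] linear_scale[OF assms] algebra_simps)

lemma iter_deriv_affine:
  assumes "linear L"
  shows "iter_deriv j (\<lambda>y. f (L y + c)) x h = iter_deriv j f (L x + c) (\<lambda>i. L (h i))"
proof (induction j arbitrary: x)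
  case (Suc j)
  have "dir_quot (\<lambda>y. iter_deriv j f (L y + c) (\<lambda>i. L (h i))) x (h j) =
      dir_quot (\<lambda>y. iter_deriv j f y (\<lambda>i. L (h i))) (L x + c) (L (h j))"
    by (rule dir_quot_affine[OF assms])
  then show ?case by (simp add: Suc dir_deriv_def)
qed simp

lemma smooth_on_affine:
  assumes L: "linear L" "continuous_on UNIV L" and f: "smooth_on U f"
  shows "smooth_on {y. L y + c \<in> U} (\<lambda>y. f (L y + c))"
  unfolding smooth_on_def
proof (intro conjI allI ballI)
  have cont: "continuous_on UNIV (\<lambda>y. L y + c)"
    by (intro continuous_intros L)
  show "open {y. L y + c \<in> U}"
    using open_vimage[OF smooth_on_open[OF f] cont] by (simp add: vimage_def)
  fix j
  show "dir_differentiable (\<lambda>y. iter_deriv j (\<lambda>y. f (L y + c)) y h) x (h j)" if "x \<in> {y. L y + c \<in> U}" for x h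
    using that smooth_on_differentiable[OF f, of "L x + c" j "\<lambda>i. L (h i)" "L (h j)"]
    unfolding iter_deriv_affine[OF L(1)] dir_differentiable_def dir_quot_affine[OF L(1), where f = "\<lambda>y. iter_deriv j f y (\<lambda>i. L (h i))"]
    by simp
  have "((\<lambda>p. iter_deriv j f (L (fst p) + c) (\<lambda>i. L (snd p i))) \<longlongrightarrow> iter_deriv j f (L x + c) (\<lambda>i. L (h i)))
      (at (x, h) within {y. L y + c \<in> U} \<times> UNIV)" if "L x + c \<in> U" for x h
  proof (rule smooth_on_tendsto[OF f that])
    show "((\<lambda>p. L (fst p) + c) \<longlongrightarrow> L x + c) (at (x, h) within {y. L y + c \<in> U} \<times> UNIV)"
      by (rule continuous_on_tendsto_compose[OF cont tendsto_fst_snd_within(1)]) auto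
    fix i
    show "((\<lambda>p. L (snd p i)) \<longlongrightarrow> L (h i)) (at (x, h) within {y. L y + c \<in> U} \<times> UNIV)"
      by (rule continuous_on_tendsto_compose[OF L(2) tendsto_apply[OF tendsto_fst_snd_within(2)]]) auto
  qed
  then show "continuous_on ({y. L y + c \<in> U} \<times> UNIV) (\<lambda>(x, h). iter_deriv j (\<lambda>y. f (L y + c)) x h)"
    unfolding iter_deriv_affine[OF L(1)] continuous_on_def by (simp add: case_prod_unfold)
qed

lemma linear_Pair_0: "linear (\<lambda>y::'a::real_vector. (y, 0::'b::real_vector))"
  by (rule linearI) (simp_all add: scaleR_prod_def)

lemma smooth_on_slice:
  fixes f :: "'e::locally_convex_space \<times> 'd::locally_convex_space \<Rightarrow> 'f::locally_convex_space"
  assumes "smooth_on U f"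
  shows "smooth_on {a. (a, b) \<in> U} (\<lambda>a. f (a, b))"
  using smooth_on_affine[OF linear_Pair_0 _ assms, of "(0, b)"] by (simp add: continuous_intros)

lemma iter_deriv_slice:
  fixes f :: "'e::locally_convex_space \<times> 'd::locally_convex_space \<Rightarrow> 'f::locally_convex_space"
  shows "iter_deriv j (\<lambda>a. f (a, b)) a h = iter_deriv j f (a, b) (\<lambda>i. (h i, 0))"
  using iter_deriv_affine[OF linear_Pair_0, of j f "(0, b)" a h] by simp

text \<open>Faa di Bruno's formula: an entry \<open>(m, \<tau>)\<close> stands for the summand in which the \<open>m\<close>-th
  derivative of the outer map is evaluated at derivatives of the inner map, the \<open>i\<close>-th of these
  having order \<open>fst (\<tau> i)\<close> and directions selected by \<open>snd (\<tau> i)\<close>.\<close>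

type_synonym fdb_index = "nat \<times> (nat \<Rightarrow> nat \<times> (nat \<Rightarrow> nat))"

text \<open>The product rule for one more differentiation, in the direction number \<open>j\<close>:
  either the outer map gains the argument number \<open>m\<close>, a first derivative of the inner
  map, or one of the \<open>m\<close> inner derivatives receives the direction as its last
  one.\<close>

definition fdb_step :: "nat \<Rightarrow> fdb_index \<Rightarrow> fdb_index list" where
  "fdb_step j = (\<lambda>(m, \<tau>). (Suc m, \<tau>(m := (1, \<lambda>_. j))) #
     map (\<lambda>i. (m, \<tau>(i := (Suc (fst (\<tau> i)), (snd (\<tau> i))(fst (\<tau> i) := j))))) [0..<m])"

primrec fdb_terms :: "nat \<Rightarrow> fdb_index list" where
  "fdb_terms 0 = [(0, \<lambda>_. (0, id))]"
| "fdb_terms (Suc j) = concat (map (fdb_step j) (fdb_terms j))"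

definition fdb_dirs :: "('e::locally_convex_space \<Rightarrow> 'f::locally_convex_space) \<Rightarrow> 'e \<Rightarrow> (nat \<Rightarrow> 'e) \<Rightarrow>
    (nat \<Rightarrow> nat \<times> (nat \<Rightarrow> nat)) \<Rightarrow> nat \<Rightarrow> 'f" where
  "fdb_dirs g x h \<tau> i = iter_deriv (fst (\<tau> i)) g x (h \<circ> snd (\<tau> i))"

definition fdb_val where
  "fdb_val f g x h T = iter_deriv (fst T) f (g x) (fdb_dirs g x h (snd T))"

lemma sum_list_upt: "sum_list (map f [0..<m]) = (\<Sum>i<m. f i)"
  by (simp add: interv_sum_list_conv_sum_set_nat atLeast0LessThan)

lemma tendsto_sum_list:
  fixes f :: "'i \<Rightarrow> 'a \<Rightarrow> 'b::topological_monoid_add"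
  assumes "\<And>i. i \<in> set xs \<Longrightarrow> (f i \<longlongrightarrow> l i) F"
  shows "((\<lambda>t. \<Sum>i\<leftarrow>xs. f i t) \<longlongrightarrow> (\<Sum>i\<leftarrow>xs. l i)) F"
  using assms by (induction xs) (auto intro: tendsto_add)

lemma dir_quot_sum_list: "dir_quot (\<lambda>y. \<Sum>i\<leftarrow>xs. f i y) x h t = (\<Sum>i\<leftarrow>xs. dir_quot (f i) x h t)"
proof (induction xs)
  case Nil
  show ?case by (simp add: dir_quot_def)
next
  case (Cons a xs)
  have "dir_quot (\<lambda>y. \<Sum>i\<leftarrow>a # xs. f i y) x h t = dir_quot (f a) x h t + dir_quot (\<lambda>y. \<Sum>i\<leftarrow>xs. f i y) x h t"
    using dir_quot_add[of "f a" "\<lambda>y. \<Sum>i\<leftarrow>xs. f i y"] by simp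
  then show ?case using Cons by simp
qed

lemma quot_eq_dir_quot: "(1 / t) *\<^sub>R (f (x + t *\<^sub>R k) - f x) = dir_quot f x k t"
  by (simp add: dir_quot_def)

text \<open>The instance of \<open>iter_deriv_curve\<close> along the line through \<open>x\<close>.
  It is the common product rule behind Faa di Bruno's formula, derivatives along vector fields, and
  the commutator of two generators.\<close>

lemma dir_quot_moving_dirs:
  assumes f: "smooth_on V f" and g: "dir_differentiable g x k" "g x \<in> V"
    and Z: "\<And>i. i < m \<Longrightarrow> dir_differentiable (Z i) x k"
  shows "(dir_quot (\<lambda>y. iter_deriv m f (g y) (\<lambda>i. Z i y)) x k \<longlongrightarrow>
    iter_deriv (Suc m) f (g x) ((\<lambda>i. Z i x)(m := dir_deriv g x k)) +
    (\<Sum>i<m. iter_deriv m f (g x) ((\<lambda>i. Z i x)(i := dir_deriv (Z i) x k)))) (at 0)"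
  unfolding dir_quot_def
proof (rule iter_deriv_curve[OF f g(2), where z = "\<lambda>t i. Z i (x + t *\<^sub>R k)"])
  show "((\<lambda>t. (1 / t) *\<^sub>R (g (x + t *\<^sub>R k) - g x)) \<longlongrightarrow> dir_deriv g x k) (at 0)"
    unfolding quot_eq_dir_quot by (rule dir_deriv_tendsto[OF g(1)])
  show "((\<lambda>t. (1 / t) *\<^sub>R (Z i (x + t *\<^sub>R k) - Z i x)) \<longlongrightarrow> dir_deriv (Z i) x k) (at 0)" if "i < m" for i
    unfolding quot_eq_dir_quot[of _ "Z i"] by (rule dir_deriv_tendsto[OF Z[OF that]])
qed (auto simp: eventually_at_filter)

lemma dir_quot_fdb_val:
  assumes f: "smooth_on V f" and g: "smooth_on U g" and gUV: "g ` U \<subseteq> V" and x: "x \<in> U"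
  shows "(dir_quot (\<lambda>y. fdb_val f g y h T) x (h j) \<longlongrightarrow> (\<Sum>T'\<leftarrow>fdb_step j T. fdb_val f g x h T')) (at 0)"
proof -
  obtain m \<tau> where T: "T = (m, \<tau>)" by (cases T)
  define Z where "Z i y = iter_deriv (fst (\<tau> i)) g y (h \<circ> snd (\<tau> i))" for i y
  have upd: "(\<lambda>l. Z l x)(m := dir_deriv g x (h j)) = fdb_dirs g x h (\<tau>(m := (1, \<lambda>_. j)))"
    by (auto simp: Z_def fdb_dirs_def fun_eq_iff)
  have upd2: "(\<lambda>l. Z l x)(i := dir_deriv (Z i) x (h j)) =
      fdb_dirs g x h (\<tau>(i := (Suc (fst (\<tau> i)), (snd (\<tau> i))(fst (\<tau> i) := j))))" for i
  proof -
    \<comment> \<open>The new direction is written at a position that the derivative of the old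
      order does not read.\<close>
    have "(\<lambda>y. iter_deriv (fst (\<tau> i)) g y (h \<circ> (snd (\<tau> i))(fst (\<tau> i) := j))) = Z i"
      unfolding Z_def by (intro ext iter_deriv_cong_dirs) simp
    then have "dir_deriv (Z i) x (h j) =
        fdb_dirs g x h (\<tau>(i := (Suc (fst (\<tau> i)), (snd (\<tau> i))(fst (\<tau> i) := j)))) i"
      by (simp only: fdb_dirs_def fun_upd_same fst_conv snd_conv iter_deriv.simps comp_apply)
    then show ?thesis
      by (auto simp: Z_def fdb_dirs_def fun_eq_iff)
  qed
  have "(dir_quot (\<lambda>y. iter_deriv m f (g y) (\<lambda>i. Z i y)) x (h j) \<longlongrightarrow>
    iter_deriv (Suc m) f (g x) ((\<lambda>i. Z i x)(m := dir_deriv g x (h j))) +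
    (\<Sum>i<m. iter_deriv m f (g x) ((\<lambda>i. Z i x)(i := dir_deriv (Z i) x (h j))))) (at 0)"
    by (rule dir_quot_moving_dirs[OF f])
      (use x gUV g in \<open>auto simp: Z_def intro: smooth_on_dir_differentiable smooth_on_differentiable\<close>)
  then show ?thesis
    unfolding upd upd2
    by (simp add: T fdb_val_def[abs_def] fdb_step_def comp_def sum_list_upt Z_def fdb_dirs_def[abs_def])
qed

lemma iter_deriv_comp:
  assumes f: "smooth_on V f" and g: "smooth_on U g" and gUV: "g ` U \<subseteq> V" and "x \<in> U"
  shows "iter_deriv j (\<lambda>y. f (g y)) x h = (\<Sum>T\<leftarrow>fdb_terms j. fdb_val f g x h T)"
    and "dir_differentiable (\<lambda>y. iter_deriv j (\<lambda>y. f (g y)) y h) x (h j)"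
proof -
  have lim: "(dir_quot (\<lambda>y. \<Sum>T\<leftarrow>fdb_terms j. fdb_val f g y h T) x (h j) \<longlongrightarrow>
      (\<Sum>T\<leftarrow>fdb_terms (Suc j). fdb_val f g x h T)) (at 0)" if "x \<in> U" for j x
  proof -
    have "((\<lambda>t. \<Sum>T\<leftarrow>fdb_terms j. dir_quot (\<lambda>y. fdb_val f g y h T) x (h j) t) \<longlongrightarrow>
        (\<Sum>T\<leftarrow>fdb_terms j. \<Sum>T'\<leftarrow>fdb_step j T. fdb_val f g x h T')) (at 0)"
      by (intro tendsto_sum_list dir_quot_fdb_val[OF f g gUV that])
    moreover have "(\<Sum>T\<leftarrow>xs. \<Sum>T'\<leftarrow>fdb_step j T. fdb_val f g x h T') =
        (\<Sum>T\<leftarrow>concat (map (fdb_step j) xs). fdb_val f g x h T)" for xs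
      by (induction xs) simp_all
    ultimately show ?thesis
      by (simp add: dir_quot_sum_list[abs_def])
  qed
  have eq: "iter_deriv j (\<lambda>y. f (g y)) x h = (\<Sum>T\<leftarrow>fdb_terms j. fdb_val f g x h T)" if "x \<in> U" for j x
    using that
  proof (induction j arbitrary: x)
    case 0
    show ?case by (simp add: fdb_val_def)
  next
    case (Suc j)
    have "iter_deriv (Suc j) (\<lambda>y. f (g y)) x h = dir_deriv (\<lambda>y. \<Sum>T\<leftarrow>fdb_terms j. fdb_val f g y h T) x (h j)"
      unfolding iter_deriv.simps
      by (rule dir_deriv_cong(1)[OF smooth_on_open[OF g] Suc.prems Suc.IH])
    then show ?case using dir_deriv_eqI[OF lim[OF Suc.prems]] by simp
  qed
  show "iter_deriv j (\<lambda>y. f (g y)) x h = (\<Sum>T\<leftarrow>fdb_terms j. fdb_val f g x h T)"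
    using eq[OF \<open>x \<in> U\<close>] .
  show "dir_differentiable (\<lambda>y. iter_deriv j (\<lambda>y. f (g y)) y h) x (h j)"
    by (subst dir_deriv_cong(2)[OF smooth_on_open[OF g] \<open>x \<in> U\<close> eq])
      (auto intro: dir_differentiableI[OF lim[OF \<open>x \<in> U\<close>]])
qed

lemma tendsto_fdb_dirs:
  assumes "smooth_on U g" "x \<in> U" "(y \<longlongrightarrow> x) F" "(k \<longlongrightarrow> h) F"
  shows "((\<lambda>t. fdb_dirs g (y t) (k t) \<tau> i) \<longlongrightarrow> fdb_dirs g x h \<tau> i) F"
  unfolding fdb_dirs_def
  by (rule smooth_on_tendsto[OF assms(1-3)]) (auto intro: tendsto_apply assms(4))

lemma smooth_on_comp:
  assumes f: "smooth_on V f" and g: "smooth_on U g" and gUV: "g ` U \<subseteq> V"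
  shows "smooth_on U (\<lambda>y. f (g y))"
  unfolding smooth_on_def
proof (intro conjI allI ballI)
  fix j
  have "((\<lambda>p. fdb_val f g (fst p) (snd p) T) \<longlongrightarrow> fdb_val f g x h T) (at (x, h) within U \<times> UNIV)"
    if x: "x \<in> U" for x h T
  proof -
    note fs = tendsto_fst_snd_within[where x = x and h = h and A = "U \<times> UNIV"]
    show ?thesis
      unfolding fdb_val_def
    proof (rule smooth_on_tendsto[OF f])
      show "((\<lambda>p. g (fst p)) \<longlongrightarrow> g x) (at (x, h) within U \<times> UNIV)"
        by (rule continuous_on_tendsto_compose[OF smooth_on_continuous[OF g] fs(1) x])
          (auto simp: eventually_at_filter intro!: always_eventually)
    qed (use x gUV in \<open>auto intro: tendsto_fdb_dirs[OF g _ fs]\<close>)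
  qed
  then have "continuous_on (U \<times> UNIV) (\<lambda>p. \<Sum>T\<leftarrow>fdb_terms j. fdb_val f g (fst p) (snd p) T)"
    unfolding continuous_on_def by (auto intro!: tendsto_sum_list)
  then show "continuous_on (U \<times> UNIV) (\<lambda>(x, h). iter_deriv j (\<lambda>y. f (g y)) x h)"
    by (rule continuous_on_eq) (auto simp: iter_deriv_comp(1)[OF assms])
qed (use iter_deriv_comp(2)[OF assms] smooth_on_open[OF g] in auto)

text \<open>Each differentiation hits either the field or the map, and only in the leading summand
  has every one of them hit the map. The remainder is left unspecified except for two facts: its
  orders are at most \<open>n\<close>, and its coefficient fields do not depend on \<open>f\<close>.
  This allows induction on the order, simultaneously for the orbit maps of all smooth
  vectors.\<close>

lemma iter_deriv_along_field:
  fixes X :: "'e::locally_convex_space \<Rightarrow> 'e"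
  assumes X: "smooth_on U X"
  shows "\<exists>Ts :: (nat \<times> (nat \<Rightarrow> 'e \<Rightarrow> 'e)) list.
    (\<forall>(m, Z)\<in>set Ts. 1 \<le> m \<and> m \<le> n \<and> (\<forall>i. smooth_on U (Z i))) \<and>
    (\<forall>f :: 'e \<Rightarrow> 'f::locally_convex_space. smooth_on U f \<longrightarrow> (\<forall>x\<in>U.
      iter_deriv n (\<lambda>y. dir_deriv f y (X y)) x h = iter_deriv (Suc n) f x (case_nat (X x) h) +
        (\<Sum>(m, Z)\<leftarrow>Ts. iter_deriv m f x (\<lambda>i. Z i x))))"
proof (induction n)
  case 0
  show ?case by (intro exI[of _ "[]"]) simp
next
  case (Suc n)
  then obtain Ts :: "(nat \<times> (nat \<Rightarrow> 'e \<Rightarrow> 'e)) list" where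
    Ts: "\<And>m Z i. (m, Z) \<in> set Ts \<Longrightarrow> 1 \<le> m \<and> m \<le> n \<and> smooth_on U (Z i)" and
    IH: "\<And>(f :: 'e \<Rightarrow> 'f) x. smooth_on U f \<Longrightarrow> x \<in> U \<Longrightarrow>
      iter_deriv n (\<lambda>y. dir_deriv f y (X y)) x h = iter_deriv (Suc n) f x (case_nat (X x) h) +
        (\<Sum>(m, Z)\<leftarrow>Ts. iter_deriv m f x (\<lambda>i. Z i x))"
    by fast
  define k where "k = h n"
  define U' where "U' = U"
  define low :: "nat \<times> (nat \<Rightarrow> 'e \<Rightarrow> 'e) \<Rightarrow> (nat \<times> (nat \<Rightarrow> 'e \<Rightarrow> 'e)) list"
    where "low = (\<lambda>(m, Z). map (\<lambda>i. (m, Z(i := (\<lambda>y. dir_deriv (Z i) y k)))) [0..<m])"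
  define top :: "nat \<times> (nat \<Rightarrow> 'e \<Rightarrow> 'e) \<Rightarrow> nat \<times> (nat \<Rightarrow> 'e \<Rightarrow> 'e)"
    where "top = (\<lambda>(m, Z). (Suc m, Z(m := (\<lambda>_. k))))"
  define ev :: "('e \<Rightarrow> 'f) \<Rightarrow> 'e \<Rightarrow> nat \<times> (nat \<Rightarrow> 'e \<Rightarrow> 'e) \<Rightarrow> 'f"
    where "ev f x = (\<lambda>(m, Z). iter_deriv m f x (\<lambda>i. Z i x))" for f x
  \<comment> \<open>The leading summand in the format of the remainder, so that the product rule
    \<open>lim\<close> covers it as well.\<close>
  define T0 :: "nat \<times> (nat \<Rightarrow> 'e \<Rightarrow> 'e)" where "T0 = (Suc n, \<lambda>i y. case_nat (X y) h i)"
  define sm :: "nat \<times> (nat \<Rightarrow> 'e \<Rightarrow> 'e) \<Rightarrow> bool" where "sm = (\<lambda>(m, Z). \<forall>i. smooth_on U (Z i))"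
  have U: "open U" using smooth_on_open[OF X] .
  have "smooth_on U (\<lambda>y. case_nat (X y) h i)" for i
    by (cases i) (simp_all add: X smooth_on_const[OF U])
  then have T0: "sm T0"
    by (simp add: sm_def T0_def)
  have low_sm: "sm T'" "fst T' = fst T" if T: "sm T" and T': "T' \<in> set (low T)" for T T'
  proof -
    obtain m Z where mZ: "T = (m, Z)" by (cases T)
    obtain i where "T' = (m, Z(i := (\<lambda>y. dir_deriv (Z i) y k)))"
      using T' by (auto simp: mZ low_def)
    moreover have "smooth_on U (\<lambda>y. dir_deriv (Z i) y k)"
      using T by (intro smooth_on_dir_deriv) (simp add: mZ sm_def)
    ultimately show "sm T'" "fst T' = fst T"
      using T by (simp_all add: mZ sm_def)
  qed
  have top_sm: "sm (top T)" "fst (top T) = Suc (fst T)" if "sm T" for T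
    using that by (auto simp: sm_def top_def smooth_on_const[OF U] split: prod.splits)
  have lim: "(dir_quot (\<lambda>y. ev f y T) x k \<longlongrightarrow> ev f x (top T) + (\<Sum>T'\<leftarrow>low T. ev f x T')) (at 0)"
    if f: "smooth_on U f" and x: "x \<in> U" and T: "sm T" for f x T
  proof -
    obtain m Z where mZ: "T = (m, Z)" by (cases T)
    have "(dir_quot (\<lambda>y. iter_deriv m f y (\<lambda>i. Z i y)) x k \<longlongrightarrow>
      iter_deriv (Suc m) f x ((\<lambda>i. Z i x)(m := dir_deriv (\<lambda>y. y) x k)) +
      (\<Sum>i<m. iter_deriv m f x ((\<lambda>i. Z i x)(i := dir_deriv (Z i) x k)))) (at 0)"
      using T x by (intro dir_quot_moving_dirs[OF f dir_differentiableI[OF dir_quot_ident]])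
        (auto simp: mZ sm_def intro: smooth_on_dir_differentiable)
    moreover have "(\<lambda>i. Z i x)(m := k) = (\<lambda>i. (Z(m := (\<lambda>_. k))) i x)"
      by auto
    moreover have "(\<lambda>l. Z l x)(i := dir_deriv (Z i) x k) = (\<lambda>l. (Z(i := (\<lambda>y. dir_deriv (Z i) y k))) l x)" for i
      by auto
    ultimately show ?thesis
      by (simp only: dir_deriv_eqI[OF dir_quot_ident] mZ ev_def top_def low_def prod.case map_map comp_def sum_list_upt)
  qed
  \<comment> \<open>The term \<open>top T0\<close> is missing here because it becomes the new
    leading summand.\<close>
  define Ts' where "Ts' = low T0 @ concat (map (\<lambda>T. top T # low T) Ts)"
  have smTs: "sm T" if "T \<in> set Ts" for T
    using Ts that by (auto simp: sm_def split: prod.splits)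
  have 1: "sm T \<and> 1 \<le> fst T \<and> fst T \<le> Suc n" if T: "T \<in> set Ts'" for T
  proof -
    consider "T \<in> set (low T0)" | S where "S \<in> set Ts" "T = top S" | S where "S \<in> set Ts" "T \<in> set (low S)"
      using T by (auto simp: Ts'_def)
    then show ?thesis
    proof cases
      case 1
      then show ?thesis using low_sm[OF T0] by (auto simp: T0_def)
    next
      case 2
      then show ?thesis using top_sm[OF smTs[of S]] Ts[of "fst S" "snd S" 0] by simp
    next
      case 3
      then show ?thesis using low_sm[OF smTs[OF 3(1)] 3(2)] Ts[of "fst S" "snd S" 0] by simp
    qed
  qed
  have 2: "iter_deriv (Suc n) (\<lambda>y. dir_deriv f y (X y)) x h = iter_deriv (Suc (Suc n)) f x (case_nat (X x) h) +
        (\<Sum>T\<leftarrow>Ts'. ev f x T)" if f: "smooth_on U f" and x: "x \<in> U" for f :: "'e \<Rightarrow> 'f" and x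
  proof -
    have "iter_deriv n (\<lambda>y. dir_deriv f y (X y)) y h = (\<Sum>T\<leftarrow>T0 # Ts. ev f y T)" if "y \<in> U" for y
      using IH[OF f that] by (simp add: ev_def T0_def)
    then have "iter_deriv (Suc n) (\<lambda>y. dir_deriv f y (X y)) x h = dir_deriv (\<lambda>y. \<Sum>T\<leftarrow>T0 # Ts. ev f y T) x k"
      unfolding iter_deriv.simps k_def by (intro dir_deriv_cong(1)[OF U x])
    also have "\<dots> = (\<Sum>T\<leftarrow>T0 # Ts. ev f x (top T) + (\<Sum>T'\<leftarrow>low T. ev f x T'))"
    proof (rule dir_deriv_eqI)
      have "((\<lambda>t. \<Sum>T\<leftarrow>T0 # Ts. dir_quot (\<lambda>y. ev f y T) x k t) \<longlongrightarrow>
          (\<Sum>T\<leftarrow>T0 # Ts. ev f x (top T) + (\<Sum>T'\<leftarrow>low T. ev f x T'))) (at 0)"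
        using T0 smTs by (intro tendsto_sum_list lim[OF f x]) auto
      then show "(dir_quot (\<lambda>y. \<Sum>T\<leftarrow>T0 # Ts. ev f y T) x k \<longlongrightarrow>
          (\<Sum>T\<leftarrow>T0 # Ts. ev f x (top T) + (\<Sum>T'\<leftarrow>low T. ev f x T'))) (at 0)"
        by (simp only: dir_quot_sum_list[abs_def])
    qed
    also have "\<dots> = ev f x (top T0) + (\<Sum>T\<leftarrow>Ts'. ev f x T)"
    proof -
      have "(\<Sum>T\<leftarrow>xs. ev f x (top T) + (\<Sum>T'\<leftarrow>low T. ev f x T')) = (\<Sum>T\<leftarrow>concat (map (\<lambda>T. top T # low T) xs). ev f x T)" for xs
        by (induction xs) (simp_all add: add.assoc)
      then show ?thesis by (simp add: Ts'_def add.assoc)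
    qed
    also have "ev f x (top T0) = iter_deriv (Suc (Suc n)) f x (case_nat (X x) h)"
    proof -
      have "(\<lambda>i. ((\<lambda>i y. case_nat (X y) h i)(Suc n := (\<lambda>_. k))) i x) = case_nat (X x) h"
        by (auto simp: k_def fun_eq_iff)
      then show ?thesis by (simp only: ev_def top_def T0_def prod.case)
    qed
    finally show ?thesis .
  qed
  show ?case
  proof (intro exI[of _ Ts'] conjI allI impI ballI)
    fix T assume "T \<in> set Ts'"
    then show "case T of (m, Z) \<Rightarrow> 1 \<le> m \<and> m \<le> Suc n \<and> (\<forall>i. smooth_on U (Z i))"
      using 1[of T] by (auto simp: sm_def split: prod.splits)
  next
    fix f :: "'e \<Rightarrow> 'f" and x assume "smooth_on U f" "x \<in> U"
    from 2[OF this] show "iter_deriv (Suc n) (\<lambda>y. dir_deriv f y (X y)) x h =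
        iter_deriv (Suc (Suc n)) f x (case_nat (X x) h) + (\<Sum>(m, Z)\<leftarrow>Ts'. iter_deriv m f x (\<lambda>i. Z i x))"
      by (simp only: ev_def)
  qed
qed

section \<open>Complex Hilbert spaces\<close>

text \<open>Riesz representation, adjoints and skew-symmetry are treated over the reals;
  \<open>cinner_eq_ip\<close> recovers the complex inner product by inserting \<i>.\<close>

definition ip :: "'h::complex_hilbert_space \<Rightarrow> 'h \<Rightarrow> real" where
  "ip x y = Re (cinner x y)"

lemma scaleC_1 [simp]: "(1::complex) *\<^sub>C (x::'h::complex_hilbert_space) = x"
  using scaleC_of_real[of 1 x] by simp

lemma scaleC_0 [simp]: "(0::complex) *\<^sub>C (x::'h::complex_hilbert_space) = 0"
  using scaleC_of_real[of 0 x] by simp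

lemma scaleC_0_right [simp]: "a *\<^sub>C (0::'h::complex_hilbert_space) = 0"
  using scaleC_add_right[of a 0 "0::'h"] by simp

lemma scaleC_minus1: "(-1::complex) *\<^sub>C (x::'h::complex_hilbert_space) = - x"
  using scaleC_of_real[of "-1" x] by simp

lemma scaleC_minus_left: "(- a) *\<^sub>C (x::'h::complex_hilbert_space) = - (a *\<^sub>C x)"
  using scaleC_scaleC[of "-1" a x] by (simp add: scaleC_minus1)

lemma scaleC_minus_right: "a *\<^sub>C (- x :: 'h::complex_hilbert_space) = - (a *\<^sub>C x)"
  using scaleC_add_right[of a x "- x"] by (simp add: eq_neg_iff_add_eq_0 add.commute)

lemma scaleC_diff_right: "a *\<^sub>C (x - y :: 'h::complex_hilbert_space) = a *\<^sub>C x - a *\<^sub>C y"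
  using scaleC_add_right[of a x "- y"] by (simp add: scaleC_minus_right)

lemma scaleC_diff_left: "(a - b) *\<^sub>C (x :: 'h::complex_hilbert_space) = a *\<^sub>C x - b *\<^sub>C x"
  using scaleC_add_left[of a "- b" x] by (simp add: scaleC_minus_left)

lemma scaleC_scaleR: "a *\<^sub>C (r *\<^sub>R x) = r *\<^sub>R (a *\<^sub>C (x :: 'h::complex_hilbert_space))"
  by (simp add: scaleC_of_real[symmetric] scaleC_scaleC mult.commute)

lemma ip_commute: "ip x y = ip y x"
  unfolding ip_def by (subst cinner_commute) simp

lemma ip_add_left: "ip (x + y) z = ip x z + ip y z"
  by (simp add: ip_def cinner_add_left)

lemma ip_add_right: "ip x (y + z) = ip x y + ip x z"
  using ip_add_left[of y z x] by (simp add: ip_commute)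

lemma ip_scaleR_left: "ip (r *\<^sub>R x) y = r * ip x y"
  by (simp add: ip_def scaleC_of_real[symmetric] cinner_scaleC_left)

lemma ip_scaleR_right: "ip x (r *\<^sub>R y) = r * ip x y"
  using ip_scaleR_left[of r y x] by (simp add: ip_commute)

lemma ip_minus_left: "ip (- x) y = - ip x y"
  using ip_scaleR_left[of "-1" x y] by simp

lemma ip_minus_right: "ip x (- y) = - ip x y"
  using ip_scaleR_right[of x "-1" y] by simp

lemma ip_diff_left: "ip (x - y) z = ip x z - ip y z"
  using ip_add_left[of x "- y" z] by (simp add: ip_minus_left)

lemma ip_diff_right: "ip x (y - z) = ip x y - ip x z"
  using ip_add_right[of x y "- z"] by (simp add: ip_minus_right)

lemma ip_self: "ip x x = (norm x)\<^sup>2"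
proof -
  have "norm x = sqrt (ip x x)"
    by (simp add: ip_def norm_eq_sqrt_cinner)
  \<comment> \<open>Positivity comes from the norm: the real square root has the sign of its
    argument.\<close>
  moreover from this have "ip x x \<ge> 0"
    using norm_ge_zero[of x] real_sqrt_ge_0_iff by metis
  ultimately show ?thesis by simp
qed

lemma norm_add_ip: "(norm (x + y))\<^sup>2 = (norm x)\<^sup>2 + 2 * ip x y + (norm y)\<^sup>2"
proof -
  have "(norm (x + y))\<^sup>2 = ip (x + y) (x + y)"
    by (simp add: ip_self)
  also have "\<dots> = ip x x + 2 * ip x y + ip y y"
    by (simp add: ip_add_left ip_add_right ip_commute[of y x])
  finally show ?thesis by (simp add: ip_self)
qed

text \<open>Cauchy-Schwarz is here a consequence of the triangle inequality, which belongs to the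
  normed space structure: expand the square of \<open>norm (x + y)\<close>.\<close>

lemma ip_le_norm: "ip x y \<le> norm x * norm y"
proof -
  have "(norm (x + y))\<^sup>2 \<le> (norm x + norm y)\<^sup>2"
    by (intro power_mono norm_triangle_ineq) simp
  then show ?thesis
    by (simp add: norm_add_ip power2_sum)
qed

lemma abs_ip_le_norm: "\<bar>ip x y\<bar> \<le> norm x * norm y"
  using ip_le_norm[of x y] ip_le_norm[of "- x" y] by (simp add: ip_minus_left)

lemma bounded_bilinear_ip: "bounded_bilinear ip"
proof
  show "\<exists>K. \<forall>a b. norm (ip a b) \<le> norm a * norm b * K"
    by (intro exI[of _ 1]) (simp add: abs_ip_le_norm)
qed (simp_all add: ip_add_left ip_add_right ip_scaleR_left ip_scaleR_right)

lemma cinner_eq_ip: "cinner x y = Complex (ip x y) (- ip (\<i> *\<^sub>C x) y)"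
  by (simp add: ip_def cinner_scaleC_left complex_eq_iff)

lemma norm_scaleC: "norm (a *\<^sub>C (x::'h::complex_hilbert_space)) = cmod a * norm x"
proof -
  have "cinner (a *\<^sub>C x) (a *\<^sub>C x) = a * cnj (a * cinner x x)"
    using cinner_commute[of x "a *\<^sub>C x"] by (simp add: cinner_scaleC_left)
  moreover have "cnj (cinner x x) = cinner x x"
    using cinner_commute[of x x] by simp
  ultimately have "cinner (a *\<^sub>C x) (a *\<^sub>C x) = (a * cnj a) * cinner x x"
    by simp
  then have "(norm (a *\<^sub>C x))\<^sup>2 = (cmod a)\<^sup>2 * (norm x)\<^sup>2"
    by (simp add: ip_self[symmetric] ip_def complex_norm_square[symmetric])
  then have "(norm (a *\<^sub>C x))\<^sup>2 = (cmod a * norm x)\<^sup>2"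
    by (simp add: power_mult_distrib)
  then show ?thesis
    by (simp add: power2_eq_iff_nonneg)
qed

lemma bounded_linear_scaleC: "bounded_linear (\<lambda>x::'h::complex_hilbert_space. a *\<^sub>C x)"
  by (rule bounded_linear_intro[where K = "cmod a"])
    (simp_all add: scaleC_add_right scaleC_scaleR norm_scaleC mult.commute)

section \<open>Density arguments, Riesz representation and adjoints\<close>

lemma dense_eqI:
  fixes f g :: "'a::topological_space \<Rightarrow> 'b::t2_space"
  assumes "closure S = UNIV" "continuous_on UNIV f" "continuous_on UNIV g" "\<And>v. v \<in> S \<Longrightarrow> f v = g v"
  shows "f x = g x"
proof -
  have "closed {x. f x = g x}"
    using assms(2,3) by (rule closed_Collect_eq)
  then have "closure S \<subseteq> {x. f x = g x}"
    using assms(4) by (intro closure_minimal) auto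
  then show ?thesis using assms(1) by auto
qed

lemma dense_leI:
  fixes f g :: "'a::topological_space \<Rightarrow> real"
  assumes "closure S = UNIV" "continuous_on UNIV f" "continuous_on UNIV g" "\<And>v. v \<in> S \<Longrightarrow> f v \<le> g v"
  shows "f x \<le> g x"
proof -
  have "closed {x. f x \<le> g x}"
    using assms(2,3) by (rule closed_Collect_le)
  then have "closure S \<subseteq> {x. f x \<le> g x}"
    using assms(4) by (intro closure_minimal) auto
  then show ?thesis using assms(1) by auto
qed

lemma continuous_on_ip:
  assumes "continuous_on S f" "continuous_on S g"
  shows "continuous_on S (\<lambda>x. ip (f x) (g x))"
  using bounded_bilinear.continuous_on[OF bounded_bilinear_ip assms] .

lemma ip_dense_eqI:
  assumes "closure S = UNIV" "\<And>v. v \<in> S \<Longrightarrow> ip v u = ip v w"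
  shows "u = w"
proof -
  have "ip (u - w) u = ip (u - w) w"
    by (rule dense_eqI[OF assms(1), where f = "\<lambda>v. ip v u" and g = "\<lambda>v. ip v w"])
      (auto intro!: continuous_on_ip continuous_intros assms(2))
  then have "(norm (u - w))\<^sup>2 = 0"
    by (simp add: ip_self[symmetric] ip_diff_right)
  then show ?thesis by simp
qed

text \<open>Density extends the inequality to all test vectors, and \<open>u\<close> itself is then
  the test vector.\<close>

lemma norm_dense_leI:
  assumes "closure S = UNIV" "\<And>v. v \<in> S \<Longrightarrow> ip v u \<le> C * norm v" "C \<ge> 0"
  shows "norm u \<le> C"
proof -
  have "ip u u \<le> C * norm u"
    by (rule dense_leI[OF assms(1), where f = "\<lambda>v. ip v u" and g = "\<lambda>v. C * norm v"])
      (auto intro!: continuous_on_ip continuous_intros assms(2))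
  then show ?thesis
    using assms(3) by (cases "u = 0") (auto simp: ip_self power2_eq_square)
qed

text \<open>A minimising sequence of \<open>\<parallel>v\<parallel>\<^sup>2 - 2 f(v)\<close> is Cauchy by the parallelogram law.\<close>

lemma riesz_dense:
  fixes f :: "'h::complex_hilbert_space \<Rightarrow> real"
  assumes S: "subspace S"
    and add: "\<And>v w. v \<in> S \<Longrightarrow> w \<in> S \<Longrightarrow> f (v + w) = f v + f w"
    and scale: "\<And>r v. v \<in> S \<Longrightarrow> f (r *\<^sub>R v) = r * f v"
    and bound: "\<And>v. v \<in> S \<Longrightarrow> \<bar>f v\<bar> \<le> C * norm v"
  obtains u where "\<And>v. v \<in> S \<Longrightarrow> f v = ip v u"
proof -
  define J where "J v = (norm v)\<^sup>2 - 2 * f v" for v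
  define m where "m = Inf (J ` S)"
  have below: "J v \<ge> - C\<^sup>2" if "v \<in> S" for v
  proof -
    have "0 \<le> (norm v - C)\<^sup>2" by simp
    then have "(norm v)\<^sup>2 - 2 * (C * norm v) \<ge> - C\<^sup>2"
      by (simp add: power2_diff algebra_simps)
    then show ?thesis
      using bound[OF that] by (simp add: J_def)
  qed
  have m: "m \<le> J v" if "v \<in> S" for v
    unfolding m_def using that below by (intro cInf_lower bdd_belowI2[where m = "- C\<^sup>2"]) auto
  have ne: "J ` S \<noteq> {}" using subspace_0[OF S] by auto
  have "\<exists>v\<in>S. J v < m + 1 / Suc n" for n
    using cInf_lessD[OF ne, of "m + 1 / Suc n"] by (auto simp: m_def)
  then obtain v where v: "\<And>n. v n \<in> S" "\<And>n. J (v n) < m + 1 / Suc n"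
    by metis
  \<comment> \<open>The midpoint of \<open>x\<close> and \<open>y\<close> lies in \<open>S\<close>,
    so its value under \<open>J\<close> is at least \<open>m\<close>; the parallelogram law turns
    this into a bound for the distance.\<close>
  have par: "(norm (x - y))\<^sup>2 \<le> 2 * (J x + J y - 2 * m)" if "x \<in> S" "y \<in> S" for x y
  proof -
    have xy: "x + y \<in> S" using that S by (simp add: subspace_add)
    then have "m \<le> J ((1/2) *\<^sub>R (x + y))"
      using S by (intro m) (simp add: subspace_scale)
    also have "\<dots> = (norm (x + y))\<^sup>2 / 4 - f x - f y"
    proof -
      have "norm ((1/2) *\<^sub>R (x + y)) = norm (x + y) / 2"
        by (subst norm_scaleR) simp
      then show ?thesis
        unfolding J_def scale[OF xy] add[OF that] by (simp only: power_divide) (simp add: field_simps)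
    qed
    finally have "4 * m \<le> (norm (x + y))\<^sup>2 - 4 * f x - 4 * f y" by simp
    then show ?thesis
      using norm_add_ip[of x y] norm_add_ip[of x "- y"] by (simp add: J_def ip_minus_right)
  qed
  have "Cauchy v"
  proof (rule metric_CauchyI)
    fix e :: real assume "e > 0"
    then obtain N :: nat where N: "inverse (real (Suc N)) < e\<^sup>2 / 4"
      using reals_Archimedean[of "e\<^sup>2 / 4"] by auto
    show "\<exists>N. \<forall>i\<ge>N. \<forall>j\<ge>N. dist (v i) (v j) < e"
    proof (intro exI[of _ N] allI impI)
      fix i j assume ij: "N \<le> i" "N \<le> j"
      then have "1 / real (Suc i) \<le> 1 / real (Suc N)" "1 / real (Suc j) \<le> 1 / real (Suc N)"
        by (simp_all add: frac_le)
      then have "(norm (v i - v j))\<^sup>2 < e\<^sup>2"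
        using par[OF v(1,1), of i j] v(2)[of i] v(2)[of j] N by (simp add: inverse_eq_divide)
      then show "dist (v i) (v j) < e"
        using \<open>e > 0\<close> by (simp add: dist_norm power2_less_imp_less)
    qed
  qed
  then obtain u where u: "v \<longlonglongrightarrow> u"
    using Cauchy_convergent convergentD by blast
  show thesis
  proof
    fix w assume w: "w \<in> S"
    define d where "d = ip u w - f w"
    \<comment> \<open>The limit \<open>u\<close> is only known to lie in the closure of
      \<open>S\<close>, where nothing is assumed about \<open>f\<close>. The variation by
      \<open>t *\<^sub>R w\<close> is therefore made at \<open>v n\<close>, which is minimal up to
      \<open>1 / Suc n\<close>, before passing to the limit.\<close>
    have pos: "0 \<le> 2 * t * d + t\<^sup>2 * (norm w)\<^sup>2" for t
    proof (rule tendsto_lowerbound)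
      show "((\<lambda>n. 1 / Suc n + 2 * t * (ip (v n) w - f w) + t\<^sup>2 * (norm w)\<^sup>2) \<longlongrightarrow> 2 * t * d + t\<^sup>2 * (norm w)\<^sup>2) sequentially"
      proof -
        have "((\<lambda>n. 1 / real (Suc n) + 2 * t * (ip (v n) w - f w) + t\<^sup>2 * (norm w)\<^sup>2) \<longlongrightarrow>
            0 + 2 * t * (ip u w - f w) + t\<^sup>2 * (norm w)\<^sup>2) sequentially"
          by (intro tendsto_intros bounded_bilinear.tendsto[OF bounded_bilinear_ip] u
              LIMSEQ_Suc[OF lim_1_over_n])
        then show ?thesis by (simp add: d_def)
      qed
      have "0 \<le> 1 / Suc n + 2 * t * (ip (v n) w - f w) + t\<^sup>2 * (norm w)\<^sup>2" for n
      proof -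
        have tw: "t *\<^sub>R w \<in> S" using w S by (simp add: subspace_scale)
        then have "m \<le> J (v n + t *\<^sub>R w)"
          using v(1) S by (intro m) (simp add: subspace_add)
        also have "\<dots> = J (v n) + 2 * t * (ip (v n) w - f w) + t\<^sup>2 * (norm w)\<^sup>2"
          unfolding J_def add[OF v(1) tw] scale[OF w] norm_add_ip
          by (simp add: ip_scaleR_right power_mult_distrib algebra_simps)
        finally show ?thesis using v(2)[of n] by simp
      qed
      then show "\<forall>\<^sub>F n in sequentially. 0 \<le> 1 / Suc n + 2 * t * (ip (v n) w - f w) + t\<^sup>2 * (norm w)\<^sup>2"
        by simp
    qed simp
    \<comment> \<open>The summand 1 keeps \<open>k\<close> positive for \<open>w = 0\<close>; the
      test value \<open>t = - d / k\<close> in \<open>pos\<close> then forces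
      \<open>d = 0\<close>.\<close>
    define k where "k = 1 + (norm w)\<^sup>2"
    have k: "k > 0" by (simp add: k_def add_pos_nonneg)
    have "0 \<le> k\<^sup>2 * (2 * (- d / k) * d + (- d / k)\<^sup>2 * (norm w)\<^sup>2)"
      using pos[of "- d / k"] k by simp
    also have "\<dots> = - 2 * d\<^sup>2 * k + d\<^sup>2 * (norm w)\<^sup>2"
      using k by (simp add: field_simps power2_eq_square)
    also have "\<dots> = - d\<^sup>2 * (2 + (norm w)\<^sup>2)"
      by (simp add: k_def algebra_simps)
    finally have "d\<^sup>2 * (2 + (norm w)\<^sup>2) \<le> 0" by simp
    moreover have "2 + (norm w)\<^sup>2 > 0" by (simp add: add_pos_nonneg)
    ultimately have "d\<^sup>2 \<le> 0" by (simp add: mult_le_0_iff)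
    then have "d = 0" by simp
    then show "f w = ip w u" by (simp add: d_def ip_commute)
  qed
qed

text \<open>Defined for every real-linear operator, so that it is a bounded linear map of the whole
  operator space and can be composed with smooth operator-valued maps. On complex-linear operators
  it is the usual adjoint.\<close>

definition radj :: "('h::complex_hilbert_space \<Rightarrow>\<^sub>L 'h) \<Rightarrow> ('h \<Rightarrow>\<^sub>L 'h)" where
  "radj T = (SOME B. \<forall>v w. ip (T v) w = ip v (blinfun_apply B w))"

lemma ip_radj: "ip (blinfun_apply T v) w = ip v (blinfun_apply (radj T) w)"
proof -
  have "\<exists>u. \<forall>v. ip (T v) w = ip v u" for w
  proof (rule riesz_dense[of UNIV "\<lambda>v. ip (T v) w" "norm T * norm w"])
    show "\<bar>ip (T v) w\<bar> \<le> norm T * norm w * norm v" for v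
    proof -
      have "\<bar>ip (T v) w\<bar> \<le> norm (T v) * norm w" by (rule abs_ip_le_norm)
      also have "\<dots> \<le> (norm T * norm v) * norm w"
        by (intro mult_right_mono norm_blinfun) simp
      finally show ?thesis by (simp add: mult_ac)
    qed
  qed (auto simp: blinfun.add_right blinfun.scaleR_right ip_add_left ip_scaleR_left)
  then obtain b where b: "\<And>v w. ip (T v) w = ip v (b w)" by metis
  have "bounded_linear b"
  proof (rule bounded_linear_intro[where K = "norm T"])
    show "b (x + y) = b x + b y" for x y
      by (rule ip_dense_eqI[of UNIV]) (simp_all add: b[symmetric] ip_add_right)
    show "b (r *\<^sub>R x) = r *\<^sub>R b x" for r x
      by (rule ip_dense_eqI[of UNIV]) (simp_all add: b[symmetric] ip_scaleR_right)
    show "norm (b x) \<le> norm x * norm T" for x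
    proof (rule norm_dense_leI[of UNIV])
      fix v
      have "ip v (b x) \<le> norm (T v) * norm x" using ip_le_norm by (simp add: b[symmetric])
      also have "\<dots> \<le> (norm T * norm v) * norm x"
        by (intro mult_right_mono norm_blinfun) simp
      finally show "ip v (b x) \<le> norm x * norm T * norm v" by (simp add: mult_ac)
    qed simp_all
  qed
  then have "\<forall>v w. ip (T v) w = ip v (Blinfun b w)"
    by (simp add: bounded_linear_Blinfun_apply b)
  then have "\<forall>v w. ip (T v) w = ip v (radj T w)"
    unfolding radj_def by (rule someI)
  then show ?thesis by blast
qed

lemma radj_eqI:
  assumes "\<And>v w. ip (blinfun_apply T v) w = ip v (blinfun_apply B w)"
  shows "radj T = B"
proof (rule blinfun_eqI)
  fix w show "radj T w = B w"
    by (rule ip_dense_eqI[of UNIV]) (simp_all add: ip_radj[symmetric] assms)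
qed

lemma bounded_linear_radj: "bounded_linear radj"
proof (rule bounded_linear_intro[where K = 1])
  show "radj (S + T) = radj S + radj T" for S T :: "'a \<Rightarrow>\<^sub>L 'a"
    by (rule radj_eqI) (simp add: blinfun.add_left ip_add_left ip_add_right ip_radj)
  show "radj (r *\<^sub>R T) = r *\<^sub>R radj T" for r and T :: "'a \<Rightarrow>\<^sub>L 'a"
    by (rule radj_eqI) (simp add: blinfun.scaleR_left ip_scaleR_left ip_scaleR_right ip_radj)
  show "norm (radj T) \<le> norm T * 1" for T :: "'a \<Rightarrow>\<^sub>L 'a"
  proof (rule norm_blinfun_bound)
    fix w show "norm (radj T w) \<le> norm T * 1 * norm w"
    proof (rule norm_dense_leI[of UNIV])
      fix v
      have "ip v (radj T w) \<le> norm (T v) * norm w" using ip_le_norm by (simp add: ip_radj[symmetric])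
      also have "\<dots> \<le> (norm T * norm v) * norm w"
        by (intro mult_right_mono norm_blinfun) simp
      finally show "ip v (radj T w) \<le> norm T * 1 * norm w * norm v" by (simp add: mult_ac)
    qed simp_all
  qed simp
qed

text \<open>Complex linearity moves \<i> through \<open>A\<close> and thus yields the imaginary part
  of the adjoint identity; uniqueness is that of the real adjoint.\<close>

lemma cadjoint_eq_radj:
  assumes "clinear_op A"
  shows "cadjoint A = radj A"
  unfolding cadjoint_def
proof (rule the_equality)
  show "\<forall>v w. cinner (A v) w = cinner v (radj A w)"
  proof (intro allI)
    fix v w
    have "\<i> *\<^sub>C A v = A (\<i> *\<^sub>C v)"
      using assms by (simp add: clinear_op_def)
    then show "cinner (A v) w = cinner v (radj A w)"
      by (simp add: cinner_eq_ip[of "A v"] cinner_eq_ip[of v] ip_radj)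
  qed
  show "B = radj A" if "\<forall>v w. cinner (A v) w = cinner v (blinfun_apply B w)" for B
    using that by (intro radj_eqI[symmetric]) (simp add: ip_def)
qed

lemma ip_scaleC_right: "ip v (a *\<^sub>C w) = ip (cnj a *\<^sub>C v) w"
proof -
  have "cinner v (a *\<^sub>C w) = cnj (a * cinner w v)"
    by (subst cinner_commute) (simp add: cinner_scaleC_left)
  also have "\<dots> = cnj a * cinner v w"
    using cinner_commute[of v w] by simp
  finally show ?thesis by (simp add: ip_def cinner_scaleC_left)
qed

lemma clinear_op_radj:
  assumes "clinear_op A"
  shows "clinear_op (radj A)"
  unfolding clinear_op_def
proof (intro allI)
  fix a w
  show "radj A (a *\<^sub>C w) = a *\<^sub>C radj A w"
  proof (rule ip_dense_eqI[of UNIV])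
    fix v
    show "ip v (radj A (a *\<^sub>C w)) = ip v (a *\<^sub>C radj A w)"
      using assms by (simp add: ip_radj[symmetric] ip_scaleC_right clinear_op_def)
  qed simp
qed

section \<open>Baire category arguments\<close>

lemma Baire_space_interior:
  fixes F :: "nat \<Rightarrow> 'a::topological_space set"
  assumes "Baire_space (euclidean :: 'a topology)" "\<And>n. closed (F n)" "(\<Union>n. F n) = UNIV"
  obtains n where "interior (F n) \<noteq> {}"
proof (rule ccontr)
  assume "\<not> thesis"
  then have int: "interior (F n) = {}" for n using that by blast
  have "countable (range (\<lambda>n. - F n)) \<and>
      (\<forall>T\<in>range (\<lambda>n. - F n). openin euclidean T \<and> euclidean closure_of T = topspace (euclidean :: 'a topology))"
    using assms(2) int by (auto simp: closure_complement)
  then have "euclidean closure_of (topspace euclidean \<inter> \<Inter>(range (\<lambda>n. - F n))) = topspace (euclidean :: 'a topology)"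
    using assms(1) unfolding Baire_space_def by blast
  moreover have "\<Inter>(range (\<lambda>n. - F n)) = {}"
    using assms(3) by auto
  ultimately show False by simp
qed

lemma Baire_space_complete: "Baire_space (euclidean :: 'a::complete_space topology)"
  unfolding Baire_space_def
proof (intro allI impI)
  fix \<G> :: "'a set set"
  assume "countable \<G> \<and> (\<forall>T\<in>\<G>. openin euclidean T \<and> euclidean closure_of T = topspace euclidean)"
  then have "euclidean closure_of \<Inter>\<G> = topspace (euclidean :: 'a topology)"
    by (intro Baire_category) (auto simp: completely_metrizable_space_euclidean)
  then show "euclidean closure_of (topspace euclidean \<inter> \<Inter>\<G>) = topspace (euclidean :: 'a topology)"
    by simp
qed

lemma frechet_space_metrizable_Baire:
  assumes "frechet_space TYPE('e::locally_convex_space)"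
  shows "metrizable_space (euclidean :: 'e topology)" "Baire_space (euclidean :: 'e topology)"
proof -
  obtain d where d: "Metric_space (UNIV :: 'e set) d" "Metric_space.mcomplete UNIV d"
    "Metric_space.mtopology UNIV d = (euclidean :: 'e topology)"
    using assms unfolding frechet_space_def by blast
  then show "metrizable_space (euclidean :: 'e topology)"
    using Metric_space.metrizable_space_mtopology by metis
  have cm: "completely_metrizable_space (euclidean :: 'e topology)"
    using d Metric_space.completely_metrizable_space_mtopology by metis
  show "Baire_space (euclidean :: 'e topology)"
    unfolding Baire_space_def
  proof (intro allI impI)
    fix \<G> :: "'e set set"
    assume "countable \<G> \<and> (\<forall>T\<in>\<G>. openin euclidean T \<and> euclidean closure_of T = topspace euclidean)"
    then have "euclidean closure_of \<Inter>\<G> = topspace (euclidean :: 'e topology)"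
      using cm by (intro Baire_category) auto
    then show "euclidean closure_of (topspace euclidean \<inter> \<Inter>\<G>) = topspace (euclidean :: 'e topology)"
      by simp
  qed
qed

text \<open>A uniform boundedness principle on a domain without a norm. Some \<open>F n\<close> has
  an interior point \<open>x0\<close>, and subtracting \<open>T i x0\<close> moves the bound to a
  neighbourhood of 0 at the cost of doubling it.\<close>

lemma Baire_linear_family:
  fixes T :: "'i \<Rightarrow> 'e::locally_convex_space \<Rightarrow> 'f::real_normed_vector"
  assumes B: "Baire_space (euclidean :: 'e topology)"
    and T: "\<And>i. i \<in> I \<Longrightarrow> continuous_on UNIV (T i)"
    and diff: "\<And>i x y. i \<in> I \<Longrightarrow> T i (x - y) = T i x - T i y"
    and bd: "\<And>x. \<exists>C. \<forall>i\<in>I. norm (T i x) \<le> C"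
  obtains V C where "open V" "convex V" "0 \<in> V" "\<And>x i. x \<in> V \<Longrightarrow> i \<in> I \<Longrightarrow> norm (T i x) \<le> C"
proof -
  define F where "F n = (\<Inter>i\<in>I. {x. norm (T i x) \<le> real n})" for n
  have "closed (F n)" for n
    unfolding F_def by (intro closed_INT ballI closed_Collect_le continuous_intros T)
  moreover have "(\<Union>n. F n) = UNIV"
  proof -
    have "\<exists>n. x \<in> F n" for x
    proof -
      obtain C where "\<forall>i\<in>I. norm (T i x) \<le> C" using bd by blast
      moreover obtain n where "C \<le> real n" using real_arch_simple by blast
      ultimately show ?thesis
        unfolding F_def by (intro exI[of _ n]) (auto intro: order_trans)
    qed
    then show ?thesis by blast
  qed
  ultimately obtain n x0 where x0: "x0 \<in> interior (F n)"
    using Baire_space_interior[OF B] by blast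
  have "open ((\<lambda>y. x0 + y) -` interior (F n))"
    by (intro open_vimage open_interior continuous_intros)
  moreover have "0 \<in> (\<lambda>y. x0 + y) -` interior (F n)"
    using x0 by simp
  ultimately obtain V where V: "open V" "convex V" "0 \<in> V" "V \<subseteq> (\<lambda>y. x0 + y) -` interior (F n)"
    by (rule convex_open_nbhd)
  show thesis
  proof (rule that[OF V(1-3)])
    fix x i assume "x \<in> V" "i \<in> I"
    then have "x0 + x \<in> F n" "x0 \<in> F n"
      using V(4) x0 interior_subset by blast+
    then have "norm (T i (x0 + x)) \<le> n" "norm (T i x0) \<le> n"
      using \<open>i \<in> I\<close> by (auto simp: F_def)
    moreover have "T i x = T i (x0 + x) - T i x0"
      using diff[OF \<open>i \<in> I\<close>, of "x0 + x" x0] by simp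
    ultimately show "norm (T i x) \<le> real n + real n"
      using norm_triangle_ineq4[of "T i (x0 + x)" "T i x0"] by simp
  qed
qed

lemma uniform_boundedness:
  fixes T :: "'i \<Rightarrow> 'a::banach \<Rightarrow> 'b::real_normed_vector"
  assumes T: "\<And>i. i \<in> I \<Longrightarrow> bounded_linear (T i)"
    and bd: "\<And>x. \<exists>C. \<forall>i\<in>I. norm (T i x) \<le> C"
  obtains C where "\<And>i x. i \<in> I \<Longrightarrow> norm (T i x) \<le> C * norm x"
proof -
  obtain V C where V: "open V" "0 \<in> V" "\<And>x i. x \<in> V \<Longrightarrow> i \<in> I \<Longrightarrow> norm (T i x) \<le> C"
    using Baire_linear_family[OF Baire_space_complete, of I T]
      linear_continuous_on[OF T] linear_diff[OF bounded_linear.linear[OF T]] bd by metis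
  obtain e where e: "e > 0" "cball 0 e \<subseteq> V"
    using V(1,2) open_contains_cball by blast
  show thesis
  proof
    fix i x assume i: "i \<in> I"
    interpret bounded_linear "T i" using T[OF i] .
    show "norm (T i x) \<le> (C / e) * norm x"
    proof (cases "x = 0")
      case False
      have "(e / norm x) *\<^sub>R x \<in> V"
        using e False by (intro subsetD[OF e(2)]) simp
      then have "norm (T i ((e / norm x) *\<^sub>R x)) \<le> C"
        using V(3) i by blast
      then show ?thesis
        using False e(1) by (simp add: scaleR field_simps)
    qed (simp add: zero)
  qed
qed

section \<open>Local bounds in metrizable spaces from bounds along sequences\<close>

lemma metrizable_euclidean_fun:
  assumes "metrizable_space (euclidean :: 'e::topological_space topology)"
  shows "metrizable_space (euclidean :: (nat \<Rightarrow> 'e) topology)"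
  using assms by (subst euclidean_product_topology[symmetric]) (simp add: metrizable_space_product_topology)

lemma metrizable_euclidean_prod:
  assumes "metrizable_space (euclidean :: 'e::topological_space topology)"
    and "metrizable_space (euclidean :: 'f::topological_space topology)"
  shows "metrizable_space (euclidean :: ('e \<times> 'f) topology)"
  using assms by (subst prod_topology_euclidean[symmetric], subst metrizable_space_prod_topology) blast

text \<open>If every ball of radius \<open>inverse (Suc k)\<close> contained a point violating the
  bound \<open>k\<close>, these points would form a sequence converging to \<open>x\<close> without
  a common bound.\<close>

lemma metrizable_locally_boundedI:
  fixes x :: "'a::topological_space"
  assumes met: "metrizable_space (euclidean :: 'a topology)"
    and mono: "\<And>C C' y. P C y \<Longrightarrow> C \<le> C' \<Longrightarrow> P C' y"
    and seq: "\<And>\<xi>. \<xi> \<longlonglongrightarrow> x \<Longrightarrow> \<exists>C. \<forall>k. P C (\<xi> k)"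
  obtains W C where "open W" "x \<in> W" "\<And>y. y \<in> W \<Longrightarrow> P (C::real) y"
proof (rule ccontr)
  assume neg: "\<not> thesis"
  obtain M d where "Metric_space M d" and Md: "(euclidean :: 'a topology) = Metric_space.mtopology M d"
    using met unfolding metrizable_space_def by blast
  then interpret Metric_space M d by simp
  have M: "M = UNIV"
    using Md topspace_mtopology by (metis topspace_euclidean)
  have op: "open (mball x r)" for r
    using openin_mball[of x r] by (simp add: Md[symmetric])
  have "\<exists>y. y \<in> mball x (inverse (Suc k)) \<and> \<not> P (real k) y" for k
  proof (rule ccontr)
    assume "\<not> ?thesis"
    then have "\<And>y. y \<in> mball x (inverse (Suc k)) \<Longrightarrow> P (real k) y" by blast
    moreover have "x \<in> mball x (inverse (Suc k))"
      by (subst centre_in_mball_iff) (simp add: M)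
    ultimately show False using neg that op by blast
  qed
  then obtain \<xi> where \<xi>: "\<And>k. \<xi> k \<in> mball x (inverse (Suc k))" "\<And>k. \<not> P (real k) (\<xi> k)"
    by metis
  have "limitin mtopology \<xi> x sequentially"
    unfolding limitin_metric
  proof (intro conjI allI impI)
    fix e :: real assume "e > 0"
    then have "\<forall>\<^sub>F k in sequentially. inverse (real (Suc k)) < e"
      by (rule order_tendstoD(2)[OF LIMSEQ_inverse_real_of_nat])
    then show "\<forall>\<^sub>F k in sequentially. \<xi> k \<in> M \<and> d (\<xi> k) x < e"
    proof eventually_elim
      case (elim k)
      have "d (\<xi> k) x < inverse (Suc k)"
        using \<xi>(1)[of k] commute by (metis in_mball)
      then show ?case using elim M by simp
    qed
  qed (simp add: M)
  then have "\<xi> \<longlonglongrightarrow> x" by (simp add: Md[symmetric])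
  from seq[OF this] obtain C where "\<And>k. P C (\<xi> k)" by blast
  moreover obtain k where "C \<le> real k" using real_arch_simple by blast
  ultimately show False using mono \<xi>(2) by blast
qed

section \<open>Operator-valued maps: norm smoothness from bounds on a dense subspace\<close>

lemma blinfun_dense_extension:
  fixes T :: "'h::real_normed_vector \<Rightarrow> 'k::banach"
  assumes S: "subspace S" "closure S = UNIV"
    and add: "\<And>v w. v \<in> S \<Longrightarrow> w \<in> S \<Longrightarrow> T (v + w) = T v + T w"
    and scale: "\<And>r v. v \<in> S \<Longrightarrow> T (r *\<^sub>R v) = r *\<^sub>R T v"
    and bd: "\<And>v. v \<in> S \<Longrightarrow> norm (T v) \<le> C * norm v"
  shows "\<exists>L. \<forall>v\<in>S. blinfun_apply L v = T v"
proof -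
  have diff: "T v - T w = T (v - w)" if "v \<in> S" "w \<in> S" for v w
    using add[of "v - w" w] that S(1) by (simp add: subspace_diff)
  have "uniformly_continuous_on S T"
    unfolding uniformly_continuous_on_def
  proof (intro allI impI)
    fix e :: real assume e: "e > 0"
    show "\<exists>d>0. \<forall>x\<in>S. \<forall>x'\<in>S. dist x' x < d \<longrightarrow> dist (T x') (T x) < e"
    proof (intro exI[of _ "e / (\<bar>C\<bar> + 1)"] conjI ballI impI)
      fix x x' assume x: "x \<in> S" "x' \<in> S" "dist x' x < e / (\<bar>C\<bar> + 1)"
      have "norm (T (x' - x)) \<le> C * norm (x' - x)"
        using x S(1) by (intro bd) (simp add: subspace_diff)
      also have "\<dots> \<le> (\<bar>C\<bar> + 1) * norm (x' - x)"
        by (intro mult_right_mono) auto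
      also have "\<dots> < e"
        using x(3) by (simp add: dist_norm field_simps)
      finally show "dist (T x') (T x) < e"
        using diff[OF x(2,1)] by (simp add: dist_norm)
    qed (use e in simp)
  qed
  then obtain g where "uniformly_continuous_on (closure S) g" and g: "\<And>x. x \<in> S \<Longrightarrow> T x = g x"
    by (rule uniformly_continuous_on_extension_on_closure) blast
  then have gc: "continuous_on UNIV g"
    using S(2) uniformly_continuous_imp_continuous by metis
  have gc': "continuous_on UNIV (\<lambda>x. g (f x))" if "continuous_on UNIV f" for f :: "'h \<Rightarrow> 'h"
    using continuous_on_compose2[OF gc that] by simp
  have gadd: "g (v + w) = g v + g w" if "v \<in> S" "w \<in> S" for v w
    using g[OF that(1)] g[OF that(2)] g[OF subspace_add[OF S(1) that]] add[OF that] by simp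
  have "g (x + y) = g x + g y" for x y
  proof -
    have "g (x + y) = g x + g y" if "y \<in> S" for x y
      by (rule dense_eqI[OF S(2), where f = "\<lambda>x. g (x + y)"])
        (use that gadd in \<open>auto intro!: gc' continuous_intros\<close>)
    then show ?thesis
      by - (rule dense_eqI[OF S(2), where f = "\<lambda>y. g (x + y)" and g = "\<lambda>y. g x + g y"],
        auto intro!: gc' continuous_intros)
  qed
  moreover have "g (r *\<^sub>R v) = r *\<^sub>R g v" if "v \<in> S" for r v
    using g[OF that] g[OF subspace_scale[OF S(1) that]] scale[OF that] by simp
  then have "g (r *\<^sub>R x) = r *\<^sub>R g x" for r x
    by - (rule dense_eqI[OF S(2), where f = "\<lambda>x. g (r *\<^sub>R x)"],
      auto intro!: gc' continuous_intros)
  moreover have "norm (g x) \<le> norm x * C" for x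
    by (rule dense_leI[OF S(2), where f = "\<lambda>x. norm (g x)"])
      (use g bd in \<open>auto intro!: gc' continuous_intros simp: mult.commute\<close>)
  ultimately have "bounded_linear g"
    by (rule bounded_linear_intro)
  then show ?thesis
    using g by (intro exI[of _ "Blinfun g"]) (simp add: bounded_linear_Blinfun_apply)
qed

lemma norm_blinfun_dense_leI:
  fixes L :: "'h::real_normed_vector \<Rightarrow>\<^sub>L 'k::real_normed_vector"
  assumes "closure S = UNIV" "\<And>v. v \<in> S \<Longrightarrow> norm (blinfun_apply L v) \<le> C * norm v" "C \<ge> 0"
  shows "norm L \<le> C"
proof (rule norm_blinfun_bound[OF assms(3)])
  show "norm (L x) \<le> C * norm x" for x
    by (rule dense_leI[OF assms(1), where f = "\<lambda>x. norm (L x)"])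
      (auto intro!: continuous_intros assms(2))
qed

lemma smooth_on_norm_dir_quot_le:
  fixes f :: "'e::locally_convex_space \<Rightarrow> 'f::real_normed_vector"
  assumes f: "smooth_on U f" and t: "t \<noteq> 0"
    and d: "\<And>s. s \<in> {0..1} \<Longrightarrow> x + (s * t) *\<^sub>R k \<in> U \<and> norm (dir_deriv f (x + (s * t) *\<^sub>R k) k - l) \<le> B"
  shows "norm (dir_quot f x k t - l) \<le> B"
proof (rule field_le_epsilon)
  fix e :: real assume "e > 0"
  \<comment> \<open>The mean value estimate needs an open convex set, so the closed bound is
    approached through slightly larger balls.\<close>
  have "dir_quot f x k t \<in> ball l (B + e)"
  proof (rule mvt_dir_quot[OF open_ball convex_ball t])
    fix s :: real assume "s \<in> {0..1}"
    from d[OF this] show "dir_differentiable f (x + (s * t) *\<^sub>R k) k \<and> dir_deriv f (x + (s * t) *\<^sub>R k) k \<in> ball l (B + e)"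
      using smooth_on_dir_differentiable[OF f] \<open>e > 0\<close> by (auto simp: dist_norm norm_minus_commute)
  qed
  then show "norm (dir_quot f x k t - l) \<le> B + e"
    by (simp add: dist_norm norm_minus_commute)
qed

lemma tendsto_fun_updI:
  assumes "\<And>l. l \<noteq> i \<Longrightarrow> ((\<lambda>t. z t l) \<longlongrightarrow> h l) F" "(w \<longlongrightarrow> c) F"
  shows "((\<lambda>t. (z t)(i := w t)) \<longlongrightarrow> h(i := c)) F"
  using assms by (intro tendsto_funI) auto

text \<open>The bound on the derivative of the next order, rescaled by homogeneity, makes each derivative
  continuous in norm.\<close>

lemma smooth_on_blinfun:
  fixes f :: "'e::locally_convex_space \<Rightarrow> ('h::real_normed_vector \<Rightarrow>\<^sub>L 'k::banach)"
  assumes U: "open U" and S: "subspace S" "closure S = UNIV"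
    and sm: "\<And>v. v \<in> S \<Longrightarrow> smooth_on U (\<lambda>a. f a v)"
    and bd: "\<And>j a h. a \<in> U \<Longrightarrow> \<exists>W C. open W \<and> (a, h) \<in> W \<and>
      (\<forall>b k v. (b, k) \<in> W \<longrightarrow> b \<in> U \<longrightarrow> v \<in> S \<longrightarrow> norm (iter_deriv j (\<lambda>a. f a v) b k) \<le> C * norm v)"
  shows "smooth_on U f"
proof -
  define u where "u v j b k = iter_deriv j (\<lambda>a. f a v) b k" for v j b k
  have ev_bd: "\<exists>C>0. \<forall>\<^sub>F p in nhds (a, h). fst p \<in> U \<and> (\<forall>v\<in>S. norm (u v j (fst p) (snd p)) \<le> C * norm v)"
    if a: "a \<in> U" for a h j
  proof -
    obtain W C where W: "open W" "(a, h) \<in> W"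
      "\<And>b k v. (b, k) \<in> W \<Longrightarrow> b \<in> U \<Longrightarrow> v \<in> S \<Longrightarrow> norm (u v j b k) \<le> C * norm v"
      using bd[OF a, of h j] unfolding u_def by metis
    have "open (W \<inter> U \<times> UNIV)" "(a, h) \<in> W \<inter> U \<times> UNIV"
      using W U a by (auto intro: open_Times)
    then have "\<forall>\<^sub>F p in nhds (a, h). p \<in> W \<inter> U \<times> UNIV"
      by (rule eventually_nhds_in_open)
    then have "\<forall>\<^sub>F p in nhds (a, h). fst p \<in> U \<and> (\<forall>v\<in>S. norm (u v j (fst p) (snd p)) \<le> (\<bar>C\<bar> + 1) * norm v)"
    proof eventually_elim
      case (elim p)
      have "norm (u v j (fst p) (snd p)) \<le> (\<bar>C\<bar> + 1) * norm v" if "v \<in> S" for v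
      proof -
        have "norm (u v j (fst p) (snd p)) \<le> C * norm v"
          using elim that by (intro W(3)) auto
        also have "\<dots> \<le> (\<bar>C\<bar> + 1) * norm v"
          by (intro mult_right_mono) auto
        finally show ?thesis .
      qed
      then show ?case using elim by auto
    qed
    then show ?thesis
      by (intro exI[of _ "\<bar>C\<bar> + 1"]) auto
  qed
  have ex: "\<exists>L. a \<in> U \<longrightarrow> (\<forall>v\<in>S. blinfun_apply L v = u v j a h)" for j a h
  proof (cases "a \<in> U")
    case True
    obtain C where C: "\<And>v. v \<in> S \<Longrightarrow> norm (u v j a h) \<le> C * norm v"
      using ev_bd[OF True, of j h] eventually_nhds_x_imp_x by fastforce
    have "\<exists>L. \<forall>v\<in>S. blinfun_apply L v = u v j a h"
    proof (rule blinfun_dense_extension[OF S _ _ C])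
      fix v w assume "v \<in> S" "w \<in> S"
      then show "u (v + w) j a h = u v j a h + u w j a h"
        using iter_deriv_add[OF sm sm True] by (simp add: u_def blinfun.add_right)
    next
      fix r v assume "v \<in> S"
      have "iter_deriv j (\<lambda>a. r *\<^sub>R f a v) a h = r *\<^sub>R iter_deriv j (\<lambda>a. f a v) a h"
        by (rule iter_deriv_scaleR[OF sm[OF \<open>v \<in> S\<close>] True])
      then show "u (r *\<^sub>R v) j a h = r *\<^sub>R u v j a h"
        by (simp add: u_def blinfun.scaleR_right)
    qed
    then show ?thesis by blast
  qed simp
  define D where "D j a h = (SOME L. a \<in> U \<longrightarrow> (\<forall>v\<in>S. blinfun_apply L v = u v j a h))" for j a h
  have D: "blinfun_apply (D j a h) v = u v j a h" if "a \<in> U" "v \<in> S" for j a h v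
    using someI_ex[OF ex[of a j h]] that unfolding D_def[symmetric] by blast
  have dirs: "\<forall>\<^sub>F k in nhds h. \<forall>v\<in>S. norm (u v j a k - u v j a h) \<le> e * norm v"
    if a: "a \<in> U" and e: "e > 0" for j a h e
  proof -
    define mx where "mx k i = (\<lambda>l. if l < i then k l else h l)" for k :: "nat \<Rightarrow> 'e" and i :: nat
    have "\<forall>\<^sub>F k in nhds h. \<forall>v\<in>S. norm (u v j a ((mx k i)(i := k i - h i))) \<le> (e / (real j + 1)) * norm v" if i: "i < j" for i
    proof -
      \<comment> \<open>The \<open>j\<close> slots share the tolerance \<open>e\<close>; the summand
        1 avoids division by zero for \<open>j = 0\<close>.\<close>
      define e' where "e' = e / (real j + 1)"
      have e': "e' > 0" using e by (simp add: e'_def)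
      obtain C where C: "C > 0" "\<forall>\<^sub>F p in nhds (a, h(i := 0)).
          fst p \<in> U \<and> (\<forall>v\<in>S. norm (u v j (fst p) (snd p)) \<le> C * norm v)"
        using ev_bd[OF a] by blast
      \<comment> \<open>The stretched direction \<open>N *\<^sub>R (k i - h i)\<close> still tends
        to 0, so the bound \<open>C\<close> near \<open>h(i := 0)\<close> applies to it. By
        homogeneity the unstretched direction has the bound \<open>C / N = e'\<close>.\<close>
      define N where "N = C / e'"
      have N: "N > 0" using C(1) e' by (simp add: N_def)
      have cf: "((\<lambda>k. k l) \<longlongrightarrow> h l) (nhds h)" for l
        by (rule tendsto_apply) (rule filterlim_ident)
      have "((\<lambda>k. N *\<^sub>R (k i - h i)) \<longlongrightarrow> N *\<^sub>R (h i - h i)) (nhds h)"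
        by (intro lcs_tendsto_scaleR tendsto_const tendsto_diff cf)
      then have "((\<lambda>k. (mx k i)(i := N *\<^sub>R (k i - h i))) \<longlongrightarrow> h(i := 0)) (nhds h)"
      proof (intro tendsto_fun_updI)
        show "((\<lambda>k. mx k i l) \<longlongrightarrow> h l) (nhds h)" for l
          using cf by (cases "l < i") (auto simp: mx_def)
      qed simp
      then have "((\<lambda>k. (a, (mx k i)(i := N *\<^sub>R (k i - h i)))) \<longlongrightarrow> (a, h(i := 0))) (nhds h)"
        by (intro tendsto_Pair tendsto_const)
      from eventually_compose_filterlim[OF C(2) this]
      have "\<forall>\<^sub>F k in nhds h. \<forall>v\<in>S. norm (u v j a ((mx k i)(i := N *\<^sub>R (k i - h i)))) \<le> C * norm v"
        by (rule eventually_mono) simp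
      then show ?thesis
      proof eventually_elim
        case (elim k)
        show ?case
        proof
          fix v assume v: "v \<in> S"
          have "u v j a ((mx k i)(i := N *\<^sub>R (k i - h i))) = N *\<^sub>R u v j a ((mx k i)(i := k i - h i))"
            unfolding u_def by (rule iter_deriv_scaleR_dir[OF sm[OF v] a i])
          then have "N * norm (u v j a ((mx k i)(i := k i - h i))) \<le> C * norm v"
            using elim v N by fastforce
          then show "norm (u v j a ((mx k i)(i := k i - h i))) \<le> e / (real j + 1) * norm v"
            using N C(1) e' unfolding e'_def[symmetric] by (simp add: N_def field_simps)
        qed
      qed
    qed
    then have "\<forall>\<^sub>F k in nhds h. \<forall>i\<in>{..<j}. \<forall>v\<in>S. norm (u v j a ((mx k i)(i := k i - h i))) \<le> (e / (real j + 1)) * norm v"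
      by (intro eventually_ball_finite) auto
    then show ?thesis
    proof eventually_elim
      case (elim k)
      show ?case
      proof
        fix v assume v: "v \<in> S"
        have "norm (u v j a k - u v j a h) \<le> (\<Sum>i<j. norm (u v j a ((mx k i)(i := k i - h i))))"
          unfolding u_def iter_deriv_telescope[OF sm[OF v] a, of j k h] mx_def by (rule norm_sum)
        also have "\<dots> \<le> (\<Sum>i<j. (e / (real j + 1)) * norm v)"
          using elim v by (intro sum_mono) auto
        also have "\<dots> = (real j / (real j + 1)) * (e * norm v)" by simp
        also have "\<dots> \<le> 1 * (e * norm v)"
          using e by (intro mult_right_mono) auto
        finally show "norm (u v j a k - u v j a h) \<le> e * norm v" by simp
      qed
    qed
  qed
  \<comment> \<open>The directions \<open>snd p\<close> are allowed to move with the base point, so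
    that this estimate and \<open>dirs\<close> add up to joint continuity.\<close>
  have base: "\<forall>\<^sub>F p in nhds (a, h). \<forall>v\<in>S. norm (u v j (fst p) (snd p) - u v j a (snd p)) \<le> e * norm v"
    if a: "a \<in> U" and e: "e > 0" for j a h e
  proof -
    obtain C where C: "C > 0" "\<forall>\<^sub>F p in nhds (a, h(j := 0)).
        fst p \<in> U \<and> (\<forall>v\<in>S. norm (u v (Suc j) (fst p) (snd p)) \<le> C * norm v)"
      using ev_bd[OF a] by blast
    then obtain T where T: "open T" "(a, h(j := 0)) \<in> T"
      "\<And>b k. (b, k) \<in> T \<Longrightarrow> b \<in> U \<and> (\<forall>v\<in>S. norm (u v (Suc j) b k) \<le> C * norm v)"
      by (force simp: eventually_nhds)
    obtain A B where AB: "open A" "open B" "a \<in> A" "h(j := 0) \<in> B" "A \<times> B \<subseteq> T"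
      using open_prod_elim[OF T(1,2)] by (metis mem_Sigma_iff)
    obtain V where V: "open V" "convex V" "a \<in> V" "V \<subseteq> A"
      using convex_open_nbhd[OF AB(1,3)] .
    \<comment> \<open>The same stretching in the slot \<open>j\<close> of the derivative of order
      \<open>Suc j\<close>, which holds the increment of the base point.\<close>
    define N where "N = C / e"
    have N: "N > 0" using C(1) e by (simp add: N_def)
    note fs = tendsto_fst_snd_nhds[where x = a and h = h]
    have "((\<lambda>p. N *\<^sub>R (fst p - a)) \<longlongrightarrow> N *\<^sub>R (a - a)) (nhds (a, h))"
      by (intro lcs_tendsto_scaleR tendsto_const tendsto_diff fs)
    then have "((\<lambda>p. (snd p)(j := N *\<^sub>R (fst p - a))) \<longlongrightarrow> h(j := 0)) (nhds (a, h))"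
      by (intro tendsto_fun_updI tendsto_apply[OF fs(2)]) simp
    then have "\<forall>\<^sub>F p in nhds (a, h). (snd p)(j := N *\<^sub>R (fst p - a)) \<in> B"
      using AB by (auto simp: tendsto_def)
    moreover have "\<forall>\<^sub>F p in nhds (a, h). fst p \<in> V"
      using fs(1) V by (auto simp: tendsto_def)
    ultimately show ?thesis
    proof eventually_elim
      case (elim p)
      obtain b k where p: "p = (b, k)" by (cases p)
      show ?case
      proof
        fix v assume v: "v \<in> S"
        have "norm (dir_quot (\<lambda>y. u v j y k) a (b - a) 1 - 0) \<le> e * norm v"
        proof (rule smooth_on_norm_dir_quot_le[of U])
          show "smooth_on U (\<lambda>y. u v j y k)"
            unfolding u_def by (rule smooth_on_iter_deriv[OF sm[OF v]])
          fix s :: real assume "s \<in> {0..1}"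
          then have "(1 - s) *\<^sub>R a + s *\<^sub>R b \<in> V"
            using V(2,3) elim by (intro convexD) (auto simp: p)
          then have x: "a + (s * 1) *\<^sub>R (b - a) \<in> V"
            by (simp add: algebra_simps)
          let ?x = "a + (s * 1) *\<^sub>R (b - a)"
          have xB: "(?x, k(j := N *\<^sub>R (b - a))) \<in> T"
            using x V(4) AB(5) elim by (auto simp: p)
          then have "norm (u v (Suc j) ?x (k(j := N *\<^sub>R (b - a)))) \<le> C * norm v"
            using T(3) v by blast
          moreover have "u v (Suc j) ?x (k(j := N *\<^sub>R (b - a))) = N *\<^sub>R u v (Suc j) ?x (k(j := b - a))"
            unfolding u_def using T(3)[OF xB] by (intro iter_deriv_scaleR_dir[OF sm[OF v]]) auto
          ultimately have "norm (u v (Suc j) ?x (k(j := b - a))) \<le> e * norm v"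
            using N C(1) e by (simp add: N_def field_simps)
          moreover have "(\<lambda>y. u v j y (k(j := b - a))) = (\<lambda>y. u v j y k)"
            unfolding u_def by (intro ext iter_deriv_cong_dirs) auto
          then have "u v (Suc j) ?x (k(j := b - a)) = dir_deriv (\<lambda>y. u v j y k) ?x (b - a)"
            by (simp add: u_def)
          ultimately show "?x \<in> U \<and> norm (dir_deriv (\<lambda>y. u v j y k) ?x (b - a) - 0) \<le> e * norm v"
            using T(3)[OF xB] by simp
        qed simp
        then show "norm (u v j (fst p) (snd p) - u v j a (snd p)) \<le> e * norm v"
          by (simp add: dir_quot_def p)
      qed
    qed
  qed
  have cont: "((\<lambda>p. D j (fst p) (snd p)) \<longlongrightarrow> D j a h) (nhds (a, h))" if a: "a \<in> U" for j a h
  proof (rule tendstoI)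
    fix e :: real assume e: "e > 0"
    have "\<forall>\<^sub>F p in nhds (a, h). \<forall>v\<in>S. norm (u v j a (snd p) - u v j a h) \<le> e / 3 * norm v"
      by (rule eventually_compose_filterlim[OF dirs[OF a]])
        (use e tendsto_fst_snd_nhds(2) in simp_all)
    moreover have "\<forall>\<^sub>F p in nhds (a, h). \<forall>v\<in>S. norm (u v j (fst p) (snd p) - u v j a (snd p)) \<le> e / 3 * norm v"
      using e by (intro base[OF a]) simp
    moreover have "\<forall>\<^sub>F p in nhds (a, h). p \<in> U \<times> UNIV"
      using U a by (intro eventually_nhds_in_open) (auto intro: open_Times)
    ultimately show "\<forall>\<^sub>F p in nhds (a, h). dist (D j (fst p) (snd p)) (D j a h) < e"
    proof eventually_elim
      case (elim p)
      have "norm (D j (fst p) (snd p) - D j a h) \<le> 2 * e / 3"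
      proof (rule norm_blinfun_dense_leI[OF S(2)])
        fix v assume v: "v \<in> S"
        have "norm (u v j (fst p) (snd p) - u v j a h) \<le>
            norm (u v j (fst p) (snd p) - u v j a (snd p)) + norm (u v j a (snd p) - u v j a h)"
          using norm_triangle_ineq[of "u v j (fst p) (snd p) - u v j a (snd p)" "u v j a (snd p) - u v j a h"] by simp
        also have "\<dots> \<le> e / 3 * norm v + e / 3 * norm v"
          using elim v by (intro add_mono) auto
        finally show "norm ((D j (fst p) (snd p) - D j a h) v) \<le> 2 * e / 3 * norm v"
          using elim(3) a v by (auto simp: blinfun.diff_left D)
      qed (use e in simp)
      then show ?case using e by (simp add: dist_norm)
    qed
  qed
  \<comment> \<open>Norm continuity of \<open>D (Suc j)\<close> provides one neighbourhood on which
    the mean value estimate works for every \<open>v\<close>; hence the quotients converge in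
    operator norm.\<close>
  have deriv: "(dir_quot (\<lambda>y. D j y h) a (h j) \<longlongrightarrow> D (Suc j) a h) (at 0)" if a: "a \<in> U" for j a h
  proof (rule tendstoI)
    fix e :: real assume e: "e > 0"
    have "((\<lambda>b. D (Suc j) b h) \<longlongrightarrow> D (Suc j) a h) (nhds a)"
      by (rule filterlim_compose[OF cont[OF a], of "\<lambda>b. (b, h)", simplified])
        (intro tendsto_Pair tendsto_const filterlim_ident)
    then have "\<forall>\<^sub>F b in nhds a. dist (D (Suc j) b h) (D (Suc j) a h) < e / 2"
      using e by (auto dest: tendstoD[of _ _ _ "e / 2"])
    then obtain T where T: "open T" "a \<in> T" "\<And>b. b \<in> T \<Longrightarrow> dist (D (Suc j) b h) (D (Suc j) a h) < e / 2"
      by (auto simp: eventually_nhds)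
    obtain V where V: "open V" "convex V" "a \<in> V" "V \<subseteq> T \<inter> U"
      using convex_open_nbhd[of "T \<inter> U" a] T(1,2) U a by blast
    have "\<forall>\<^sub>F t in at 0. a + t *\<^sub>R h j \<in> V" "\<forall>\<^sub>F t in at 0. t \<noteq> (0::real)"
      using eventually_line[OF V(1,3)] by (auto simp: eventually_at_filter)
    then show "\<forall>\<^sub>F t in at 0. dist (dir_quot (\<lambda>y. D j y h) a (h j) t) (D (Suc j) a h) < e"
    proof eventually_elim
      case (elim t)
      have "norm (dir_quot (\<lambda>y. D j y h) a (h j) t - D (Suc j) a h) \<le> e / 2"
      proof (rule norm_blinfun_dense_leI[OF S(2)])
        fix v assume v: "v \<in> S"
        have "norm (dir_quot (\<lambda>y. u v j y h) a (h j) t - u v (Suc j) a h) \<le> e / 2 * norm v"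
        proof (rule smooth_on_norm_dir_quot_le[of U])
          show "smooth_on U (\<lambda>y. u v j y h)"
            unfolding u_def by (rule smooth_on_iter_deriv[OF sm[OF v]])
          fix s :: real assume "s \<in> {0..1}"
          then have "(1 - s) *\<^sub>R a + s *\<^sub>R (a + t *\<^sub>R h j) \<in> V"
            using V(2,3) elim by (intro convexD) auto
          then have x: "a + (s * t) *\<^sub>R h j \<in> V"
            by (simp add: algebra_simps)
          let ?x = "a + (s * t) *\<^sub>R h j"
          have "norm (u v (Suc j) ?x h - u v (Suc j) a h) = norm ((D (Suc j) ?x h - D (Suc j) a h) v)"
            using x V(4) a v by (auto simp: blinfun.diff_left D)
          also have "\<dots> \<le> norm (D (Suc j) ?x h - D (Suc j) a h) * norm v"
            by (rule norm_blinfun)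
          also have "\<dots> \<le> e / 2 * norm v"
            using T(3)[of ?x] x V(4) by (intro mult_right_mono) (auto simp: dist_norm)
          finally show "?x \<in> U \<and> norm (dir_deriv (\<lambda>y. u v j y h) ?x (h j) - u v (Suc j) a h) \<le> e / 2 * norm v"
            using x V(4) by (auto simp: u_def)
        qed (rule elim)
        then show "norm ((dir_quot (\<lambda>y. D j y h) a (h j) t - D (Suc j) a h) v) \<le> e / 2 * norm v"
          using elim(1) V(4) a v by (auto simp: dir_quot_def blinfun.diff_left blinfun.scaleR_left D subset_iff)
      qed (use e in simp)
      then show ?case using e by (simp add: dist_norm)
    qed
  qed
  have eq: "iter_deriv j f a h = D j a h" if "a \<in> U" for j a h
    using that
  proof (induction j arbitrary: a)
    case 0
    have "norm (f a - D 0 a h) \<le> 0"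
      by (rule norm_blinfun_dense_leI[OF S(2)]) (use 0 in \<open>auto simp: blinfun.diff_left D u_def\<close>)
    then show ?case by simp
  next
    case (Suc j)
    have "iter_deriv (Suc j) f a h = dir_deriv (\<lambda>y. D j y h) a (h j)"
      unfolding iter_deriv.simps by (rule dir_deriv_cong(1)[OF U Suc.prems Suc.IH])
    then show ?case using dir_deriv_eqI[OF deriv[OF Suc.prems]] by simp
  qed
  show ?thesis
    unfolding smooth_on_def
  proof (intro conjI allI ballI U)
    fix j a h assume a: "a \<in> U"
    show "dir_differentiable (\<lambda>y. iter_deriv j f y h) a (h j)"
      by (subst dir_deriv_cong(2)[OF U a eq]) (auto intro: dir_differentiableI[OF deriv[OF a]])
  next
    fix j
    have "((\<lambda>p. D j (fst p) (snd p)) \<longlongrightarrow> D j a h) (at (a, h) within U \<times> UNIV)" if "a \<in> U" for a h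
      by (rule tendsto_mono[OF _ cont[OF that]]) (simp add: at_within_def)
    then have "continuous_on (U \<times> UNIV) (\<lambda>p. D j (fst p) (snd p))"
      unfolding continuous_on_def by auto
    then show "continuous_on (U \<times> UNIV) (\<lambda>(x, h). iter_deriv j f x h)"
      by (rule continuous_on_eq) (auto simp: eq)
  qed
qed

text \<open>A factor that absorbs the limit absorbs a tail of the sequence, finitely many factors
  take care of the rest, and a common smaller factor works because a convex set containing 0 is
  star-shaped.\<close>

lemma star_shaped_absorbs_sequence:
  fixes \<xi> :: "nat \<Rightarrow> 'e::locally_convex_space"
  assumes V: "open V" "convex V" "0 \<in> V" and \<xi>: "\<xi> \<longlonglongrightarrow> x"
  obtains r where "r > 0" "\<And>k. r *\<^sub>R \<xi> k \<in> V"
proof -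
  have star: "s *\<^sub>R y \<in> V" if "r *\<^sub>R y \<in> V" "0 < s" "s \<le> r" for r s and y :: 'e
  proof -
    have "(s / r) *\<^sub>R (r *\<^sub>R y) + (1 - s / r) *\<^sub>R 0 \<in> V"
      using that V by (intro convexD[OF V(2)]) auto
    then show ?thesis using that by simp
  qed
  have absorb: "\<exists>r>0. r *\<^sub>R y \<in> V" for y :: 'e
  proof -
    have "((\<lambda>r. r *\<^sub>R y) \<longlongrightarrow> 0 *\<^sub>R y) (at_right 0)"
      by (intro lcs_tendsto_scaleR tendsto_const tendsto_ident_at)
    then have "\<forall>\<^sub>F r in at_right 0. r *\<^sub>R y \<in> V"
      using V by (auto simp: tendsto_def)
    moreover have "\<forall>\<^sub>F r in at_right (0::real). r > 0"
      by (simp add: eventually_at_right_less)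
    ultimately have "\<forall>\<^sub>F r in at_right 0. r > 0 \<and> r *\<^sub>R y \<in> V"
      by eventually_elim simp
    then show ?thesis
      using eventually_happens'[OF trivial_limit_at_right_real] by blast
  qed
  obtain r0 where r0: "r0 > 0" "r0 *\<^sub>R x \<in> V" using absorb by blast
  have "((\<lambda>k. r0 *\<^sub>R \<xi> k) \<longlongrightarrow> r0 *\<^sub>R x) sequentially"
    by (intro lcs_tendsto_scaleR tendsto_const \<xi>)
  then have "\<forall>\<^sub>F k in sequentially. r0 *\<^sub>R \<xi> k \<in> V"
    using V(1) r0(2) by (auto simp: tendsto_def)
  then obtain K where K: "\<And>k. k \<ge> K \<Longrightarrow> r0 *\<^sub>R \<xi> k \<in> V"
    by (auto simp: eventually_sequentially)
  have "\<exists>r>0. \<forall>k<K. r *\<^sub>R \<xi> k \<in> V" for K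
  proof (induction K)
    case (Suc K)
    then obtain r where r: "r > 0" "\<And>k. k < K \<Longrightarrow> r *\<^sub>R \<xi> k \<in> V" by blast
    obtain r' where r': "r' > 0" "r' *\<^sub>R \<xi> K \<in> V" using absorb by blast
    have "min r r' *\<^sub>R \<xi> k \<in> V" if "k < Suc K" for k
      using that r r' star[of r "\<xi> k" "min r r'"] star[of r' "\<xi> K" "min r r'"]
      by (cases "k = K") auto
    then show ?case
      using r(1) r'(1) by (intro exI[of _ "min r r'"]) simp
  qed (auto intro: exI[of _ 1])
  then obtain r1 where r1: "r1 > 0" "\<And>k. k < K \<Longrightarrow> r1 *\<^sub>R \<xi> k \<in> V" by blast
  show thesis
  proof (rule that[of "min r0 r1"])
    show "min r0 r1 *\<^sub>R \<xi> k \<in> V" for k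
      using r0(1) r1 K[of k] star[of r0 "\<xi> k" "min r0 r1"] star[of r1 "\<xi> k" "min r0 r1"]
      by (cases "k < K") auto
  qed (use r0 r1 in simp)
qed

text \<open>Along a convergent sequence of directions the arguments are replaced one at a time, the
  Baire property being applied to the next argument.\<close>

lemma Baire_multilinear_family:
  fixes \<beta> :: "'i \<Rightarrow> (nat \<Rightarrow> 'e::locally_convex_space) \<Rightarrow> 'f::real_normed_vector"
  assumes met: "metrizable_space (euclidean :: 'e topology)"
    and B: "Baire_space (euclidean :: 'e topology)"
    and cont: "\<And>i. i \<in> I \<Longrightarrow> continuous_on UNIV (\<beta> i)"
    and diff: "\<And>i l y a b. i \<in> I \<Longrightarrow> l < n \<Longrightarrow> \<beta> i (y(l := a - b)) = \<beta> i (y(l := a)) - \<beta> i (y(l := b))"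
    and scale: "\<And>i l y r a. i \<in> I \<Longrightarrow> l < n \<Longrightarrow> \<beta> i (y(l := r *\<^sub>R a)) = r *\<^sub>R \<beta> i (y(l := a))"
    and dep: "\<And>i y y'. i \<in> I \<Longrightarrow> (\<And>l. l < n \<Longrightarrow> y l = y' l) \<Longrightarrow> \<beta> i y = \<beta> i y'"
    and bd: "\<And>y. \<exists>C. \<forall>i\<in>I. norm (\<beta> i y) \<le> C"
  obtains W C where "open W" "y \<in> W" "\<And>z i. z \<in> W \<Longrightarrow> i \<in> I \<Longrightarrow> norm (\<beta> i z) \<le> C"
proof -
  have "\<exists>C. \<forall>k. \<forall>i\<in>I. norm (\<beta> i (\<xi> k)) \<le> C" if \<xi>: "\<xi> \<longlonglongrightarrow> y" for \<xi>
  proof -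
    define mx where "mx m k z = (\<lambda>l. if l < m then \<xi> k l else z l)" for m :: nat and k :: nat and z :: "nat \<Rightarrow> 'e"
    have "\<exists>C. \<forall>k. \<forall>i\<in>I. norm (\<beta> i (mx m k z)) \<le> C" if "m \<le> n" for m z
      using that
    proof (induction m arbitrary: z)
      case 0
      then show ?case using bd[of z] by (simp add: mx_def)
    next
      case (Suc m)
      then have m: "m < n" by simp
      \<comment> \<open>Indexing by pairs \<open>(k, i)\<close> lets one application of the Baire
        property treat all members of the sequence at once, with a single neighbourhood
        \<open>V\<close>.\<close>
      define T where "T = (\<lambda>(k, i) t. \<beta> i ((mx m k z)(m := t)))"
      have mxu: "mx m k (z(m := t)) = (mx m k z)(m := t)" for k t
        by (auto simp: mx_def)
      obtain V C where V: "open V" "convex V" "0 \<in> V" "\<And>x p. x \<in> V \<Longrightarrow> p \<in> UNIV \<times> I \<Longrightarrow> norm (T p x) \<le> C"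
      proof (rule Baire_linear_family[OF B, of "UNIV \<times> I" T])
        fix p :: "nat \<times> 'i" assume p: "p \<in> UNIV \<times> I"
        have "continuous_on UNIV (\<lambda>t. (mx m (fst p) z)(m := t))"
        proof (rule continuous_on_coordinatewise_then_product)
          show "continuous_on UNIV (\<lambda>t. ((mx m (fst p) z)(m := t)) i)" for i
            by (cases "i = m") simp_all
        qed
        then show "continuous_on UNIV (T p)"
          using p continuous_on_compose2[OF cont, of "snd p" UNIV] by (auto simp: T_def case_prod_unfold)
        show "T p (x - y) = T p x - T p y" for x y
          using p diff m by (auto simp: T_def)
      next
        fix t
        obtain C where "\<forall>k. \<forall>i\<in>I. norm (\<beta> i (mx m k (z(m := t)))) \<le> C"
          using Suc.IH[of "z(m := t)"] less_imp_le[OF m] by blast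
        then show "\<exists>C. \<forall>p\<in>UNIV \<times> I. norm (T p t) \<le> C"
          by (intro exI[of _ C]) (auto simp: T_def mxu)
      qed blast
      obtain r where r: "r > 0" "\<And>k. r *\<^sub>R \<xi> k m \<in> V"
        by (rule star_shaped_absorbs_sequence[OF V(1-3) tendsto_apply[OF \<xi>, of m]]) blast
      have "norm (\<beta> i (mx (Suc m) k z)) \<le> C / r" if i: "i \<in> I" for k i
      proof -
        have "mx (Suc m) k z = (mx m k z)(m := \<xi> k m)"
          by (auto simp: mx_def)
        then have "r * norm (\<beta> i (mx (Suc m) k z)) = norm (T (k, i) (r *\<^sub>R \<xi> k m))"
          using scale[OF i m] r(1) by (simp add: T_def)
        also have "\<dots> \<le> C"
          using V(4) r(2) i by simp
        finally show ?thesis using r(1) by (simp add: field_simps)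
      qed
      then show ?case by blast
    qed
    \<comment> \<open>After \<open>n\<close> replacements the start value is overwritten in every
      argument that \<open>\<beta> i\<close> reads, so any start value will do.\<close>
    from this[of n] obtain C where "\<forall>k. \<forall>i\<in>I. norm (\<beta> i (mx n k undefined)) \<le> C" by blast
    moreover have "\<beta> i (mx n k undefined) = \<beta> i (\<xi> k)" if "i \<in> I" for i k
      using that by (intro dep) (auto simp: mx_def)
    ultimately show ?thesis by auto
  qed
  note seq = this
  obtain W C where "open W" "y \<in> W" "\<And>z. z \<in> W \<Longrightarrow> \<forall>i\<in>I. norm (\<beta> i z) \<le> C"
  proof (rule metrizable_locally_boundedI[OF metrizable_euclidean_fun[OF met],
        where P = "\<lambda>C z. \<forall>i\<in>I. norm (\<beta> i z) \<le> C" and x = y])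
    show "\<forall>i\<in>I. norm (\<beta> i z) \<le> C'" if "\<forall>i\<in>I. norm (\<beta> i z) \<le> C" "C \<le> C'" for C C' z
      using that by (blast intro: order_trans)
  qed (use seq in blast)+
  then show thesis
    using that by blast
qed

text \<open>The next derivative is the pointwise limit of difference quotients with steps
  \<open>1 / Suc n\<close>. By induction these are bounded operators, so Banach-Steinhaus bounds the
  limit.\<close>

lemma bounded_linear_iter_deriv_blinfun:
  fixes f :: "'e::locally_convex_space \<Rightarrow> ('h::banach \<Rightarrow>\<^sub>L 'k::banach)"
  assumes sm: "\<And>v. smooth_on U (\<lambda>a. f a v)" and a: "a \<in> U"
  shows "bounded_linear (\<lambda>v. iter_deriv j (\<lambda>a. f a v) a h)"
  using a
proof (induction j arbitrary: a)
  case 0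
  show ?case by (simp add: blinfun.bounded_linear_right)
next
  case (Suc j)
  define u where "u j a v = iter_deriv j (\<lambda>a. f a v) a h" for j a v
  have IH: "bounded_linear (u j b)" if "b \<in> U" for b
    unfolding u_def using Suc.IH that .
  define b where "b n = a + (1 / Suc n) *\<^sub>R h j" for n
  define T where "T n v = real (Suc n) *\<^sub>R (u j (b n) v - u j a v)" for n v
  have lim: "(\<lambda>n. T n v) \<longlonglongrightarrow> u (Suc j) a v" for v
  proof -
    have "(dir_quot (\<lambda>y. u j y v) a (h j) \<longlongrightarrow> u (Suc j) a v) (at 0)"
      using dir_deriv_tendsto[OF smooth_on_differentiable[OF sm Suc.prems]] by (simp add: u_def)
    moreover have "filterlim (\<lambda>n. 1 / real (Suc n)) (at 0) sequentially"
      using LIMSEQ_Suc[OF lim_1_over_n] by (auto simp: filterlim_at)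
    ultimately have "((\<lambda>n. dir_quot (\<lambda>y. u j y v) a (h j) (1 / real (Suc n))) \<longlongrightarrow> u (Suc j) a v) sequentially"
      by (rule filterlim_compose)
    then show ?thesis
      by (simp add: dir_quot_def T_def b_def)
  qed
  have "b \<longlonglongrightarrow> a + 0 *\<^sub>R h j"
    unfolding b_def by (intro tendsto_add lcs_tendsto_scaleR tendsto_const LIMSEQ_Suc[OF lim_1_over_n])
  then have ev: "\<forall>\<^sub>F n in sequentially. b n \<in> U"
    using Suc.prems smooth_on_open[OF sm] by (auto simp: tendsto_def)
  \<comment> \<open>Only quotients whose moved base point lies in \<open>U\<close> fall under the
    induction hypothesis; eventually all of them do.\<close>
  obtain C where C: "\<And>n v. n \<in> {n. b n \<in> U} \<Longrightarrow> norm (T n v) \<le> C * norm v"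
  proof (rule uniform_boundedness[of "{n. b n \<in> U}" T])
    show "bounded_linear (T n)" if "n \<in> {n. b n \<in> U}" for n
      unfolding T_def using that Suc.prems
      by (intro bounded_linear_const_scaleR bounded_linear_sub IH) auto
    show "\<exists>C. \<forall>n\<in>{n. b n \<in> U}. norm (T n v) \<le> C" for v
      using convergent_imp_Bseq[OF convergentI[OF lim[of v]]] by (auto simp: Bseq_def)
  qed blast
  have "norm (u (Suc j) a v) \<le> C * norm v" for v
  proof (rule tendsto_upperbound[OF tendsto_norm[OF lim]])
    show "\<forall>\<^sub>F n in sequentially. norm (T n v) \<le> C * norm v"
      using ev by eventually_elim (simp add: C)
  qed simp
  moreover have "u (Suc j) a (v + w) = u (Suc j) a v + u (Suc j) a w" for v w
    using iter_deriv_add[OF sm[of v] sm[of w] Suc.prems, of "Suc j" h]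
    unfolding u_def by (simp only: blinfun.add_right)
  moreover have "u (Suc j) a (r *\<^sub>R v) = r *\<^sub>R u (Suc j) a v" for r v
  proof -
    have "iter_deriv (Suc j) (\<lambda>a. r *\<^sub>R f a v) a h = r *\<^sub>R iter_deriv (Suc j) (\<lambda>a. f a v) a h"
      by (rule iter_deriv_scaleR[OF sm Suc.prems])
    then show ?thesis
      unfolding u_def by (simp only: blinfun.scaleR_right)
  qed
  ultimately have "bounded_linear (u (Suc j) a)"
    by (intro bounded_linear_intro[of _ C]) (auto simp: mult.commute)
  then show ?case unfolding u_def[abs_def] .
qed

lemma smooth_on_strong_imp_norm:
  fixes f :: "'e::locally_convex_space \<Rightarrow> ('h::banach \<Rightarrow>\<^sub>L 'k::banach)"
  assumes met: "metrizable_space (euclidean :: 'e topology)"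
    and sm: "\<And>v. smooth_on U (\<lambda>a. f a v)"
  shows "smooth_on U f"
proof (rule smooth_on_blinfun[OF smooth_on_open[OF sm], of UNIV])
  fix j a and h :: "nat \<Rightarrow> 'e" assume a: "a \<in> U"
  \<comment> \<open>A sequence tending to \<open>(a, h)\<close> may start outside \<open>U\<close>,
    so \<open>P\<close> makes no claim there.\<close>
  define P where "P C p \<longleftrightarrow> (fst p \<in> U \<longrightarrow> (\<forall>v. norm (iter_deriv j (\<lambda>a. f a v) (fst p) (snd p)) \<le> C * norm v))"
    for C and p :: "'e \<times> (nat \<Rightarrow> 'e)"
  obtain W C where "open W" "(a, h) \<in> W" "\<And>p. p \<in> W \<Longrightarrow> P C p"
  proof (rule metrizable_locally_boundedI[of P "(a, h)"])
    show "metrizable_space (euclidean :: ('e \<times> (nat \<Rightarrow> 'e)) topology)"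
      by (intro metrizable_euclidean_prod metrizable_euclidean_fun met)
    show "P C' p" if "P C p" "C \<le> C'" for C C' p
      using that unfolding P_def by (meson mult_right_mono norm_ge_zero order_trans)
    fix \<xi> assume \<xi>: "\<xi> \<longlonglongrightarrow> (a, h)"
    have fs: "(\<lambda>k. fst (\<xi> k)) \<longlonglongrightarrow> a" "(\<lambda>k. snd (\<xi> k)) \<longlonglongrightarrow> h"
      using tendsto_fst[OF \<xi>] tendsto_snd[OF \<xi>] by simp_all
    obtain C where "\<And>k v. k \<in> {k. fst (\<xi> k) \<in> U} \<Longrightarrow>
        norm (iter_deriv j (\<lambda>a. f a v) (fst (\<xi> k)) (snd (\<xi> k))) \<le> C * norm v"
    proof (rule uniform_boundedness[of "{k. fst (\<xi> k) \<in> U}" "\<lambda>k v. iter_deriv j (\<lambda>a. f a v) (fst (\<xi> k)) (snd (\<xi> k))"])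
      show "bounded_linear (\<lambda>v. iter_deriv j (\<lambda>a. f a v) (fst (\<xi> k)) (snd (\<xi> k)))"
        if "k \<in> {k. fst (\<xi> k) \<in> U}" for k
        using that by (intro bounded_linear_iter_deriv_blinfun[OF sm]) simp
      fix v
      have "(\<lambda>k. iter_deriv j (\<lambda>a. f a v) (fst (\<xi> k)) (snd (\<xi> k))) \<longlonglongrightarrow> iter_deriv j (\<lambda>a. f a v) a h"
        by (rule smooth_on_tendsto[OF sm a fs(1)]) (rule tendsto_apply[OF fs(2)])
      from convergent_imp_Bseq[OF convergentI[OF this]]
      show "\<exists>C. \<forall>k\<in>{k. fst (\<xi> k) \<in> U}. norm (iter_deriv j (\<lambda>a. f a v) (fst (\<xi> k)) (snd (\<xi> k))) \<le> C"
        by (auto simp: Bseq_def)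
    qed blast
    then show "\<exists>C. \<forall>k. P C (\<xi> k)"
      by (auto simp: P_def)
  qed blast
  then show "\<exists>W C. open W \<and> (a, h) \<in> W \<and>
      (\<forall>b k v. (b, k) \<in> W \<longrightarrow> b \<in> U \<longrightarrow> v \<in> UNIV \<longrightarrow> norm (iter_deriv j (\<lambda>a. f a v) b k) \<le> C * norm v)"
    by (intro exI[of _ W] exI[of _ C]) (auto simp: P_def)
qed (simp_all add: sm)

section \<open>Lie groups and their unitary representations\<close>

context lie_group
begin

lemma in_carrier [simp]: "g \<in> carrier G"
  by (simp add: carrier_UNIV)

lemma chart_facts:
  assumes "(U, \<phi>) \<in> \<A>"
  shows "open U" "open (\<phi> ` U)" "continuous_on U \<phi>" "continuous_on (\<phi> ` U) (inv_into U \<phi>)" "inj_on \<phi> U"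
proof -
  have h: "homeomorphism U (\<phi> ` U) \<phi> (inv_into U \<phi>)" and "open U" "open (\<phi> ` U)"
    using atlas assms by (auto simp: smooth_atlas_def)
  then show "open U" "open (\<phi> ` U)" "continuous_on U \<phi>" "continuous_on (\<phi> ` U) (inv_into U \<phi>)"
    by (auto simp: homeomorphism_def)
  show "inj_on \<phi> U"
    using h by (intro inj_on_inverseI[where g = "inv_into U \<phi>"]) (auto simp: homeomorphism_def)
qed

lemma chart_inv [simp]: "(U, \<phi>) \<in> \<A> \<Longrightarrow> g \<in> U \<Longrightarrow> inv_into U \<phi> (\<phi> g) = g"
  using chart_facts(5) by (rule inv_into_f_f)

lemma chart_cover:
  obtains U \<phi> where "(U, \<phi>) \<in> \<A>" "g \<in> U"
proof -
  have "g \<in> \<Union> (fst ` \<A>)" using atlas by (simp add: smooth_atlas_def)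
  then show thesis using that by force
qed

lemma smooth_map_chart:
  assumes "smooth_map \<A> lcs_atlas f" "(U, \<phi>) \<in> \<A>"
  shows "smooth_on (\<phi> ` U) (\<lambda>a. f (inv_into U \<phi> a))"
  using assms by (fastforce simp: smooth_map_def lcs_atlas_def comp_def)

lemma smooth_mapI:
  assumes sm: "\<And>U \<phi>. (U, \<phi>) \<in> \<A> \<Longrightarrow> smooth_on (\<phi> ` U) (\<lambda>a. f (inv_into U \<phi> a))"
  shows "smooth_map \<A> lcs_atlas f"
proof -
  have "continuous_on U f" if U: "(U, \<phi>) \<in> \<A>" for U \<phi>
  proof -
    have "continuous_on U (\<lambda>g. f (inv_into U \<phi> (\<phi> g)))"
      using continuous_on_compose2[OF smooth_on_continuous[OF sm[OF U]] chart_facts(3)[OF U]] by simp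
    then show ?thesis
      by (rule continuous_on_eq) (simp add: U)
  qed
  then have "continuous_on (\<Union>x\<in>\<A>. fst x) f"
    by (intro continuous_on_open_UN) (auto intro: chart_facts(1))
  moreover have "(\<Union>x\<in>\<A>. fst x) = UNIV"
    using atlas by (simp add: smooth_atlas_def)
  ultimately show ?thesis
    using sm by (auto simp: smooth_map_def lcs_atlas_def comp_def)
qed

text \<open>The factors and the product are read in separate charts because they may be far apart:
  bounds are transported with factors near \<open>g\<close> and \<open>inv g\<close> and the product
  near \<open>\<one>\<close>.\<close>

definition mult_dom :: "('g, 'e) chart \<Rightarrow> ('g, 'e) chart \<Rightarrow> ('g, 'e) chart \<Rightarrow> ('e \<times> 'e) set" where
  "mult_dom c1 c2 c3 = (\<lambda>(g, h). (snd c1 g, snd c2 h)) ` {(g, h). g \<in> fst c1 \<and> h \<in> fst c2 \<and> g \<otimes> h \<in> fst c3}"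

definition mult_coord :: "('g, 'e) chart \<Rightarrow> ('g, 'e) chart \<Rightarrow> ('g, 'e) chart \<Rightarrow> 'e \<times> 'e \<Rightarrow> 'e" where
  "mult_coord c1 c2 c3 = (\<lambda>(a, b). snd c3 (inv_into (fst c1) (snd c1) a \<otimes> inv_into (fst c2) (snd c2) b))"

lemma mult_domI:
  "g \<in> fst c1 \<Longrightarrow> h \<in> fst c2 \<Longrightarrow> g \<otimes> h \<in> fst c3 \<Longrightarrow> (snd c1 g, snd c2 h) \<in> mult_dom c1 c2 c3"
  by (auto simp: mult_dom_def)

lemma smooth_on_mult_coord:
  assumes "c1 \<in> \<A>" "c2 \<in> \<A>" "c3 \<in> \<A>"
  shows "smooth_on (mult_dom c1 c2 c3) (mult_coord c1 c2 c3)"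
proof -
  obtain U \<phi> V \<psi> W \<eta> where c: "c1 = (U, \<phi>)" "c2 = (V, \<psi>)" "c3 = (W, \<eta>)"
    by (cases c1; cases c2; cases c3) auto
  have mem: "(U, \<phi>) \<in> \<A>" "(V, \<psi>) \<in> \<A>" "(W, \<eta>) \<in> \<A>" using assms c by auto
  have "(U \<times> V, map_prod \<phi> \<psi>) \<in> prod_atlas \<A> \<A>"
    using mem by (auto simp: prod_atlas_def)
  then have sm: "smooth_on (map_prod \<phi> \<psi> ` (U \<times> V \<inter> (\<lambda>(g, h). g \<otimes> h) -` W))
      (\<eta> \<circ> (\<lambda>(g, h). g \<otimes> h) \<circ> inv_into (U \<times> V) (map_prod \<phi> \<psi>))"
    using smooth_mult mem(3) unfolding smooth_map_def by fast
  have dom: "map_prod \<phi> \<psi> ` (U \<times> V \<inter> (\<lambda>(g, h). g \<otimes> h) -` W) = mult_dom c1 c2 c3"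
    by (auto simp: mult_dom_def c map_prod_def image_iff)
  have inj: "inj_on (map_prod \<phi> \<psi>) (U \<times> V)"
    using map_prod_inj_on[OF chart_facts(5)[OF mem(1)] chart_facts(5)[OF mem(2)]] .
  show ?thesis
  proof (rule smooth_on_cong[OF sm[unfolded dom]])
    fix x assume "x \<in> mult_dom c1 c2 c3"
    then obtain g h where gh: "x = map_prod \<phi> \<psi> (g, h)" "g \<in> U" "h \<in> V"
      by (auto simp: mult_dom_def c)
    then have "inv_into (U \<times> V) (map_prod \<phi> \<psi>) x = (g, h)"
      using inv_into_f_f[OF inj] by auto
    then show "(\<eta> \<circ> (\<lambda>(g, h). g \<otimes> h) \<circ> inv_into (U \<times> V) (map_prod \<phi> \<psi>)) x = mult_coord c1 c2 c3 x"
      using gh mem by (simp add: mult_coord_def c)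
  qed
qed

text \<open>Products of elements of \<open>U\<close> and \<open>V\<close> need not lie in one chart
  domain, so smoothness is checked near each pair with a chart around its product. Slices give
  invariance under right translations, partial derivatives at the identity give the
  generators.\<close>

lemma smooth_on_product:
  assumes f: "smooth_map \<A> lcs_atlas f" and U: "(U, \<phi>) \<in> \<A>" and V: "(V, \<psi>) \<in> \<A>"
  shows "smooth_on (\<phi> ` U \<times> \<psi> ` V) (\<lambda>(a, b). f (inv_into U \<phi> a \<otimes> inv_into V \<psi> b))"
proof (rule smooth_on_local)
  fix x assume "x \<in> \<phi> ` U \<times> \<psi> ` V"
  then obtain g h where gh: "x = (\<phi> g, \<psi> h)" "g \<in> U" "h \<in> V" by auto
  obtain W \<eta> where W: "(W, \<eta>) \<in> \<A>" "g \<otimes> h \<in> W" by (rule chart_cover)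
  let ?D = "mult_dom (U, \<phi>) (V, \<psi>) (W, \<eta>)" and ?M = "mult_coord (U, \<phi>) (V, \<psi>) (W, \<eta>)"
  have M: "?M ` ?D \<subseteq> \<eta> ` W"
    using U V by (auto simp: mult_dom_def mult_coord_def)
  have "smooth_on ?D (\<lambda>x. f (inv_into W \<eta> (?M x)))"
    by (rule smooth_on_comp[OF smooth_map_chart[OF f W(1)] smooth_on_mult_coord[OF U V W(1)] M])
  then have "smooth_on ?D (\<lambda>(a, b). f (inv_into U \<phi> a \<otimes> inv_into V \<psi> b))"
    by (rule smooth_on_cong) (use U V W in \<open>auto simp: mult_dom_def mult_coord_def\<close>)
  moreover have "x \<in> ?D"
    using mult_domI[of g "(U, \<phi>)" h "(V, \<psi>)" "(W, \<eta>)"] gh W(2) by simp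
  moreover have "?D \<subseteq> \<phi> ` U \<times> \<psi> ` V"
    by (auto simp: mult_dom_def)
  ultimately show "\<exists>W. x \<in> W \<and> W \<subseteq> \<phi> ` U \<times> \<psi> ` V \<and>
      smooth_on W (\<lambda>(a, b). f (inv_into U \<phi> a \<otimes> inv_into V \<psi> b))"
    by blast
qed

lemma smooth_map_right_translate:
  assumes f: "smooth_map \<A> lcs_atlas f"
  shows "smooth_map \<A> lcs_atlas (\<lambda>g. f (g \<otimes> h))"
proof (rule smooth_mapI)
  fix U \<phi> assume U: "(U, \<phi>) \<in> \<A>"
  obtain V \<psi> where V: "(V, \<psi>) \<in> \<A>" "h \<in> V" by (rule chart_cover)
  have "smooth_on {a. (a, \<psi> h) \<in> \<phi> ` U \<times> \<psi> ` V} (\<lambda>a. f (inv_into U \<phi> a \<otimes> h))"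
    using smooth_on_slice[OF smooth_on_product[OF f U V(1)], of "\<psi> h"] V by simp
  moreover have "{a. (a, \<psi> h) \<in> \<phi> ` U \<times> \<psi> ` V} = \<phi> ` U"
    using V by auto
  ultimately show "smooth_on (\<phi> ` U) (\<lambda>a. f (inv_into U \<phi> a \<otimes> h))"
    by simp
qed

lemma smooth_map_inverse:
  assumes f: "smooth_map \<A> lcs_atlas f"
  shows "smooth_map \<A> lcs_atlas (\<lambda>g. f (inv g))"
proof (rule smooth_mapI)
  fix U \<phi> assume U: "(U, \<phi>) \<in> \<A>"
  show "smooth_on (\<phi> ` U) (\<lambda>a. f (inv (inv_into U \<phi> a)))"
  proof (rule smooth_on_local)
    fix x assume "x \<in> \<phi> ` U"
    then obtain g where g: "x = \<phi> g" "g \<in> U" by auto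
    obtain V \<psi> where V: "(V, \<psi>) \<in> \<A>" "inv g \<in> V" by (rule chart_cover)
    let ?D = "\<phi> ` (U \<inter> m_inv G -` V)"
    have sm: "smooth_on ?D (\<psi> \<circ> m_inv G \<circ> inv_into U \<phi>)"
      using smooth_inv U V(1) unfolding smooth_map_def by fast
    have "(\<psi> \<circ> m_inv G \<circ> inv_into U \<phi>) ` ?D \<subseteq> \<psi> ` V"
      using U by auto
    from smooth_on_comp[OF smooth_map_chart[OF f V(1)] sm this]
    have "smooth_on ?D (\<lambda>a. f (inv (inv_into U \<phi> a)))"
      by (rule smooth_on_cong) (use U V in auto)
    then show "\<exists>W. x \<in> W \<and> W \<subseteq> \<phi> ` U \<and> smooth_on W (\<lambda>a. f (inv (inv_into U \<phi> a)))"
      using g V by (intro exI[of _ ?D]) auto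
  qed
qed

lemma smooth_map_linear_post:
  assumes "linear L" "continuous_on UNIV L" "smooth_map \<A> lcs_atlas f"
  shows "smooth_map \<A> lcs_atlas (\<lambda>g. L (f g))"
  by (rule smooth_mapI, rule smooth_on_linear_post[OF assms(1,2) smooth_map_chart[OF assms(3)]])

lemma smooth_map_add:
  assumes "smooth_map \<A> lcs_atlas f" "smooth_map \<A> lcs_atlas f'"
  shows "smooth_map \<A> lcs_atlas (\<lambda>g. f g + f' g)"
  by (rule smooth_mapI, rule smooth_on_add[OF smooth_map_chart[OF assms(1)] smooth_map_chart[OF assms(2)]])

end

section \<open>The representation and its smooth vectors\<close>

locale lie_group_rep = lie_group_exp G \<A> c ex
  for G :: "('g::t2_space) monoid" (structure)
    and \<A> :: "('g, 'e::locally_convex_space) chart set"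
    and c :: "('g, 'e) chart" and ex :: "'e \<Rightarrow> 'g" +
  fixes \<pi> :: "'g \<Rightarrow> ('h::complex_hilbert_space \<Rightarrow>\<^sub>L 'h)"
  assumes rep: "smooth_unitary_rep G \<A> \<pi>"
begin

abbreviation S where "S \<equiv> smooth_vectors \<A> \<pi>"

lemma unitary: "unitary_op (\<pi> g)"
  using rep by (simp add: smooth_unitary_rep_def unitary_rep_def carrier_UNIV)

lemma rep_mult: "\<pi> (g \<otimes> h) v = \<pi> g (\<pi> h v)"
  using rep by (simp add: smooth_unitary_rep_def unitary_rep_def carrier_UNIV)

lemma continuous_on_rep:
  "continuous_on A f \<Longrightarrow> continuous_on A u \<Longrightarrow> continuous_on A (\<lambda>t. \<pi> (f t) (u t))"
  using rep continuous_on_compose2[of UNIV "\<lambda>(g, v). \<pi> g v" A "\<lambda>t. (f t, u t)"]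
  by (auto simp: smooth_unitary_rep_def unitary_rep_def carrier_UNIV intro: continuous_on_Pair)

lemma ip_rep: "ip (\<pi> g v) (\<pi> g w) = ip v w"
  using unitary[of g] by (simp add: unitary_op_def ip_def)

lemma norm_rep [simp]: "norm (\<pi> g v) = norm v"
  using ip_rep[of g v v] by (simp add: ip_self)

lemma rep_scaleC: "\<pi> g (a *\<^sub>C v) = a *\<^sub>C \<pi> g v"
  using unitary[of g] by (simp add: unitary_op_def clinear_op_def)

lemma rep_one [simp]: "\<pi> \<one> v = v"
proof -
  \<comment> \<open>As an idempotent, \<open>\<pi> \<one>\<close> annihilates this difference; as an
    isometry, it preserves its norm.\<close>
  have "\<pi> \<one> (\<pi> \<one> v - v) = 0"
    using rep_mult[of \<one> \<one> v] by (simp add: blinfun.diff_right)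
  then have "norm (\<pi> \<one> v - v) = 0"
    using norm_rep[of \<one> "\<pi> \<one> v - v"] by simp
  then show ?thesis by simp
qed

lemma rep_inv [simp]: "\<pi> (inv g) (\<pi> g v) = v"
  using rep_mult[of "inv g" g v] by simp

lemma ip_rep_inv: "ip (\<pi> (inv g) v) w = ip v (\<pi> g w)"
  using ip_rep[of g "\<pi> (inv g) v" w] rep_mult[of g "inv g" v] by simp

lemma dense: "closure S = UNIV"
  using rep by (simp add: smooth_unitary_rep_def)

lemma smooth_vectorsD: "v \<in> S \<Longrightarrow> smooth_map \<A> lcs_atlas (\<lambda>g. \<pi> g v)"
  by (simp add: smooth_vectors_def)

lemma smooth_vectors_add: "v \<in> S \<Longrightarrow> w \<in> S \<Longrightarrow> v + w \<in> S"
  using smooth_map_add by (simp add: smooth_vectors_def blinfun.add_right)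

lemma smooth_vectors_scaleC: "v \<in> S \<Longrightarrow> a *\<^sub>C v \<in> S"
  using smooth_map_linear_post[OF bounded_linear.linear[OF bounded_linear_scaleC]
      linear_continuous_on[OF bounded_linear_scaleC]]
  by (simp add: smooth_vectors_def rep_scaleC)

lemma smooth_vectors_scaleR: "v \<in> S \<Longrightarrow> r *\<^sub>R v \<in> S"
  using smooth_vectors_scaleC[of v "of_real r"] by (simp add: scaleC_of_real)

lemma smooth_vectors_zero: "0 \<in> S"
  using smooth_on_const chart_facts(2) by (auto simp: smooth_vectors_def intro!: smooth_mapI)

lemma subspace_smooth_vectors: "subspace S"
  using smooth_vectors_add smooth_vectors_scaleR smooth_vectors_zero by (simp add: subspace_def)

text \<open>The orbit map of \<open>\<pi> h v\<close> is the orbit map of \<open>v\<close> after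
  right translation by \<open>h\<close>.\<close>

lemma smooth_vectors_rep: "v \<in> S \<Longrightarrow> \<pi> h v \<in> S"
  using smooth_map_right_translate[OF smooth_vectorsD, of v h]
  by (simp add: smooth_vectors_def rep_mult)

lemma chart_at_one': "(fst c, snd c) \<in> \<A>"
  using chart_at_one by simp

section \<open>One-parameter groups and their generators\<close>

lemma ex_0 [simp]: "ex 0 = \<one>"
proof -
  have "ex 0 = ex 0 \<otimes> ex 0" using ex_add[of 0 0 0] by simp
  then show ?thesis using l_cancel_one'[of "ex 0" "ex 0"] by simp
qed

lemma inv_ex: "inv (ex (t *\<^sub>R x)) = ex (- t *\<^sub>R x)"
  using ex_add[of "- t" t x] by (intro inv_equality) simp_all

lemma continuous_on_ex: "continuous_on A ex"
  using smooth_ex continuous_on_subset unfolding smooth_map_def by blast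

lemma continuous_on_ex_line: "continuous_on A (\<lambda>t. ex (t *\<^sub>R x))"
  by (intro continuous_on_compose2[OF continuous_on_ex] lcs_continuous_on_scaleR continuous_intros) auto

lemma ex_near_one: "\<forall>\<^sub>F t in at 0. ex (t *\<^sub>R x) \<in> fst c"
proof -
  have "((\<lambda>t. ex (t *\<^sub>R x)) \<longlongrightarrow> ex (0 *\<^sub>R x)) (at 0)"
    using continuous_on_ex_line[of UNIV x] unfolding continuous_on_def by blast
  then show ?thesis
    using chart_facts(1)[OF chart_at_one'] chart_at_one(2) by (simp add: tendsto_def)
qed

abbreviation cinv where "cinv \<equiv> inv_into (fst c) (snd c)"
abbreviation e where "e \<equiv> snd c \<one>"
abbreviation coords where "coords \<equiv> snd c ` fst c"
abbreviation X where "X \<equiv> left_inv_field G c"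

lemma cinv_e [simp]: "cinv e = \<one>"
  using chart_inv[OF chart_at_one' chart_at_one(2)] .

lemma e_in_coords [simp]: "e \<in> coords"
  using chart_at_one(2) by simp

lemma open_coords: "open coords"
  using chart_facts(2)[OF chart_at_one'] .

text \<open>By the chain rule only the velocity of the one-parameter group at 0 enters. The limit
  thus becomes a partial derivative of a jointly smooth function, which gives both its existence and
  its smooth dependence on \<open>g\<close>.\<close>

lemma derivative_along_ex:
  assumes f: "smooth_map \<A> lcs_atlas f" and U: "(U, \<phi>) \<in> \<A>" "g \<in> U"
  shows "((\<lambda>t. (1 / t) *\<^sub>R (f (g \<otimes> ex (t *\<^sub>R x)) - f g)) \<longlongrightarrow>
    dir_deriv (\<lambda>(a, b). f (inv_into U \<phi> a \<otimes> cinv b)) (\<phi> g, e) (0, x)) (at 0)"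
proof -
  let ?K = "\<lambda>(a, b). f (inv_into U \<phi> a \<otimes> cinv b)"
  have "((\<lambda>t. (1 / t) *\<^sub>R (?K (\<phi> g, snd c (ex (t *\<^sub>R x))) - ?K (\<phi> g, e))) \<longlongrightarrow>
    dir_deriv ?K (\<phi> g, e) (0, x)) (at 0)"
  proof (rule smooth_on_chain[OF smooth_on_product[OF f U(1) chart_at_one']])
    show "(\<phi> g, e) \<in> \<phi> ` U \<times> coords" using U(2) by auto
    have "((\<lambda>t. (0, (1 / t) *\<^sub>R (snd c (ex (t *\<^sub>R x)) - e))) \<longlongrightarrow> (0, x)) (at 0)"
      by (intro tendsto_Pair tendsto_const ex_velocity)
    then show "((\<lambda>t. (1 / t) *\<^sub>R ((\<phi> g, snd c (ex (t *\<^sub>R x))) - (\<phi> g, e))) \<longlongrightarrow> (0, x)) (at 0)"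
      by simp
  qed (auto simp: eventually_at_filter)
  moreover have "\<forall>\<^sub>F t in at 0. (1 / t) *\<^sub>R (?K (\<phi> g, snd c (ex (t *\<^sub>R x))) - ?K (\<phi> g, e)) =
      (1 / t) *\<^sub>R (f (g \<otimes> ex (t *\<^sub>R x)) - f g)"
    using ex_near_one[of x] by eventually_elim (use U chart_at_one' in simp)
  ultimately show ?thesis
    by (rule Lim_transform_eventually)
qed

text \<open>By the group law the difference quotient at time \<open>t\<close> is
  \<open>\<pi> (ex (t *\<^sub>R x))\<close> applied to the one at 0, so differentiability at 0 alone
  makes the orbit continuously differentiable. Membership in the domain thereby reduces to the
  existence of one limit.\<close>

lemma dpi_bar_iff:
  "dpi_bar ex \<pi> x v = Some u \<longleftrightarrow> ((\<lambda>t. (1 / t) *\<^sub>R (\<pi> (ex (t *\<^sub>R x)) v - v)) \<longlongrightarrow> u) (at 0)"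
proof -
  define orb where "orb t = \<pi> (ex (t *\<^sub>R x)) v" for t
  have orb0 [simp]: "orb 0 = v" by (simp add: orb_def)
  have orb_add: "orb (t + s) = \<pi> (ex (t *\<^sub>R x)) (orb s)" for t s
    by (simp add: orb_def ex_add rep_mult)
  have fwd: "dpi_bar ex \<pi> x v = Some l" if l: "((\<lambda>t. (1 / t) *\<^sub>R (orb t - v)) \<longlongrightarrow> l) (at 0)" for l
  proof -
    have lim: "(dir_quot orb t 1 \<longlongrightarrow> \<pi> (ex (t *\<^sub>R x)) l) (at 0)" for t
    proof -
      have "((\<lambda>s. \<pi> (ex (t *\<^sub>R x)) ((1 / s) *\<^sub>R (orb s - v))) \<longlongrightarrow> \<pi> (ex (t *\<^sub>R x)) l) (at 0)"
        by (intro tendsto_intros l)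
      moreover have "\<pi> (ex (t *\<^sub>R x)) ((1 / s) *\<^sub>R (orb s - v)) = dir_quot orb t 1 s" for s
        using orb_add[of t s] orb_add[of t 0] by (simp add: dir_quot_def blinfun.scaleR_right blinfun.diff_right)
      ultimately show ?thesis by simp
    qed
    have diffb: "dir_differentiable orb t h" and dd: "dir_deriv orb t h = h *\<^sub>R \<pi> (ex (t *\<^sub>R x)) l" for t h
      using dir_deriv_scaleR[OF dir_differentiableI[OF lim[of t]], of h] dir_deriv_eqI[OF lim[of t]] by simp_all
    have cont_fst: "continuous_on UNIV (\<lambda>z::real \<times> (nat \<Rightarrow> real). \<pi> (ex (fst z *\<^sub>R x)) u)" for u
    proof -
      have "continuous_on UNIV (\<lambda>t. \<pi> (ex (t *\<^sub>R x)) u)"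
        by (intro continuous_on_rep continuous_on_ex_line continuous_on_const)
      from continuous_on_compose2[OF this continuous_on_fst[OF continuous_on_id]] show ?thesis
        by simp
    qed
    have "Ck_on 1 UNIV orb"
      unfolding Ck_on_def
    proof (intro conjI allI impI ballI)
      fix j t and h :: "nat \<Rightarrow> real" assume "enat (Suc j) \<le> 1"
      then have "j = 0" by (simp add: one_enat_def)
      then show "dir_differentiable (\<lambda>y. iter_deriv j orb y h) t (h j)"
        using diffb by simp
    next
      fix j assume "enat j \<le> 1"
      then consider "j = 0" | "j = 1" by (auto simp: one_enat_def le_Suc_eq)
      then show "continuous_on (UNIV \<times> UNIV) (\<lambda>(t, h). iter_deriv j orb t h)"
      proof cases
        case 1
        then show ?thesis using cont_fst[of v] by (simp add: orb_def case_prod_unfold)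
      next
        case 2
        have h0: "continuous_on UNIV (\<lambda>h::nat \<Rightarrow> real. h 0)" by simp
        have "continuous_on (UNIV :: (real \<times> (nat \<Rightarrow> real)) set) (\<lambda>z. snd z 0)"
          by (rule continuous_on_compose2[OF h0 continuous_on_snd[OF continuous_on_id]]) simp
        from continuous_on_scaleR[OF this cont_fst[of l]]
        show ?thesis using 2 by (simp add: dd case_prod_unfold)
      qed
    qed simp
    moreover have "(orb has_vector_derivative l) (at 0)"
    proof -
      have "((\<lambda>t. norm ((1 / t) *\<^sub>R (orb t - v) - l)) \<longlongrightarrow> norm (l - l)) (at 0)"
        by (intro tendsto_intros l)
      moreover have "\<forall>\<^sub>F t in at 0. norm ((1 / t) *\<^sub>R (orb t - v) - l) = norm (orb (0 + t) - orb 0 - t *\<^sub>R l) / norm t"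
      proof -
        have "norm ((1 / t) *\<^sub>R (orb t - v) - l) = norm (orb (0 + t) - orb 0 - t *\<^sub>R l) / norm t" if "t \<noteq> 0" for t
        proof -
          have "(1 / t) *\<^sub>R (orb t - v) - l = (1 / t) *\<^sub>R (orb (0 + t) - orb 0 - t *\<^sub>R l)"
            using that by (simp add: scaleR_diff_right)
          then show ?thesis by (simp only: norm_scaleR) (simp add: divide_simps)
        qed
        then show ?thesis by (auto simp: eventually_at_filter)
      qed
      ultimately have "((\<lambda>t. norm (orb (0 + t) - orb 0 - t *\<^sub>R l) / norm t) \<longlongrightarrow> 0) (at 0)"
        using tendsto_cong by fastforce
      then show ?thesis
        unfolding has_vector_derivative_def has_derivative_at by (simp add: bounded_linear_scaleR_left)
    qed
    then have "vector_derivative orb (at 0) = l"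
      by (rule vector_derivative_at)
    ultimately show ?thesis
      by (simp add: dpi_bar_def orb_def[abs_def])
  qed
  show ?thesis
  proof
    assume u: "dpi_bar ex \<pi> x v = Some u"
    then have "Ck_on 1 UNIV orb"
      by (auto simp: dpi_bar_def orb_def[abs_def] Let_def split: if_splits)
    then have "dir_differentiable (\<lambda>y. iter_deriv 0 orb y (\<lambda>_. 1)) 0 ((\<lambda>_. 1) 0)"
      unfolding Ck_on_def by (metis UNIV_I one_enat_def order_refl One_nat_def)
    then obtain l where "(dir_quot orb 0 1 \<longlongrightarrow> l) (at 0)"
      by (auto simp: dir_differentiable_def)
    then have l: "((\<lambda>t. (1 / t) *\<^sub>R (orb t - v)) \<longlongrightarrow> l) (at 0)"
      by (simp add: dir_quot_def[abs_def])
    from fwd[OF l] u have "l = u" by simp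
    with l show "((\<lambda>t. (1 / t) *\<^sub>R (\<pi> (ex (t *\<^sub>R x)) v - v)) \<longlongrightarrow> u) (at 0)"
      by (simp add: orb_def)
  next
    assume "((\<lambda>t. (1 / t) *\<^sub>R (\<pi> (ex (t *\<^sub>R x)) v - v)) \<longlongrightarrow> u) (at 0)"
    then show "dpi_bar ex \<pi> x v = Some u"
      by (intro fwd) (simp add: orb_def)
  qed
qed

lemma dpi_bar_smooth:
  assumes v: "v \<in> S"
  shows "dpi_bar ex \<pi> x v = Some (dpi ex \<pi> x v)"
proof -
  have "\<exists>u. dpi_bar ex \<pi> x v = Some u"
    using derivative_along_ex[OF smooth_vectorsD[OF v] chart_at_one' chart_at_one(2), of x]
    unfolding dpi_bar_iff by auto
  then show ?thesis by (auto simp: dpi_def)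
qed

lemma dpi_tendsto:
  "v \<in> S \<Longrightarrow> ((\<lambda>t. (1 / t) *\<^sub>R (\<pi> (ex (t *\<^sub>R x)) v - v)) \<longlongrightarrow> dpi ex \<pi> x v) (at 0)"
  using dpi_bar_smooth dpi_bar_iff by blast

lemma dpi_eqI:
  "((\<lambda>t. (1 / t) *\<^sub>R (\<pi> (ex (t *\<^sub>R x)) v - v)) \<longlongrightarrow> u) (at 0) \<Longrightarrow> dpi ex \<pi> x v = u"
  unfolding dpi_bar_iff[symmetric] by (simp add: dpi_def)

lemma rep_dpi_tendsto:
  assumes v: "v \<in> S"
  shows "((\<lambda>t. (1 / t) *\<^sub>R (\<pi> (g \<otimes> ex (t *\<^sub>R x)) v - \<pi> g v)) \<longlongrightarrow> \<pi> g (dpi ex \<pi> x v)) (at 0)"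
proof -
  have "((\<lambda>t. \<pi> g ((1 / t) *\<^sub>R (\<pi> (ex (t *\<^sub>R x)) v - v))) \<longlongrightarrow> \<pi> g (dpi ex \<pi> x v)) (at 0)"
    by (intro tendsto_intros dpi_tendsto v)
  then show ?thesis
    by (simp add: rep_mult blinfun.scaleR_right blinfun.diff_right)
qed

text \<open>The orbit map of the new vector is a partial derivative, at the identity in the second
  factor, of a function smooth in both factors.\<close>

lemma dpi_in_smooth_vectors:
  assumes v: "v \<in> S"
  shows "dpi ex \<pi> x v \<in> S"
proof -
  have "smooth_map \<A> lcs_atlas (\<lambda>g. \<pi> g (dpi ex \<pi> x v))"
  proof (rule smooth_mapI)
    fix U \<phi> assume U: "(U, \<phi>) \<in> \<A>"
    let ?K = "\<lambda>(a, b). \<pi> (inv_into U \<phi> a \<otimes> cinv b) v"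
    have "smooth_on {a. (a, e) \<in> \<phi> ` U \<times> coords} (\<lambda>a. dir_deriv ?K (a, e) (0, x))"
      by (rule smooth_on_slice[OF smooth_on_dir_deriv[OF smooth_on_product[OF smooth_vectorsD[OF v] U chart_at_one']]])
    moreover have "{a. (a, e) \<in> \<phi> ` U \<times> coords} = \<phi> ` U"
      by auto
    ultimately have "smooth_on (\<phi> ` U) (\<lambda>a. dir_deriv ?K (a, e) (0, x))" by simp
    then show "smooth_on (\<phi> ` U) (\<lambda>a. \<pi> (inv_into U \<phi> a) (dpi ex \<pi> x v))"
    proof (rule smooth_on_cong)
      fix a assume "a \<in> \<phi> ` U"
      then obtain g where g: "a = \<phi> g" "g \<in> U" by auto
      show "dir_deriv ?K (a, e) (0, x) = \<pi> (inv_into U \<phi> a) (dpi ex \<pi> x v)"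
        using tendsto_unique[OF _ derivative_along_ex[OF smooth_vectorsD[OF v] U g(2)] rep_dpi_tendsto[OF v], of x] g U
        by simp
    qed
  qed
  then show ?thesis by (simp add: smooth_vectors_def)
qed

section \<open>Generators as left-invariant vector fields\<close>

abbreviation orbit where "orbit v \<equiv> (\<lambda>a. \<pi> (cinv a) v)"

lemma smooth_on_orbit: "v \<in> S \<Longrightarrow> smooth_on coords (orbit v)"
  using smooth_map_chart[OF smooth_vectorsD chart_at_one'] .

text \<open>As a partial derivative of the jointly smooth multiplication the field is seen to depend
  smoothly on \<open>a\<close>.\<close>

lemma left_inv_field_eq: "X x a = dir_deriv (mult_coord c c c) (a, e) (0, x)"
proof -
  have lin: "linear (\<lambda>b::'e. (0::'e, b))"
    by (rule linearI) simp_all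
  have "dir_deriv (\<lambda>b. mult_coord c c c ((0, b) + (a, 0))) e x = dir_deriv (mult_coord c c c) ((0, e) + (a, 0)) (0, x)"
    using iter_deriv_affine[OF lin, of 1 "mult_coord c c c" "(a, 0)" e "\<lambda>_. x"] by simp
  then show ?thesis
    by (simp add: left_inv_field_def mult_coord_def Let_def)
qed

lemma mult_dom_unit: "a \<in> coords \<Longrightarrow> (a, e) \<in> mult_dom c c c"
  using mult_domI[of _ c \<one> c c] chart_at_one(2) by auto

lemma smooth_on_left_inv_field: "smooth_on coords (X x)"
proof -
  have "smooth_on {a. (a, e) \<in> mult_dom c c c} (\<lambda>a. dir_deriv (mult_coord c c c) (a, e) (0, x))"
    using smooth_on_mult_coord chart_at_one(1) by (intro smooth_on_slice smooth_on_dir_deriv) auto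
  then have "smooth_on coords (\<lambda>a. dir_deriv (mult_coord c c c) (a, e) (0, x))"
    by (rule smooth_on_subset[OF _ open_coords]) (use mult_dom_unit in blast)
  then show ?thesis
    by (simp only: left_inv_field_eq[abs_def])
qed

lemma left_inv_field_e: "X x e = x"
proof -
  have "X x e = dir_deriv (\<lambda>b. b) e x"
    unfolding left_inv_field_def Let_def
  proof (rule dir_deriv_cong(1)[OF open_coords e_in_coords])
    fix b assume "b \<in> coords"
    then show "snd c (cinv e \<otimes> cinv b) = b"
      using f_inv_into_f[of b "snd c" "fst c"] by simp
  qed
  also have "\<dots> = x"
    by (rule dir_deriv_eqI[OF dir_quot_ident])
  finally show ?thesis .
qed

text \<open>In coordinates the curve \<open>g \<otimes> ex (t *\<^sub>R x)\<close> has velocity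
  \<open>X x a\<close> at 0, so the chain rule turns the generator into the left-invariant vector
  field. Words of generators are treated as differential operators on this basis.\<close>

lemma orbit_dpi:
  assumes v: "v \<in> S" and a: "a \<in> coords"
  shows "orbit (dpi ex \<pi> x v) a = dir_deriv (orbit v) a (X x a)"
proof -
  let ?M = "mult_coord c c c"
  obtain g where g: "a = snd c g" "g \<in> fst c" using a by auto
  have pa: "cinv a = g" using g chart_inv[OF chart_at_one'] by simp
  define y where "y t = ?M (a, snd c (ex (t *\<^sub>R x)))" for t
  have "((\<lambda>t. (1 / t) *\<^sub>R (?M (a, snd c (ex (t *\<^sub>R x))) - ?M (a, e))) \<longlongrightarrow> dir_deriv ?M (a, e) (0, x)) (at 0)"
  proof (rule smooth_on_chain[OF smooth_on_mult_coord mult_dom_unit[OF a]])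
    have "((\<lambda>t. (0, (1 / t) *\<^sub>R (snd c (ex (t *\<^sub>R x)) - e))) \<longlongrightarrow> (0, x)) (at 0)"
      by (intro tendsto_Pair tendsto_const ex_velocity)
    then show "((\<lambda>t. (1 / t) *\<^sub>R ((a, snd c (ex (t *\<^sub>R x))) - (a, e))) \<longlongrightarrow> (0, x)) (at 0)"
      by simp
  qed (use chart_at_one in \<open>auto simp: eventually_at_filter\<close>)
  moreover have "?M (a, e) = a"
    using g pa by (simp add: mult_coord_def)
  ultimately have y: "((\<lambda>t. (1 / t) *\<^sub>R (y t - a)) \<longlongrightarrow> X x a) (at 0)"
    by (simp add: y_def left_inv_field_eq)
  have "((\<lambda>t. (1 / t) *\<^sub>R (orbit v (y t) - orbit v a)) \<longlongrightarrow> dir_deriv (orbit v) a (X x a)) (at 0)"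
    by (rule smooth_on_chain[OF smooth_on_orbit[OF v] a _ _ y]) (auto simp: eventually_at_filter)
  moreover have "\<forall>\<^sub>F t in at 0. (1 / t) *\<^sub>R (orbit v (y t) - orbit v a) = (1 / t) *\<^sub>R (\<pi> (g \<otimes> ex (t *\<^sub>R x)) v - \<pi> g v)"
  proof -
    have "continuous_on UNIV (\<lambda>h. g \<otimes> h)"
    proof -
      have "continuous_on UNIV (\<lambda>(g, h). g \<otimes> h)"
        using smooth_mult by (simp add: smooth_map_def)
      from continuous_on_compose2[OF this, of UNIV "\<lambda>h. (g, h)"] show ?thesis
        by (simp add: continuous_on_Pair)
    qed
    from continuous_on_compose2[OF this continuous_on_ex_line[of UNIV x]]
    have "((\<lambda>t. g \<otimes> ex (t *\<^sub>R x)) \<longlongrightarrow> g \<otimes> ex (0 *\<^sub>R x)) (at 0)"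
      unfolding continuous_on_def by blast
    then have "\<forall>\<^sub>F t in at 0. g \<otimes> ex (t *\<^sub>R x) \<in> fst c"
      using chart_facts(1)[OF chart_at_one'] g(2) by (simp add: tendsto_def)
    then show ?thesis
      using ex_near_one[of x]
      by eventually_elim (simp add: y_def mult_coord_def pa chart_inv[OF chart_at_one'])
  qed
  ultimately have "((\<lambda>t. (1 / t) *\<^sub>R (\<pi> (g \<otimes> ex (t *\<^sub>R x)) v - \<pi> g v)) \<longlongrightarrow> dir_deriv (orbit v) a (X x a)) (at 0)"
    by (rule Lim_transform_eventually)
  then show ?thesis
    using tendsto_unique[OF _ _ rep_dpi_tendsto[OF v, of g x]] by (simp add: pa)
qed

text \<open>Linearity in the Lie algebra element is inherited from the directional derivative at the
  identity.\<close>

lemma dpi_eq_dir_deriv: "v \<in> S \<Longrightarrow> dpi ex \<pi> x v = dir_deriv (orbit v) e x"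
  using orbit_dpi[of v e x] by (simp add: left_inv_field_e)

lemma dpi_add_left: "v \<in> S \<Longrightarrow> dpi ex \<pi> (x + y) v = dpi ex \<pi> x v + dpi ex \<pi> y v"
  using smooth_on_dir_deriv_add[OF smooth_on_orbit e_in_coords] by (simp add: dpi_eq_dir_deriv)

lemma dpi_scaleR_left: "v \<in> S \<Longrightarrow> dpi ex \<pi> (r *\<^sub>R x) v = r *\<^sub>R dpi ex \<pi> x v"
  using dir_deriv_scaleR(2)[OF smooth_on_dir_differentiable[OF smooth_on_orbit e_in_coords]]
  by (simp add: dpi_eq_dir_deriv)

lemma dpi_diff_left: "v \<in> S \<Longrightarrow> dpi ex \<pi> (x - y) v = dpi ex \<pi> x v - dpi ex \<pi> y v"
  using dpi_add_left[of v "x - y" y] by simp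

lemma dpi_zero_left: "dpi ex \<pi> 0 v = 0"
  by (rule dpi_eqI) simp

lemma dpi_add_right:
  assumes "v \<in> S" "w \<in> S"
  shows "dpi ex \<pi> x (v + w) = dpi ex \<pi> x v + dpi ex \<pi> x w"
proof (rule dpi_eqI)
  have "(1 / t) *\<^sub>R (\<pi> (ex (t *\<^sub>R x)) v - v) + (1 / t) *\<^sub>R (\<pi> (ex (t *\<^sub>R x)) w - w) =
      (1 / t) *\<^sub>R (\<pi> (ex (t *\<^sub>R x)) (v + w) - (v + w))" for t
    by (simp only: scaleR_add_right[symmetric] blinfun.add_right) (simp add: algebra_simps)
  then show "((\<lambda>t. (1 / t) *\<^sub>R (\<pi> (ex (t *\<^sub>R x)) (v + w) - (v + w))) \<longlongrightarrow> dpi ex \<pi> x v + dpi ex \<pi> x w) (at 0)"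
    using tendsto_add[OF dpi_tendsto[OF assms(1), of x] dpi_tendsto[OF assms(2), of x]] by simp
qed

lemma dpi_scaleC_right:
  assumes "v \<in> S"
  shows "dpi ex \<pi> x (a *\<^sub>C v) = a *\<^sub>C dpi ex \<pi> x v"
  using bounded_linear.tendsto[OF bounded_linear_scaleC[of a] dpi_tendsto[OF assms, of x]]
  by (intro dpi_eqI) (simp add: rep_scaleC scaleC_scaleR scaleC_diff_right)

text \<open>Differentiating the orbit map along a moving field gives a second derivative plus a
  derivative along the derivative of the field. In the commutator the second derivatives cancel by
  symmetry, and the rest is the coordinate bracket.\<close>

lemma dpi_commutator:
  assumes v: "v \<in> S"
  shows "dpi ex \<pi> x (dpi ex \<pi> y v) - dpi ex \<pi> y (dpi ex \<pi> x v) = dpi ex \<pi> (lie_bracket G c x y) v"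
proof -
  let ?f = "orbit v"
  have f: "smooth_on coords ?f" using smooth_on_orbit[OF v] .
  have two: "dpi ex \<pi> x (dpi ex \<pi> y v) =
      dir_deriv (\<lambda>a. dir_deriv ?f a y) e x + dir_deriv ?f e (dir_deriv (X y) e x)" for x y
  proof -
    have "dpi ex \<pi> x (dpi ex \<pi> y v) = dir_deriv (orbit (dpi ex \<pi> y v)) e x"
      using dpi_eq_dir_deriv[OF dpi_in_smooth_vectors[OF v]] .
    also have "\<dots> = dir_deriv (\<lambda>a. iter_deriv 1 ?f a (\<lambda>_. X y a)) e x"
      by (rule dir_deriv_cong(1)[OF open_coords e_in_coords]) (simp add: orbit_dpi[OF v])
    also have "\<dots> = iter_deriv (Suc 1) ?f e ((\<lambda>_. X y e)(1 := dir_deriv (\<lambda>a. a) e x)) +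
        (\<Sum>i<1. iter_deriv 1 ?f e ((\<lambda>_. X y e)(i := dir_deriv (X y) e x)))"
      by (intro dir_deriv_eqI dir_quot_moving_dirs[OF f dir_differentiableI[OF dir_quot_ident], where Z = "\<lambda>_. X y"])
        (auto intro: smooth_on_dir_differentiable[OF smooth_on_left_inv_field])
    also have "\<dots> = dir_deriv (\<lambda>a. dir_deriv ?f a y) e x + dir_deriv ?f e (dir_deriv (X y) e x)"
      by (simp add: dir_deriv_eqI[OF dir_quot_ident] left_inv_field_e)
    finally show ?thesis .
  qed
  have diff: "dir_deriv ?f e (a - b) = dir_deriv ?f e a - dir_deriv ?f e b" for a b
    using smooth_on_dir_deriv_add[OF f e_in_coords, of "a - b" b] by simp
  have "dpi ex \<pi> (lie_bracket G c x y) v = dir_deriv ?f e (dir_deriv (X y) e x) - dir_deriv ?f e (dir_deriv (X x) e y)"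
    by (simp only: dpi_eq_dir_deriv[OF v] lie_bracket_def diff)
  then show ?thesis
    unfolding two using dir_deriv_commute[OF f e_in_coords, of x y] by simp
qed

text \<open>By unitarity the quotient of \<open>v\<close> at \<open>t\<close>, paired with
  \<open>w\<close>, is minus \<open>v\<close> paired with the quotient of \<open>w\<close> at
  \<open>- t\<close>.\<close>

lemma dpi_bar_skew:
  assumes "dpi_bar ex \<pi> x v = Some a" "dpi_bar ex \<pi> x w = Some b"
  shows "ip a w = - ip v b"
proof -
  have "((\<lambda>t. ip ((1 / t) *\<^sub>R (\<pi> (ex (t *\<^sub>R x)) v - v)) w) \<longlongrightarrow> ip a w) (at 0)"
    using assms(1) unfolding dpi_bar_iff by (intro bounded_bilinear.tendsto[OF bounded_bilinear_ip] tendsto_const)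
  moreover have "((\<lambda>t. ip ((1 / t) *\<^sub>R (\<pi> (ex (t *\<^sub>R x)) v - v)) w) \<longlongrightarrow> - ip v b) (at 0)"
  proof -
    have "((\<lambda>t. (1 / - t) *\<^sub>R (\<pi> (ex (- t *\<^sub>R x)) w - w)) \<longlongrightarrow> b) (at 0)"
      using assms(2) filterlim_uminus_at_0 unfolding dpi_bar_iff by (rule filterlim_compose)
    then have "((\<lambda>t. - ip v ((1 / - t) *\<^sub>R (\<pi> (ex (- t *\<^sub>R x)) w - w))) \<longlongrightarrow> - ip v b) (at 0)"
      by (intro tendsto_minus bounded_bilinear.tendsto[OF bounded_bilinear_ip] tendsto_const)
    moreover have "- ip v ((1 / - t) *\<^sub>R (\<pi> (ex (- t *\<^sub>R x)) w - w)) = ip ((1 / t) *\<^sub>R (\<pi> (ex (t *\<^sub>R x)) v - v)) w" for t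
      using ip_rep_inv[of "ex (t *\<^sub>R x)" w v] inv_ex[of t x]
      by (simp add: ip_scaleR_left ip_scaleR_right ip_diff_left ip_diff_right ip_minus_right ip_commute)
    ultimately show ?thesis by simp
  qed
  ultimately show ?thesis
    by (rule tendsto_unique[rotated]) simp
qed

text \<open>The smooth vectors form a core of each generator: the test vectors may be moved along the
  one-parameter group because smooth vectors are invariant under it.\<close>

lemma dpi_bar_weak:
  assumes weak: "\<And>v. v \<in> S \<Longrightarrow> ip (dpi ex \<pi> x v) w = - ip v u"
  shows "dpi_bar ex \<pi> x w = Some u"
  unfolding dpi_bar_iff
proof (rule tendstoI)
  fix \<epsilon> :: real assume \<epsilon>: "\<epsilon> > 0"
  define orb where "orb t = \<pi> (ex (t *\<^sub>R x)) u" for t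
  have der: "((\<lambda>t. ip v (\<pi> (ex (t *\<^sub>R x)) w)) has_real_derivative ip v (orb t)) (at t)" if v: "v \<in> S" for v t
  proof -
    define v' where "v' = \<pi> (ex (- t *\<^sub>R x)) v"
    have v': "v' \<in> S" unfolding v'_def using v by (rule smooth_vectors_rep)
    have eq: "ip v (\<pi> (ex ((t + s) *\<^sub>R x)) w) = ip (\<pi> (ex (- s *\<^sub>R x)) v') w" for s
    proof -
      have "ip v (\<pi> (ex ((t + s) *\<^sub>R x)) w) = ip (\<pi> (ex ((- s + - t) *\<^sub>R x)) v) w"
        using ip_rep_inv[of "ex ((t + s) *\<^sub>R x)" v w] inv_ex[of "t + s" x] by (simp add: add.commute)
      then show ?thesis
        using ex_add[of "- s" "- t" x] by (simp add: v'_def rep_mult)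
    qed
    have "((\<lambda>s. (1 / - s) *\<^sub>R (\<pi> (ex (- s *\<^sub>R x)) v' - v')) \<longlongrightarrow> dpi ex \<pi> x v') (at 0)"
      using dpi_tendsto[OF v'] filterlim_uminus_at_0 by (rule filterlim_compose)
    then have "((\<lambda>s. - ip ((1 / - s) *\<^sub>R (\<pi> (ex (- s *\<^sub>R x)) v' - v')) w) \<longlongrightarrow> - ip (dpi ex \<pi> x v') w) (at 0)"
      by (intro tendsto_minus bounded_bilinear.tendsto[OF bounded_bilinear_ip] tendsto_const)
    moreover have "- ip (dpi ex \<pi> x v') w = ip v (orb t)"
      using weak[OF v'] ip_rep_inv[of "ex (t *\<^sub>R x)" v u] inv_ex[of t x] by (simp add: v'_def orb_def)
    moreover have "- ip ((1 / - s) *\<^sub>R (\<pi> (ex (- s *\<^sub>R x)) v' - v')) w =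
        (ip v (\<pi> (ex ((t + s) *\<^sub>R x)) w) - ip v (\<pi> (ex (t *\<^sub>R x)) w)) / s" for s
      using eq[of s] eq[of 0] by (simp add: ip_scaleR_left ip_diff_left ip_minus_left)
    ultimately show ?thesis
      by (simp add: DERIV_def)
  qed
  have "continuous_on UNIV orb"
    unfolding orb_def by (intro continuous_on_rep continuous_on_ex_line continuous_intros)
  then have "(orb \<longlongrightarrow> orb 0) (at 0)"
    unfolding continuous_on_def by blast
  moreover have orb0: "orb 0 = u" by (simp add: orb_def)
  ultimately have "\<forall>\<^sub>F t in at 0. dist (orb t) u < \<epsilon> / 2"
    using tendstoD[of orb u "at 0" "\<epsilon> / 2"] \<epsilon> by simp
  then obtain d where d: "d > 0" "\<And>t. t \<noteq> 0 \<Longrightarrow> \<bar>t\<bar> < d \<Longrightarrow> dist (orb t) u < \<epsilon> / 2"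
    by (auto simp: eventually_at dist_real_def)
  have d': "dist (orb t) u < \<epsilon> / 2" if "\<bar>t\<bar> < d" for t
    using that d(2)[of t] \<epsilon> orb0 by (cases "t = 0") auto
  have "dist ((1 / t) *\<^sub>R (\<pi> (ex (t *\<^sub>R x)) w - w)) u < \<epsilon>" if t: "t \<noteq> 0" "\<bar>t\<bar> < d" for t
  proof -
    have "norm ((1 / t) *\<^sub>R (\<pi> (ex (t *\<^sub>R x)) w - w) - u) \<le> \<epsilon> / 2"
    proof (rule norm_dense_leI[OF dense])
      fix v assume v: "v \<in> S"
      let ?\<psi> = "\<lambda>t. ip v (\<pi> (ex (t *\<^sub>R x)) w)"
      \<comment> \<open>The intermediate point depends on the test vector, but it always lies where
        \<open>orb\<close> is within \<epsilon>/2 of \<open>u\<close>; the resulting estimate is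
        therefore uniform in \<open>v\<close>, and density turns it into a norm estimate.\<close>
      obtain \<theta> where \<theta>: "\<bar>\<theta>\<bar> < d" "?\<psi> t - ?\<psi> 0 = t * ip v (orb \<theta>)"
      proof (cases "t > 0")
        case True
        from MVT2[OF this der[OF v]] obtain z where "0 < z" "z < t" "?\<psi> t - ?\<psi> 0 = (t - 0) * ip v (orb z)"
          by blast
        then show thesis using that[of z] t by simp
      next
        case False
        then have "t < 0" using t by simp
        from MVT2[OF this der[OF v]] obtain z where "t < z" "z < 0" "?\<psi> 0 - ?\<psi> t = (0 - t) * ip v (orb z)"
          by blast
        then show thesis using that[of z] t by simp
      qed
      have "ip v ((1 / t) *\<^sub>R (\<pi> (ex (t *\<^sub>R x)) w - w) - u) = ip v (orb \<theta> - u)"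
        using \<theta>(2) t(1) by (simp add: ip_diff_right ip_scaleR_right)
      also have "\<dots> \<le> norm v * norm (orb \<theta> - u)"
        by (rule ip_le_norm)
      also have "\<dots> \<le> norm v * (\<epsilon> / 2)"
        using d'[OF \<theta>(1)] by (intro mult_left_mono) (auto simp: dist_norm)
      finally show "ip v ((1 / t) *\<^sub>R (\<pi> (ex (t *\<^sub>R x)) w - w) - u) \<le> \<epsilon> / 2 * norm v"
        by (simp add: mult.commute)
    qed (use \<epsilon> in simp)
    then show ?thesis using \<epsilon> by (simp add: dist_norm)
  qed
  then show "\<forall>\<^sub>F t in at 0. dist ((1 / t) *\<^sub>R (\<pi> (ex (t *\<^sub>R x)) w - w)) u < \<epsilon>"
    using d(1) by (auto simp: eventually_at dist_real_def)
qed

end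

section \<open>The derived representation of the enveloping algebra\<close>

lemma poly_mapping_single_induct [case_names zero add_single]:
  fixes p :: "'a \<Rightarrow>\<^sub>0 'b::comm_monoid_add"
  assumes "P 0" "\<And>p w a. P p \<Longrightarrow> P (p + Poly_Mapping.single w a)"
  shows "P p"
proof (induction p rule: update_induct)
  case (update p w a)
  have "Poly_Mapping.update w a p = p + Poly_Mapping.single w a"
    using update.hyps(1)
    by (intro poly_mapping_eqI) (auto simp: lookup_update lookup_add lookup_single in_keys_iff when_def)
  then show ?case using assms(2) update by simp
qed (rule assms(1))

context lie_group_rep
begin

abbreviation word where "word xs v \<equiv> foldr (dpi ex \<pi>) xs v"
abbreviation cword where "cword us v \<equiv> foldr (dpi_cplx ex \<pi>) us v"

lemma word_in_smooth_vectors: "v \<in> S \<Longrightarrow> word xs v \<in> S"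
  by (induction xs) (simp_all add: dpi_in_smooth_vectors)

lemma word_add: "v \<in> S \<Longrightarrow> w \<in> S \<Longrightarrow> word xs (v + w) = word xs v + word xs w"
  by (induction xs) (simp_all add: dpi_add_right word_in_smooth_vectors)

lemma word_scaleC: "v \<in> S \<Longrightarrow> word xs (a *\<^sub>C v) = a *\<^sub>C word xs v"
  by (induction xs) (simp_all add: dpi_scaleC_right word_in_smooth_vectors)

lemma word_scaleR: "v \<in> S \<Longrightarrow> word xs (r *\<^sub>R v) = r *\<^sub>R word xs v"
  using word_scaleC[of v xs "of_real r"] by (simp add: scaleC_of_real)

lemma dpi_cplx_in_smooth_vectors: "v \<in> S \<Longrightarrow> dpi_cplx ex \<pi> u v \<in> S"
  by (auto simp: dpi_cplx_def split: prod.split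
      intro!: smooth_vectors_add smooth_vectors_scaleC dpi_in_smooth_vectors)

lemma dpi_cplx_add_right:
  "v \<in> S \<Longrightarrow> w \<in> S \<Longrightarrow> dpi_cplx ex \<pi> u (v + w) = dpi_cplx ex \<pi> u v + dpi_cplx ex \<pi> u w"
  by (auto simp: dpi_cplx_def dpi_add_right scaleC_add_right split: prod.split)

lemma dpi_cplx_scaleC_right:
  "v \<in> S \<Longrightarrow> dpi_cplx ex \<pi> u (a *\<^sub>C v) = a *\<^sub>C dpi_cplx ex \<pi> u v"
  by (auto simp: dpi_cplx_def dpi_scaleC_right scaleC_add_right scaleC_scaleC mult.commute split: prod.split)

lemma dpi_cplx_add_left:
  "v \<in> S \<Longrightarrow> dpi_cplx ex \<pi> (u + w) v = dpi_cplx ex \<pi> u v + dpi_cplx ex \<pi> w v"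
  by (cases u; cases w) (simp add: dpi_cplx_def dpi_add_left scaleC_add_right)

lemma dpi_cplx_scale_left:
  assumes "v \<in> S"
  shows "dpi_cplx ex \<pi> (cplx_scale a u) v = a *\<^sub>C dpi_cplx ex \<pi> u v"
proof -
  obtain x y where u: "u = (x, y)" by (cases u)
  let ?x = "dpi ex \<pi> x v" and ?y = "dpi ex \<pi> y v"
  have "dpi_cplx ex \<pi> (cplx_scale a u) v =
      of_real (Re a) *\<^sub>C ?x - of_real (Im a) *\<^sub>C ?y + \<i> *\<^sub>C (of_real (Re a) *\<^sub>C ?y + of_real (Im a) *\<^sub>C ?x)"
    using assms by (simp add: u dpi_cplx_def cplx_scale_def dpi_add_left dpi_diff_left dpi_scaleR_left scaleC_of_real)
  also have "\<dots> = (of_real (Re a) + \<i> * of_real (Im a)) *\<^sub>C ?x + (\<i> * of_real (Re a) - of_real (Im a)) *\<^sub>C ?y"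
    by (simp only: scaleC_add_left scaleC_diff_left scaleC_add_right scaleC_scaleC) simp
  also have "of_real (Re a) + \<i> * of_real (Im a) = a"
    by (simp add: complex_eq_iff)
  also have "\<i> * of_real (Re a) - of_real (Im a) = a * \<i>"
    by (simp add: complex_eq_iff)
  also have "a *\<^sub>C ?x + (a * \<i>) *\<^sub>C ?y = a *\<^sub>C dpi_cplx ex \<pi> u v"
    by (simp add: u dpi_cplx_def scaleC_add_right scaleC_scaleC)
  finally show ?thesis .
qed

lemma dpi_cplx_commutator:
  assumes v: "v \<in> S"
  shows "dpi_cplx ex \<pi> u (dpi_cplx ex \<pi> w v) - dpi_cplx ex \<pi> w (dpi_cplx ex \<pi> u v) =
    dpi_cplx ex \<pi> (cplx_bracket (lie_bracket G c) u w) v"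
proof -
  obtain x y x' y' where uw: "u = (x, y)" "w = (x', y')" by (cases u; cases w) auto
  define d where "d x = dpi ex \<pi> x" for x
  have dS: "d x v \<in> S" for x unfolding d_def using v by (rule dpi_in_smooth_vectors)
  have comm: "d (lie_bracket G c x y) v = d x (d y v) - d y (d x v)" for x y
    unfolding d_def using dpi_commutator[OF v] by simp
  have lin: "d x (d y v + \<i> *\<^sub>C d z v) = d x (d y v) + \<i> *\<^sub>C d x (d z v)" for x y z
    using dS unfolding d_def by (simp add: dpi_add_right dpi_scaleC_right smooth_vectors_scaleC)
  have dlin: "d (x - y) v = d x v - d y v" "d (x + y) v = d x v + d y v" for x y
    unfolding d_def using v by (simp_all add: dpi_diff_left dpi_add_left)
  have ii: "\<i> *\<^sub>C \<i> *\<^sub>C z = - z" for z :: 'h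
    by (simp add: scaleC_scaleC scaleC_minus1)
  have "dpi_cplx ex \<pi> (cplx_bracket (lie_bracket G c) u w) v =
      (d x (d x' v) - d x' (d x v)) - (d y (d y' v) - d y' (d y v)) +
      \<i> *\<^sub>C ((d x (d y' v) - d y' (d x v)) + (d y (d x' v) - d x' (d y v)))"
    by (simp add: uw dpi_cplx_def cplx_bracket_def d_def[symmetric] dlin comm)
  moreover have "dpi_cplx ex \<pi> u (dpi_cplx ex \<pi> w v) =
      d x (d x' v) + \<i> *\<^sub>C d x (d y' v) + \<i> *\<^sub>C d y (d x' v) - d y (d y' v)"
    by (simp add: uw dpi_cplx_def d_def[symmetric] lin scaleC_add_right ii)
  moreover have "dpi_cplx ex \<pi> w (dpi_cplx ex \<pi> u v) =
      d x' (d x v) + \<i> *\<^sub>C d x' (d y v) + \<i> *\<^sub>C d y' (d x v) - d y' (d y v)"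
    by (simp add: uw dpi_cplx_def d_def[symmetric] lin scaleC_add_right ii)
  ultimately show ?thesis
    by (simp only: scaleC_add_right scaleC_diff_right) simp
qed

lemma cword_in_smooth_vectors: "v \<in> S \<Longrightarrow> cword us v \<in> S"
  by (induction us) (simp_all add: dpi_cplx_in_smooth_vectors)

lemma cword_add: "v \<in> S \<Longrightarrow> w \<in> S \<Longrightarrow> cword us (v + w) = cword us v + cword us w"
  by (induction us) (simp_all add: dpi_cplx_add_right cword_in_smooth_vectors)

lemma cword_scaleC: "v \<in> S \<Longrightarrow> cword us (a *\<^sub>C v) = a *\<^sub>C cword us v"
  by (induction us) (simp_all add: dpi_cplx_scaleC_right cword_in_smooth_vectors)

lemma dpi_free_superset:
  assumes "finite K" "Poly_Mapping.keys p \<subseteq> K"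
  shows "dpi_free ex \<pi> p v = (\<Sum>w\<in>K. Poly_Mapping.lookup p w *\<^sub>C cword (letters w) v)"
  unfolding dpi_free_def using assms
  by (intro sum.mono_neutral_left) (auto simp: in_keys_iff)

lemma dpi_free_zero [simp]: "dpi_free ex \<pi> 0 v = 0"
  by (simp add: dpi_free_def)

lemma dpi_free_single [simp]: "dpi_free ex \<pi> (Poly_Mapping.single w a) v = a *\<^sub>C cword (letters w) v"
  by (subst dpi_free_superset[of "{w}"]) simp_all

lemma dpi_free_add: "dpi_free ex \<pi> (p + q) v = dpi_free ex \<pi> p v + dpi_free ex \<pi> q v"
proof -
  let ?K = "Poly_Mapping.keys p \<union> Poly_Mapping.keys q"
  have "Poly_Mapping.keys (p + q) \<subseteq> ?K" by (rule keys_add)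
  then have "dpi_free ex \<pi> (p + q) v = (\<Sum>w\<in>?K. Poly_Mapping.lookup (p + q) w *\<^sub>C cword (letters w) v)"
    by (intro dpi_free_superset) auto
  also have "\<dots> = (\<Sum>w\<in>?K. Poly_Mapping.lookup p w *\<^sub>C cword (letters w) v) +
      (\<Sum>w\<in>?K. Poly_Mapping.lookup q w *\<^sub>C cword (letters w) v)"
    by (simp add: lookup_add scaleC_add_left sum.distrib)
  also have "\<dots> = dpi_free ex \<pi> p v + dpi_free ex \<pi> q v"
    using dpi_free_superset[of ?K p v] dpi_free_superset[of ?K q v] by simp
  finally show ?thesis .
qed

lemma dpi_free_diff: "dpi_free ex \<pi> (p - q) v = dpi_free ex \<pi> p v - dpi_free ex \<pi> q v"
  using dpi_free_add[of "p - q" q v] by simp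

lemma dpi_free_in_smooth_vectors: "v \<in> S \<Longrightarrow> dpi_free ex \<pi> p v \<in> S"
  by (induction p rule: poly_mapping_single_induct)
    (simp_all add: dpi_free_add smooth_vectors_zero smooth_vectors_add smooth_vectors_scaleC cword_in_smooth_vectors)

lemma cword_dpi_free:
  assumes "v \<in> S"
  shows "cword us (dpi_free ex \<pi> q v) = dpi_free ex \<pi> (Poly_Mapping.single (Word us) 1 * q) v"
proof (induction q rule: poly_mapping_single_induct)
  case zero
  have "cword us (0 *\<^sub>C v) = 0 *\<^sub>C cword us v" using assms by (rule cword_scaleC)
  then show ?case by simp
next
  case (add_single q w a)
  have "cword us (dpi_free ex \<pi> (q + Poly_Mapping.single w a) v) =
      cword us (dpi_free ex \<pi> q v) + cword us (a *\<^sub>C cword (letters w) v)"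
    unfolding dpi_free_add using assms
    by (subst cword_add) (simp_all add: dpi_free_in_smooth_vectors smooth_vectors_scaleC cword_in_smooth_vectors)
  also have "cword us (a *\<^sub>C cword (letters w) v) = a *\<^sub>C cword (us @ letters w) v"
    using assms by (simp add: cword_scaleC cword_in_smooth_vectors)
  finally show ?case
    by (simp add: add_single distrib_left mult_single dpi_free_add plus_word_monoid_def)
qed

lemma dpi_free_mult:
  assumes "v \<in> S"
  shows "dpi_free ex \<pi> (p * q) v = dpi_free ex \<pi> p (dpi_free ex \<pi> q v)"
proof (induction p rule: poly_mapping_single_induct)
  case (add_single p w a)
  have sc: "dpi_free ex \<pi> (Poly_Mapping.single 0 a * r) v = a *\<^sub>C dpi_free ex \<pi> r v" for r
    by (induction r rule: poly_mapping_single_induct)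
      (simp_all add: distrib_left dpi_free_add mult_single scaleC_add_right scaleC_scaleC)
  \<comment> \<open>The coefficient is split off as a monomial at the empty word, because
    \<open>cword_dpi_free\<close> speaks of coefficient 1.\<close>
  have "Poly_Mapping.single w a = Poly_Mapping.single 0 a * Poly_Mapping.single w 1"
    by (simp add: mult_single)
  then have "Poly_Mapping.single w a * q = Poly_Mapping.single 0 a * (Poly_Mapping.single (Word (letters w)) 1 * q)"
    by (simp add: mult.assoc)
  then have "dpi_free ex \<pi> (Poly_Mapping.single w a * q) v = a *\<^sub>C cword (letters w) (dpi_free ex \<pi> q v)"
    by (simp only: sc cword_dpi_free[OF assms])
  then show ?case
    by (simp add: add_single distrib_right dpi_free_add)
qed simp

lemma dpi_free_gen: "dpi_free ex \<pi> (gen u) v = dpi_cplx ex \<pi> u v"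
  by (simp add: gen_def)

lemma dpi_free_zero_right: "dpi_free ex \<pi> p 0 = 0"
proof -
  have "cword us 0 = 0" for us
    using cword_scaleC[OF smooth_vectors_zero, of us 0] by simp
  then show ?thesis by (simp add: dpi_free_def)
qed

text \<open>This makes the action descend to the enveloping algebra. The vector varies in the
  induction, since in \<open>p * q\<close> the factor \<open>p\<close> acts on the smooth vector
  \<open>dpi_free ex \<pi> q v\<close>.\<close>

lemma dpi_free_env_ideal:
  assumes "p \<in> env_ideal (lie_bracket G c)" "v \<in> S"
  shows "dpi_free ex \<pi> p v = 0"
  using assms
proof (induction p arbitrary: v)
  case (rel_add u w)
  then show ?case by (simp add: dpi_free_diff dpi_free_gen dpi_cplx_add_left)
next
  case (rel_scale a u)
  then show ?case by (simp add: dpi_free_diff dpi_free_gen dpi_cplx_scale_left)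
next
  case (rel_bracket u w)
  then show ?case
    using dpi_cplx_commutator[of v u w] by (simp add: dpi_free_diff dpi_free_gen dpi_free_mult)
next
  case (mult_left p q)
  then show ?case by (simp add: dpi_free_mult dpi_free_zero_right)
next
  case (mult_right p q)
  then show ?case by (simp add: dpi_free_mult dpi_free_in_smooth_vectors)
qed (simp_all add: dpi_free_add)

lemma dpi_env_class:
  assumes "v \<in> S"
  shows "dpi_env ex \<pi> (env_rel (lie_bracket G c) `` {p}) v = dpi_free ex \<pi> p v"
proof -
  let ?q = "SOME q. q \<in> env_rel (lie_bracket G c) `` {p}"
  have "p \<in> env_rel (lie_bracket G c) `` {p}"
    by (simp add: env_rel_def env_ideal.zero)
  then have "?q \<in> env_rel (lie_bracket G c) `` {p}"
    by (rule someI)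
  then have "p - ?q \<in> env_ideal (lie_bracket G c)"
    by (simp add: env_rel_def)
  from dpi_free_env_ideal[OF this assms] have "dpi_free ex \<pi> ?q v = dpi_free ex \<pi> p v"
    unfolding dpi_free_diff by simp
  then show ?thesis by (simp only: dpi_env_def)
qed

text \<open>The parameter \<open>z\<close> and the family \<open>a\<close> let one statement serve
  both boundedness claims: \<open>A*\<close> followed by the action on smooth vectors, and the
  action on the values of \<open>A\<close>.\<close>

lemma dpi_free_bounded:
  fixes L :: "'h \<Rightarrow>\<^sub>L 'h" and a :: "'z \<Rightarrow> 'h"
  assumes L: "clinear_op L" and a: "\<And>z. z \<in> Z \<Longrightarrow> a z \<in> S"
    and words: "\<And>xs. \<exists>C. \<forall>z\<in>Z. norm (L (word xs (a z))) \<le> C * n z"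
  shows "\<exists>C. \<forall>z\<in>Z. norm (L (dpi_free ex \<pi> p (a z))) \<le> C * n z"
proof -
  have LC: "L (k *\<^sub>C v) = k *\<^sub>C L v" for k v
    using L by (simp add: clinear_op_def)
  \<comment> \<open>A prefix of real letters grows while the complex word shrinks from its outermost
    letter; this needs the bound for all \<open>xs\<close> at once.\<close>
  have cwords: "\<exists>C. \<forall>z\<in>Z. norm (L (word xs (cword us (a z)))) \<le> C * n z" for us xs
  proof (induction us arbitrary: xs)
    case Nil
    then show ?case using words by simp
  next
    case (Cons u us)
    obtain x y where u: "u = (x, y)" by (cases u)
    obtain C1 C2 where C: "\<And>z. z \<in> Z \<Longrightarrow> norm (L (word (xs @ [x]) (cword us (a z)))) \<le> C1 * n z"
      "\<And>z. z \<in> Z \<Longrightarrow> norm (L (word (xs @ [y]) (cword us (a z)))) \<le> C2 * n z"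
      using Cons.IH[of "xs @ [x]"] Cons.IH[of "xs @ [y]"] by blast
    have "norm (L (word xs (cword (u # us) (a z)))) \<le> (C1 + C2) * n z" if z: "z \<in> Z" for z
    proof -
      let ?v = "cword us (a z)"
      have v: "?v \<in> S" using a[OF z] by (rule cword_in_smooth_vectors)
      have "L (word xs (cword (u # us) (a z))) = L (word (xs @ [x]) ?v) + \<i> *\<^sub>C L (word (xs @ [y]) ?v)"
        using v by (simp add: u dpi_cplx_def word_add word_scaleC dpi_in_smooth_vectors smooth_vectors_scaleC
            blinfun.add_right LC)
      then have "norm (L (word xs (cword (u # us) (a z)))) \<le>
          norm (L (word (xs @ [x]) ?v)) + norm (L (word (xs @ [y]) ?v))"
        using norm_triangle_ineq[of "L (word (xs @ [x]) ?v)" "\<i> *\<^sub>C L (word (xs @ [y]) ?v)"]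
        by (simp add: norm_scaleC)
      then show ?thesis using C[OF z] by (simp add: algebra_simps)
    qed
    then show ?case by blast
  qed
  show ?thesis
  proof (induction p rule: poly_mapping_single_induct)
    case zero
    show ?case by (intro exI[of _ 0]) (simp add: blinfun.zero_right)
  next
    case (add_single p w k)
    obtain C1 C2 where C: "\<And>z. z \<in> Z \<Longrightarrow> norm (L (dpi_free ex \<pi> p (a z))) \<le> C1 * n z"
      "\<And>z. z \<in> Z \<Longrightarrow> norm (L (cword (letters w) (a z))) \<le> C2 * n z"
      using add_single cwords[of "[]" "letters w"] by auto
    have "norm (L (dpi_free ex \<pi> (p + Poly_Mapping.single w k) (a z))) \<le> (C1 + cmod k * C2) * n z" if z: "z \<in> Z" for z
    proof -
      have "norm (L (dpi_free ex \<pi> (p + Poly_Mapping.single w k) (a z))) \<le>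
          norm (L (dpi_free ex \<pi> p (a z))) + cmod k * norm (L (cword (letters w) (a z)))"
        using norm_triangle_ineq[of "L (dpi_free ex \<pi> p (a z))" "k *\<^sub>C L (cword (letters w) (a z))"]
        by (simp add: dpi_free_add blinfun.add_right LC norm_scaleC)
      also have "\<dots> \<le> C1 * n z + cmod k * (C2 * n z)"
        using C[OF z] by (intro add_mono mult_left_mono) auto
      finally show ?thesis by (simp add: algebra_simps)
    qed
    then show ?case by blast
  qed
qed

section \<open>Domains of products of generators\<close>

abbreviation gens where "gens xs \<equiv> fold (\<lambda>x T. dpi_bar ex \<pi> x \<circ>\<^sub>m T) xs Some"

lemma in_dom_infty_iff: "w \<in> dom_infty ex \<pi> \<longleftrightarrow> (\<forall>xs. \<exists>u. gens xs w = Some u)"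
  by (auto simp: dom_infty_def dom_n_def dom_def)

text \<open>No reversal occurs because the two products read a list in opposite orders:
  \<open>gens\<close> applies its first letter first, \<open>word\<close> applies it last. In
  \<open>word_skew\<close>, where both sides are words, the list is reversed.\<close>

lemma gens_skew:
  "v \<in> S \<Longrightarrow> gens xs w = Some u \<Longrightarrow> ip (word xs v) w = (-1) ^ length xs * ip v u"
proof (induction xs arbitrary: v u rule: rev_induct)
  case (snoc x xs)
  then obtain u' where u': "gens xs w = Some u'" "dpi_bar ex \<pi> x u' = Some u"
    by (auto simp: map_comp_Some_iff)
  have "ip (word (xs @ [x]) v) w = (-1) ^ length xs * ip (dpi ex \<pi> x v) u'"
    using snoc.IH[OF dpi_in_smooth_vectors[OF snoc.prems(1)] u'(1)] by simp
  then show ?case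
    using dpi_bar_skew[OF dpi_bar_smooth[OF snoc.prems(1)] u'(2)] by simp
qed simp

lemma smooth_vectors_subset_dom_infty: "S \<subseteq> dom_infty ex \<pi>"
proof
  fix w assume w: "w \<in> S"
  have "\<exists>u\<in>S. gens xs w = Some u" for xs
  proof (induction xs rule: rev_induct)
    case (snoc x xs)
    then obtain u where "u \<in> S" "gens xs w = Some u" by blast
    then show ?case
      using dpi_bar_smooth[of u x] dpi_in_smooth_vectors[of u x] by (auto simp: map_comp_def)
  qed (use w in simp)
  then show "w \<in> dom_infty ex \<pi>"
    unfolding in_dom_infty_iff by blast
qed

lemma word_skew:
  "v \<in> S \<Longrightarrow> w \<in> S \<Longrightarrow> ip (word xs w) v = (-1) ^ length xs * ip w (word (rev xs) v)"
proof (induction xs arbitrary: v)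
  case (Cons x xs)
  have "ip (word (x # xs) w) v = - ip (word xs w) (dpi ex \<pi> x v)"
    using dpi_bar_skew[OF dpi_bar_smooth dpi_bar_smooth] Cons.prems by (simp add: word_in_smooth_vectors)
  then show ?case
    using Cons.IH[OF dpi_in_smooth_vectors[OF Cons.prems(1)] Cons.prems(2)] by simp
qed simp

text \<open>For fixed \<open>w\<close> all letters can be moved onto \<open>A w\<close>, which gives
  a bound independent of \<open>v\<close> in the unit ball of the smooth vectors. Uniform
  boundedness then applies to the functionals of \<open>w\<close> indexed by these
  \<open>v\<close>.\<close>

lemma words_bounded_of_dom_infty:
  assumes dom: "range (blinfun_apply A) \<subseteq> dom_infty ex \<pi>"
  shows "\<exists>C. \<forall>v\<in>S. norm (radj A (word xs v)) \<le> C * norm v"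
proof -
  have ipA: "ip z (A w) = ip w (radj A z)" for z w
    using ip_radj[of A w z] by (simp add: ip_commute)
  obtain C where C: "\<And>v w. v \<in> {v \<in> S. norm v \<le> 1} \<Longrightarrow> norm (ip (word xs v) (A w)) \<le> C * norm w"
  proof (rule uniform_boundedness[of "{v \<in> S. norm v \<le> 1}" "\<lambda>v w. ip (word xs v) (A w)"])
    show "bounded_linear (\<lambda>w. ip (word xs v) (A w))" for v
      by (rule bounded_linear_compose[OF bounded_bilinear.bounded_linear_right[OF bounded_bilinear_ip]
            blinfun.bounded_linear_right])
    fix w
    obtain u where u: "gens xs (A w) = Some u"
      using dom unfolding in_dom_infty_iff[abs_def] by (metis in_dom_infty_iff rangeI subsetD)
    have "norm (ip (word xs v) (A w)) \<le> norm u" if "v \<in> S" "norm v \<le> 1" for v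
    proof -
      have "\<bar>ip (word xs v) (A w)\<bar> = \<bar>ip v u\<bar>"
        using gens_skew[OF that(1) u] by (simp add: abs_mult power_abs)
      also have "\<dots> \<le> norm v * norm u" by (rule abs_ip_le_norm)
      also have "\<dots> \<le> 1 * norm u" using that(2) by (intro mult_right_mono) auto
      finally show ?thesis by simp
    qed
    then show "\<exists>C. \<forall>v\<in>{v \<in> S. norm v \<le> 1}. norm (ip (word xs v) (A w)) \<le> C" by blast
  qed blast
  have one: "norm (radj A (word xs v)) \<le> \<bar>C\<bar>" if "v \<in> S" "norm v \<le> 1" for v
  proof (rule norm_dense_leI[of UNIV])
    fix w
    have "ip w (radj A (word xs v)) \<le> C * norm w"
      using C[of v w] that by (simp add: ipA)
    also have "\<dots> \<le> \<bar>C\<bar> * norm w" by (intro mult_right_mono) auto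
    finally show "ip w (radj A (word xs v)) \<le> \<bar>C\<bar> * norm w" .
  qed simp_all
  have "norm (radj A (word xs v)) \<le> \<bar>C\<bar> * norm v" if v: "v \<in> S" for v
  proof (cases "v = 0")
    case True
    then show ?thesis
      using word_scaleR[OF smooth_vectors_zero, of xs 0] by (simp add: blinfun.zero_right)
  next
    case False
    have "norm (radj A (word xs ((1 / norm v) *\<^sub>R v))) \<le> \<bar>C\<bar>"
      using False v by (intro one) (simp_all add: smooth_vectors_scaleR)
    then show ?thesis
      using False v by (simp add: word_scaleR blinfun.scaleR_right field_simps)
  qed
  then show ?thesis by blast
qed

text \<open>Letters are added one by one. If \<open>u'\<close> is the value reached so far, pairing
  it with \<open>dpi ex \<pi> x v\<close> is, up to sign, pairing \<open>w\<close> with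
  \<open>A*\<close> applied to the longer word. The bound for that word makes the pairing a bounded
  functional of \<open>v\<close>, Riesz represents it, and the core property puts \<open>u'\<close>
  into the domain of the next generator.\<close>

lemma dom_infty_of_words_bounded:
  assumes bd: "\<And>xs. \<exists>C. \<forall>v\<in>S. norm (radj A (word xs v)) \<le> C * norm v"
  shows "range (blinfun_apply A) \<subseteq> dom_infty ex \<pi>"
proof -
  have "\<exists>u. gens xs (A w) = Some u" for xs w
  proof (induction xs rule: rev_induct)
    case (snoc x xs)
    then obtain u' where u': "gens xs (A w) = Some u'" by blast
    obtain C where C: "\<And>v. v \<in> S \<Longrightarrow> norm (radj A (word (xs @ [x]) v)) \<le> C * norm v"
      using bd by blast
    have eq: "ip (dpi ex \<pi> x v) u' = (-1) ^ length xs * ip (radj A (word (xs @ [x]) v)) w" if v: "v \<in> S" for v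
    proof -
      have "ip (word xs (dpi ex \<pi> x v)) (A w) = (-1) ^ length xs * ip (dpi ex \<pi> x v) u'"
        by (rule gens_skew[OF dpi_in_smooth_vectors[OF v] u'])
      moreover have "ip (word xs (dpi ex \<pi> x v)) (A w) = ip (radj A (word (xs @ [x]) v)) w"
        using ip_radj[of A w "word xs (dpi ex \<pi> x v)"] by (simp add: ip_commute)
      ultimately show ?thesis
        by (simp add: mult.assoc[symmetric] power_mult_distrib[symmetric])
    qed
    obtain u where u: "\<And>v. v \<in> S \<Longrightarrow> ip (dpi ex \<pi> x v) u' = ip v u"
    proof (rule riesz_dense[OF subspace_smooth_vectors, of "\<lambda>v. ip (dpi ex \<pi> x v) u'" "C * norm w"])
      fix v assume v: "v \<in> S"
      have "\<bar>ip (dpi ex \<pi> x v) u'\<bar> = \<bar>ip (radj A (word (xs @ [x]) v)) w\<bar>"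
        unfolding eq[OF v] by (simp add: abs_mult power_abs)
      also have "\<dots> \<le> norm (radj A (word (xs @ [x]) v)) * norm w"
        by (rule abs_ip_le_norm)
      also have "\<dots> \<le> (C * norm v) * norm w"
        using C[OF v] by (intro mult_right_mono) auto
      finally show "\<bar>ip (dpi ex \<pi> x v) u'\<bar> \<le> C * norm w * norm v"
        by (simp add: mult_ac)
    next
      show "ip (dpi ex \<pi> x (r *\<^sub>R v)) u' = r * ip (dpi ex \<pi> x v) u'" if "v \<in> S" for r v
        using word_scaleR[OF that, of "[x]" r] by (simp add: ip_scaleR_left)
    qed (auto simp: dpi_add_right ip_add_left)
    have "dpi_bar ex \<pi> x u' = Some (- u)"
      by (rule dpi_bar_weak) (simp add: u ip_minus_right)
    then show ?case using u' by (simp add: map_comp_def)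
  qed simp
  then show ?thesis by (auto simp: in_dom_infty_iff)
qed

section \<open>Local bounds from the Baire property\<close>

lemma bounded_sum_list:
  fixes L :: "'h \<Rightarrow>\<^sub>L 'h"
  assumes "\<And>T. T \<in> set Ts \<Longrightarrow> \<exists>C. \<forall>v\<in>S. norm (L (F T v)) \<le> C * norm v"
  shows "\<exists>C. \<forall>v\<in>S. norm (L (\<Sum>T\<leftarrow>Ts. F T v)) \<le> C * norm v"
  using assms
proof (induction Ts)
  case Nil
  show ?case by (intro exI[of _ 0]) (simp add: blinfun.zero_right)
next
  case (Cons T Ts)
  then obtain C C' where C: "\<And>v. v \<in> S \<Longrightarrow> norm (L (F T v)) \<le> C * norm v"
    "\<And>v. v \<in> S \<Longrightarrow> norm (L (\<Sum>T\<leftarrow>Ts. F T v)) \<le> C' * norm v"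
    by (metis list.set_intros)
  have "norm (L (\<Sum>T\<leftarrow>T # Ts. F T v)) \<le> (C + C') * norm v" if v: "v \<in> S" for v
    using norm_triangle_ineq[of "L (F T v)" "L (\<Sum>T\<leftarrow>Ts. F T v)"] C[OF v]
    by (simp add: blinfun.add_right algebra_simps)
  then show ?case by blast
qed

text \<open>The first direction is traded for a letter prefixed to the word: by
  \<open>iter_deriv_along_field\<close> this lowers the order by one, up to further terms of lower
  order. Hence the induction on \<open>n\<close> runs over all words and directions. The constant
  depends on \<open>y\<close>, without any control of how.\<close>

lemma orbit_iter_deriv_bounded:
  fixes B :: "'h \<Rightarrow>\<^sub>L 'h"
  assumes bd: "\<And>xs. \<exists>C. \<forall>v\<in>S. norm (blinfun_apply B (word xs v)) \<le> C * norm v"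
  shows "\<exists>C. \<forall>v\<in>S. norm (B (iter_deriv n (orbit (word xs v)) e y)) \<le> C * norm v"
proof (induction n arbitrary: xs y rule: less_induct)
  case (less n)
  show ?case
  proof (cases n)
    case 0
    then show ?thesis using bd[of xs] by simp
  next
    case (Suc m)
    define x where "x = y 0"
    define h where "h i = y (Suc i)" for i
    have y: "y = case_nat x h"
      by (auto simp: x_def h_def fun_eq_iff split: nat.split)
    obtain Ts :: "(nat \<times> (nat \<Rightarrow> 'e \<Rightarrow> 'e)) list" where
      Ts: "\<And>k Z. (k, Z) \<in> set Ts \<Longrightarrow> k \<le> m" and
      eq: "\<And>f :: 'e \<Rightarrow> 'h. smooth_on coords f \<Longrightarrow>
        iter_deriv m (\<lambda>a. dir_deriv f a (X x a)) e h = iter_deriv (Suc m) f e (case_nat (X x e) h) +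
        (\<Sum>(k, Z)\<leftarrow>Ts. iter_deriv k f e (\<lambda>i. Z i e))"
      using iter_deriv_along_field[OF smooth_on_left_inv_field[of x], of m h, where 'f = 'h] e_in_coords by fast
    define F where "F T v = (case T of (k, Z) \<Rightarrow> iter_deriv k (orbit (word xs v)) e (\<lambda>i. Z i e))"
      for T :: "nat \<times> (nat \<Rightarrow> 'e \<Rightarrow> 'e)" and v
    have "\<exists>C. \<forall>v\<in>S. norm (B (\<Sum>T\<leftarrow>Ts. F T v)) \<le> C * norm v"
    proof (rule bounded_sum_list)
      fix T assume "T \<in> set Ts"
      then obtain k Z where T: "T = (k, Z)" "k < n"
        using Ts[of "fst T" "snd T"] Suc by (metis less_Suc_eq_le prod.collapse)
      then show "\<exists>C. \<forall>v\<in>S. norm (B (F T v)) \<le> C * norm v"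
        using less.IH[of k xs "\<lambda>i. Z i e"] by (simp add: F_def)
    qed
    then obtain C1 where C1: "\<And>v. v \<in> S \<Longrightarrow> norm (B (\<Sum>T\<leftarrow>Ts. F T v)) \<le> C1 * norm v" by blast
    obtain C2 where C2: "\<And>v. v \<in> S \<Longrightarrow> norm (B (iter_deriv m (orbit (word (x # xs) v)) e h)) \<le> C2 * norm v"
      using less.IH[of m "x # xs" h] Suc by blast
    have "norm (B (iter_deriv n (orbit (word xs v)) e y)) \<le> (C2 + C1) * norm v" if v: "v \<in> S" for v
    proof -
      let ?u = "word xs v"
      have u: "?u \<in> S" using v by (rule word_in_smooth_vectors)
      have "iter_deriv m (orbit (dpi ex \<pi> x ?u)) e h = iter_deriv m (\<lambda>a. dir_deriv (orbit ?u) a (X x a)) e h"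
        by (rule iter_deriv_cong[OF open_coords orbit_dpi[OF u] e_in_coords])
      also have "\<dots> = iter_deriv n (orbit ?u) e y + (\<Sum>T\<leftarrow>Ts. F T v)"
        unfolding eq[OF smooth_on_orbit[OF u]] left_inv_field_e y[symmetric] Suc F_def ..
      finally have "B (iter_deriv n (orbit ?u) e y) =
          B (iter_deriv m (orbit (word (x # xs) v)) e h) - B (\<Sum>T\<leftarrow>Ts. F T v)"
        by (simp add: blinfun.add_right)
      then have "norm (B (iter_deriv n (orbit ?u) e y)) \<le>
          norm (B (iter_deriv m (orbit (word (x # xs) v)) e h)) + norm (B (\<Sum>T\<leftarrow>Ts. F T v))"
        by (simp only: norm_triangle_ineq4)
      then show ?thesis
        using C1[OF v] C2[OF v] by (simp only: distrib_right)
    qed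
    then show ?thesis by blast
  qed
qed

lemma orbit_scaleR:
  assumes "v \<in> S" "a \<in> coords"
  shows "iter_deriv n (orbit (r *\<^sub>R v)) a y = r *\<^sub>R iter_deriv n (orbit v) a y"
  using iter_deriv_scaleR[OF smooth_on_orbit[OF assms(1)] assms(2)] by (simp add: blinfun.scaleR_right)

text \<open>The family is indexed by the unit ball of the smooth vectors, so that a bound
  independent of the index becomes, by homogeneity, a bound linear in \<open>norm v\<close>.\<close>

lemma orbit_locally_bounded:
  fixes B :: "'h \<Rightarrow>\<^sub>L 'h"
  assumes met: "metrizable_space (euclidean :: 'e topology)" and Baire: "Baire_space (euclidean :: 'e topology)"
    and bd: "\<And>xs. \<exists>C. \<forall>v\<in>S. norm (blinfun_apply B (word xs v)) \<le> C * norm v"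
  obtains W C where "open W" "y \<in> W"
    "\<And>z v. z \<in> W \<Longrightarrow> v \<in> S \<Longrightarrow> norm (B (iter_deriv n (orbit v) e z)) \<le> C * norm v"
proof -
  let ?I = "{v \<in> S. norm v \<le> 1}"
  let ?\<beta> = "\<lambda>v z. B (iter_deriv n (orbit v) e z)"
  obtain W C where W: "open W" "y \<in> W" "\<And>z v. z \<in> W \<Longrightarrow> v \<in> ?I \<Longrightarrow> norm (?\<beta> v z) \<le> C"
  proof (rule Baire_multilinear_family[OF met Baire, of ?I ?\<beta> n y])
    fix v assume "v \<in> ?I"
    then have v: "v \<in> S" by simp
    note sm = smooth_on_orbit[OF v]
    show "continuous_on UNIV (?\<beta> v)"
      unfolding continuous_on_def
      by (auto intro!: blinfun.tendsto tendsto_const smooth_on_tendsto[OF sm e_in_coords] tendsto_apply[OF tendsto_ident_at])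
    show "?\<beta> v (z(l := a - b)) = ?\<beta> v (z(l := a)) - ?\<beta> v (z(l := b))" if "l < n" for l z a b
      using iter_deriv_diff_dir[OF sm e_in_coords that, of z a b] by (simp only: blinfun.diff_right)
    show "?\<beta> v (z(l := r *\<^sub>R a)) = r *\<^sub>R ?\<beta> v (z(l := a))" if "l < n" for l z r a
      using iter_deriv_scaleR_dir[OF sm e_in_coords that, of z r a] by (simp only: blinfun.scaleR_right)
    show "?\<beta> v z = ?\<beta> v z'" if "\<And>l. l < n \<Longrightarrow> z l = z' l" for z z'
      using iter_deriv_cong_dirs[of n z z'] that by metis
  next
    fix z
    obtain C where C: "\<And>v. v \<in> S \<Longrightarrow> norm (?\<beta> v z) \<le> C * norm v"
      using orbit_iter_deriv_bounded[OF bd, of n "[]" z] bd by auto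
    have "norm (?\<beta> v z) \<le> \<bar>C\<bar>" if "v \<in> ?I" for v
    proof -
      have "norm (?\<beta> v z) \<le> C * norm v" using C that by simp
      also have "\<dots> \<le> \<bar>C\<bar> * 1" using that by (intro mult_mono) auto
      finally show ?thesis by simp
    qed
    then show "\<exists>C. \<forall>v\<in>?I. norm (?\<beta> v z) \<le> C" by blast
  qed blast
  show thesis
  proof (rule that[OF W(1,2)])
    fix z v assume z: "z \<in> W" and v: "v \<in> S"
    show "norm (?\<beta> v z) \<le> C * norm v"
    proof (cases "v = 0")
      case True
      then show ?thesis
        using orbit_scaleR[OF v e_in_coords, of n 0 z] by (simp add: blinfun.zero_right)
    next
      case False
      have "norm (?\<beta> ((1 / norm v) *\<^sub>R v) z) \<le> C"
        using False v z by (intro W(3)) (simp_all add: smooth_vectors_scaleR)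
      moreover have "?\<beta> ((1 / norm v) *\<^sub>R v) z = (1 / norm v) *\<^sub>R ?\<beta> v z"
        using orbit_scaleR[OF v e_in_coords, of n "1 / norm v" z] by (simp only: blinfun.scaleR_right)
      ultimately show ?thesis
        using False by (simp add: field_simps)
    qed
  qed
qed

text \<open>The bound at the identity is transported to a point \<open>g\<close> by writing
  \<open>\<pi>(h) v = \<pi>(h g\<^sup>-\<^sup>1) (\<pi>(g) v)\<close>, where \<open>\<pi>(g) v\<close> has the norm of \<open>v\<close>; Faa di Bruno's formula
  applies to the coordinates of \<open>h \<mapsto> h g\<^sup>-\<^sup>1\<close>, which are jointly smooth.\<close>

lemma chart_locally_bounded:
  fixes B :: "'h \<Rightarrow>\<^sub>L 'h"
  assumes met: "metrizable_space (euclidean :: 'e topology)" and Baire: "Baire_space (euclidean :: 'e topology)"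
    and bd: "\<And>xs. \<exists>C. \<forall>v\<in>S. norm (blinfun_apply B (word xs v)) \<le> C * norm v"
    and U: "(U, \<phi>) \<in> \<A>" and a0: "a0 \<in> \<phi> ` U"
  shows "\<exists>W C. open W \<and> (a0, h0) \<in> W \<and> (\<forall>a h v. (a, h) \<in> W \<longrightarrow> a \<in> \<phi> ` U \<longrightarrow> v \<in> S \<longrightarrow>
    norm (B (iter_deriv j (\<lambda>a. \<pi> (inv_into U \<phi> a) v) a h)) \<le> C * norm v)"
proof -
  define q where "q = inv_into U \<phi>"
  obtain V \<psi> where V: "(V, \<psi>) \<in> \<A>" "inv (q a0) \<in> V" by (rule chart_cover)
  define M where "M = mult_coord (U, \<phi>) (V, \<psi>) c"
  define D where "D = mult_dom (U, \<phi>) (V, \<psi>) c"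
  \<comment> \<open>With the second argument frozen at \<open>\<iota> a\<close>, the map
    \<open>M\<close> is right translation by the inverse of the base point; it takes
    \<open>a\<close> to the coordinates of the identity.\<close>
  define \<iota> where "\<iota> a = \<psi> (inv (q a))" for a
  have smM: "smooth_on D M"
    unfolding D_def M_def using U V(1) chart_at_one(1) by (rule smooth_on_mult_coord)
  have MD: "M ` D \<subseteq> coords"
    using U V(1) by (auto simp: D_def M_def mult_dom_def mult_coord_def)
  have qU: "q a \<in> U" "\<phi> (q a) = a" if "a \<in> \<phi> ` U" for a
    using that by (auto simp: q_def inv_into_into f_inv_into_f)
  have \<iota>: "(a, \<iota> a) \<in> D" "M (a, \<iota> a) = e" if a: "a \<in> \<phi> ` U" "inv (q a) \<in> V" for a
  proof -
    show "(a, \<iota> a) \<in> D"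
      using mult_domI[of "q a" "(U, \<phi>)" "inv (q a)" "(V, \<psi>)" c] a qU[OF a(1)] chart_at_one(2)
      by (simp add: D_def \<iota>_def)
    show "M (a, \<iota> a) = e"
      using a V(1) by (simp add: M_def mult_coord_def \<iota>_def q_def[symmetric])
  qed
  \<comment> \<open>These arguments of the outer derivatives do not involve \<open>v\<close>, so
    that one neighbourhood of \<open>dirs T a0 h0\<close> serves all smooth vectors.\<close>
  define dirs where "dirs T a h = fdb_dirs M (a, \<iota> a) (\<lambda>i. (h i, 0)) (snd T)" for T :: fdb_index and a and h :: "nat \<Rightarrow> 'e"
  have formula: "iter_deriv j (\<lambda>a. \<pi> (q a) v) a h = (\<Sum>T\<leftarrow>fdb_terms j. iter_deriv (fst T) (orbit (\<pi> (q a) v)) e (dirs T a h))"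
    if a: "a \<in> \<phi> ` U" "inv (q a) \<in> V" and v: "v \<in> S" for a h v
  proof -
    let ?v = "\<pi> (q a) v"
    have v': "?v \<in> S" using v by (rule smooth_vectors_rep)
    have "iter_deriv j (\<lambda>a. \<pi> (q a) v) a h = iter_deriv j (\<lambda>b. orbit ?v (M (b, \<iota> a))) a h"
    proof (rule iter_deriv_cong)
      show "open {b. (b, \<iota> a) \<in> D}"
        using smooth_on_open[OF smooth_on_slice[OF smM]] .
      show "a \<in> {b. (b, \<iota> a) \<in> D}" using \<iota>(1)[OF a] by simp
      fix b assume "b \<in> {b. (b, \<iota> a) \<in> D}"
      then obtain g where g: "b = \<phi> g" "g \<in> U" "\<exists>h. \<iota> a = \<psi> h \<and> h \<in> V \<and> g \<otimes> h \<in> fst c"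
        by (auto simp: D_def mult_dom_def)
      then obtain h where h: "\<iota> a = \<psi> h" "h \<in> V" "g \<otimes> h \<in> fst c" by blast
      have "h = inv (q a)"
        using h(1,2) a(2) chart_facts(5)[OF V(1)] by (auto simp: \<iota>_def inj_on_def)
      then have "orbit ?v (M (b, \<iota> a)) = \<pi> (g \<otimes> inv (q a)) ?v"
        using g h U V(1) chart_inv[OF chart_at_one'] by (simp add: M_def mult_coord_def)
      also have "\<dots> = \<pi> g v"
        by (simp add: rep_mult)
      finally show "\<pi> (q b) v = orbit ?v (M (b, \<iota> a))"
        using g U by (simp add: q_def)
    qed
    also have "\<dots> = iter_deriv j (\<lambda>x. orbit ?v (M x)) (a, \<iota> a) (\<lambda>i. (h i, 0))"
      by (rule iter_deriv_slice)
    also have "\<dots> = (\<Sum>T\<leftarrow>fdb_terms j. fdb_val (orbit ?v) M (a, \<iota> a) (\<lambda>i. (h i, 0)) T)"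
      by (rule iter_deriv_comp(1)[OF smooth_on_orbit[OF v'] smM MD \<iota>(1)[OF a]])
    finally show ?thesis
      by (simp add: fdb_val_def \<iota>(2)[OF a] dirs_def)
  qed
  let ?F = "nhds (a0, h0)"
  note fs = tendsto_fst_snd_nhds[where x = a0 and h = h0]
  have evU: "\<forall>\<^sub>F p in ?F. fst p \<in> \<phi> ` U"
    using fs(1) chart_facts(2)[OF U] a0 by (auto simp: tendsto_def)
  have invq: "((\<lambda>p. inv (q (fst p))) \<longlongrightarrow> inv (q a0)) ?F"
  proof -
    have "((\<lambda>p. q (fst p)) \<longlongrightarrow> q a0) ?F"
      using continuous_on_tendsto_compose[OF chart_facts(4)[OF U] fs(1) a0 evU] by (simp add: q_def)
    moreover have "continuous_on UNIV (m_inv G)"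
      using smooth_inv by (simp add: smooth_map_def)
    ultimately show ?thesis
      by - (rule continuous_on_tendsto_compose[of UNIV "m_inv G"], auto)
  qed
  then have evV: "\<forall>\<^sub>F p in ?F. inv (q (fst p)) \<in> V"
    using chart_facts(1)[OF V(1)] V(2) by (auto simp: tendsto_def)
  have \<iota>lim: "((\<lambda>p. (fst p, \<iota> (fst p))) \<longlongrightarrow> (a0, \<iota> a0)) ?F"
    unfolding \<iota>_def
    by (rule tendsto_Pair[OF fs(1) continuous_on_tendsto_compose[OF chart_facts(3)[OF V(1)] invq V(2) evV]])
  have dirs_lim: "((\<lambda>p. dirs T (fst p) (snd p)) \<longlongrightarrow> dirs T a0 h0) ?F" for T
    unfolding dirs_def
  proof (rule tendsto_funI, rule tendsto_fdb_dirs[OF smM \<iota>(1)[OF a0 V(2)] \<iota>lim])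
    show "((\<lambda>p i. (snd p i, 0)) \<longlongrightarrow> (\<lambda>i. (h0 i, 0))) ?F"
      by (rule tendsto_funI) (intro tendsto_Pair tendsto_const tendsto_apply[OF fs(2)])
  qed
  have "\<exists>W C. open W \<and> dirs T a0 h0 \<in> W \<and>
      (\<forall>z\<in>W. \<forall>v\<in>S. norm (B (iter_deriv (fst T) (orbit v) e z)) \<le> C * norm v)" for T
    using orbit_locally_bounded[OF met Baire bd, of "dirs T a0 h0" "fst T"] bd by metis
  then obtain W C where W: "\<And>T. open (W T)" "\<And>T. dirs T a0 h0 \<in> W T"
    "\<And>T z v. z \<in> W T \<Longrightarrow> v \<in> S \<Longrightarrow> norm (B (iter_deriv (fst T) (orbit v) e z)) \<le> C T * norm v"
    by metis
  have evW: "\<forall>\<^sub>F p in ?F. \<forall>T\<in>set (fdb_terms j). dirs T (fst p) (snd p) \<in> W T"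
    using dirs_lim W(1,2) by (intro eventually_ball_finite) (auto simp: tendsto_def)
  define K where "K = (\<Sum>T\<leftarrow>fdb_terms j. C T)"
  have "\<forall>\<^sub>F p in ?F. \<forall>v\<in>S. norm (B (iter_deriv j (\<lambda>a. \<pi> (q a) v) (fst p) (snd p))) \<le> K * norm v"
    using evU evV evW
  proof eventually_elim
    case (elim p)
    show ?case
    proof
      fix v assume v: "v \<in> S"
      let ?v = "\<pi> (q (fst p)) v"
      have "norm (B (\<Sum>T\<leftarrow>Ts. iter_deriv (fst T) (orbit ?v) e (dirs T (fst p) (snd p)))) \<le> (\<Sum>T\<leftarrow>Ts. C T) * norm v"
        if "set Ts \<subseteq> set (fdb_terms j)" for Ts
        using that
      proof (induction Ts)
        case (Cons T Ts)
        let ?x = "B (iter_deriv (fst T) (orbit ?v) e (dirs T (fst p) (snd p)))"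
        let ?y = "B (\<Sum>T\<leftarrow>Ts. iter_deriv (fst T) (orbit ?v) e (dirs T (fst p) (snd p)))"
        have "norm ?x \<le> C T * norm ?v"
          using Cons.prems elim(3) by (intro W(3) smooth_vectors_rep v) auto
        then show ?case
          using Cons norm_triangle_ineq[of ?x ?y] by (simp add: blinfun.add_right algebra_simps)
      qed (simp add: blinfun.zero_right)
      from this[of "fdb_terms j"]
      show "norm (B (iter_deriv j (\<lambda>a. \<pi> (q a) v) (fst p) (snd p))) \<le> K * norm v"
        using formula[OF elim(1,2) v, of "snd p"] by (simp add: K_def)
    qed
  qed
  then obtain W' where "open W'" "(a0, h0) \<in> W'"
    "\<And>p v. p \<in> W' \<Longrightarrow> v \<in> S \<Longrightarrow> norm (B (iter_deriv j (\<lambda>a. \<pi> (q a) v) (fst p) (snd p))) \<le> K * norm v"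
    unfolding eventually_nhds by metis
  then show ?thesis
    unfolding q_def by (intro exI[of _ W'] exI[of _ K]) auto
qed

lemma smooth_map_of_words_bounded:
  fixes B :: "'h \<Rightarrow>\<^sub>L 'h"
  assumes met: "metrizable_space (euclidean :: 'e topology)" and Baire: "Baire_space (euclidean :: 'e topology)"
    and bd: "\<And>xs. \<exists>C. \<forall>v\<in>S. norm (blinfun_apply B (word xs v)) \<le> C * norm v"
  shows "smooth_map \<A> lcs_atlas (\<lambda>g. B o\<^sub>L \<pi> g)"
proof (rule smooth_mapI)
  fix U \<phi> assume U: "(U, \<phi>) \<in> \<A>"
  have L: "linear (blinfun_apply B)" "continuous_on UNIV (blinfun_apply B)"
    using blinfun.bounded_linear_right[of B] by (auto intro: bounded_linear.linear linear_continuous_on)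
  show "smooth_on (\<phi> ` U) (\<lambda>a. B o\<^sub>L \<pi> (inv_into U \<phi> a))"
  proof (rule smooth_on_blinfun[OF chart_facts(2)[OF U] subspace_smooth_vectors dense])
    fix v assume v: "v \<in> S"
    show "smooth_on (\<phi> ` U) (\<lambda>a. (B o\<^sub>L \<pi> (inv_into U \<phi> a)) v)"
      using smooth_on_linear_post[OF L smooth_map_chart[OF smooth_vectorsD[OF v] U]] by simp
  next
    fix j a h assume a: "a \<in> \<phi> ` U"
    obtain W C where W: "open W" "(a, h) \<in> W"
      "\<And>b k v. (b, k) \<in> W \<Longrightarrow> b \<in> \<phi> ` U \<Longrightarrow> v \<in> S \<Longrightarrow>
        norm (B (iter_deriv j (\<lambda>a. \<pi> (inv_into U \<phi> a) v) b k)) \<le> C * norm v"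
      using chart_locally_bounded[OF met Baire bd U a, of h j] bd by metis
    have "norm (iter_deriv j (\<lambda>a. (B o\<^sub>L \<pi> (inv_into U \<phi> a)) v) b k) \<le> C * norm v"
      if "(b, k) \<in> W" "b \<in> \<phi> ` U" "v \<in> S" for b k v
      using W(3)[OF that] iter_deriv_linear_post(1)[OF L smooth_map_chart[OF smooth_vectorsD[OF that(3)] U] that(2)]
      by simp
    then show "\<exists>W C. open W \<and> (a, h) \<in> W \<and> (\<forall>b k v. (b, k) \<in> W \<longrightarrow> b \<in> \<phi> ` U \<longrightarrow> v \<in> S \<longrightarrow>
        norm (iter_deriv j (\<lambda>a. (B o\<^sub>L \<pi> (inv_into U \<phi> a)) v) b k) \<le> C * norm v)"
      using W(1,2) by blast
  qed
qed

end

section \<open>Smoothing operators\<close>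

theorem theorem2p1:
  fixes G :: "('g::t2_space) monoid"
    and \<A> :: "('g, 'e::locally_convex_space) chart set"
    and c :: "('g, 'e) chart"
    and ex :: "'e \<Rightarrow> 'g"
    and \<pi> :: "'g \<Rightarrow> ('h::complex_hilbert_space \<Rightarrow>\<^sub>L 'h)"
    and A :: "'h \<Rightarrow>\<^sub>L 'h"
    and I II III IV V :: bool
  assumes G: "lie_group_exp G \<A> c ex"
    and \<pi>: "smooth_unitary_rep G \<A> \<pi>"
    and A: "clinear_op A"
    and I: "I \<longleftrightarrow> smooth_map \<A> lcs_atlas (\<lambda>g. \<pi> g o\<^sub>L A)"
    and II: "II \<longleftrightarrow> smooth_map \<A> lcs_atlas (\<lambda>g. cadjoint A o\<^sub>L \<pi> g)"
    and III: "III \<longleftrightarrow> range (blinfun_apply A) \<subseteq> smooth_vectors \<A> \<pi>"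
    and IV: "IV \<longleftrightarrow> range (blinfun_apply A) \<subseteq> dom_infty ex \<pi>"
    and V: "V \<longleftrightarrow> (\<forall>D\<in>env_algebra (lie_bracket G c).
                bounded_op_on (smooth_vectors \<A> \<pi>) (\<lambda>v. cadjoint A (dpi_env ex \<pi> D v)))"
  shows "(I \<longleftrightarrow> II) \<and> (II \<longrightarrow> III) \<and> (III \<longrightarrow> IV) \<and> (IV \<longleftrightarrow> V) \<and>
    (metrizable_space (euclidean :: 'e topology) \<longrightarrow> III \<longrightarrow> I \<and> II) \<and>
    (metrizable_space (euclidean :: 'e topology) \<and> Baire_space (euclidean :: 'e topology)
       \<longrightarrow> (I \<longleftrightarrow> II) \<and> (II \<longleftrightarrow> III) \<and> (III \<longleftrightarrow> IV) \<and> (IV \<longleftrightarrow> V)) \<and>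
    (frechet_space TYPE('e) \<longrightarrow> (I \<longleftrightarrow> II) \<and> (II \<longleftrightarrow> III) \<and> (III \<longleftrightarrow> IV) \<and> (IV \<longleftrightarrow> V)) \<and>
    (III \<longrightarrow> (\<forall>D\<in>env_algebra (lie_bracket G c).
                bounded_op_on UNIV (\<lambda>v. dpi_env ex \<pi> D (A v))))"
proof -
  interpret lie_group_exp G \<A> c ex by (rule G)
  interpret lie_group_rep G \<A> c ex \<pi> by unfold_locales (rule \<pi>)
  define B where "B = radj A"
  have cadj: "cadjoint A = B" unfolding B_def using A by (rule cadjoint_eq_radj)
  have B: "clinear_op B" unfolding B_def using A by (rule clinear_op_radj)
  have ipB: "ip (A v) w = ip v (B w)" for v w unfolding B_def by (rule ip_radj)
  have radj_lin: "linear radj" "continuous_on UNIV radj"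
    using bounded_linear_radj by (auto intro: bounded_linear.linear linear_continuous_on)
  have 1: "I \<longrightarrow> II"
  proof
    assume I
    then have "smooth_map \<A> lcs_atlas (\<lambda>g. radj (\<pi> (m_inv G g) o\<^sub>L A))"
      unfolding I by (rule smooth_map_inverse[OF smooth_map_linear_post[OF radj_lin]])
    moreover have "radj (\<pi> (m_inv G g) o\<^sub>L A) = B o\<^sub>L \<pi> g" for g
      by (rule radj_eqI) (simp add: ip_rep_inv ipB)
    ultimately show II by (simp add: II cadj)
  qed
  have 2: "II \<longrightarrow> I"
  proof
    assume II
    then have "smooth_map \<A> lcs_atlas (\<lambda>g. radj (B o\<^sub>L \<pi> (m_inv G g)))"
      unfolding II cadj by (rule smooth_map_inverse[OF smooth_map_linear_post[OF radj_lin]])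
    moreover have "radj (B o\<^sub>L \<pi> (m_inv G g)) = \<pi> g o\<^sub>L A" for g
    proof (rule radj_eqI)
      fix v w
      have "ip (B (\<pi> (m_inv G g) v)) w = ip (\<pi> (m_inv G g) v) (A w)"
        using ipB[of w "\<pi> (m_inv G g) v"] by (simp add: ip_commute)
      then show "ip ((B o\<^sub>L \<pi> (m_inv G g)) v) w = ip v ((\<pi> g o\<^sub>L A) w)"
        by (simp add: ip_rep_inv)
    qed
    ultimately show I by (simp add: I)
  qed
  have 3: "I \<longrightarrow> III"
  proof
    assume I
    have "A v \<in> smooth_vectors \<A> \<pi>" for v
    proof -
      have L: "bounded_linear (\<lambda>T :: 'h \<Rightarrow>\<^sub>L 'h. T v)"
        by (rule blinfun.bounded_linear_left)
      have "smooth_map \<A> lcs_atlas (\<lambda>g. (\<pi> g o\<^sub>L A) v)"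
        using \<open>I\<close> unfolding I
        by (rule smooth_map_linear_post[OF bounded_linear.linear[OF L] linear_continuous_on[OF L]])
      then show ?thesis by (simp add: smooth_vectors_def)
    qed
    then show III by (auto simp: III)
  qed
  have 4: "III \<longrightarrow> IV"
    using smooth_vectors_subset_dom_infty by (auto simp: III IV)
  have 5: "\<exists>C. \<forall>v\<in>smooth_vectors \<A> \<pi>. norm (B (word xs v)) \<le> C * norm v" if IV for xs
    unfolding B_def using words_bounded_of_dom_infty that IV by blast
  have 6: "IV \<longrightarrow> V"
  proof
    assume IV
    \<comment> \<open>The action of a class is by definition that of some representative, so a bound
      for every element of the free algebra suffices.\<close>
    have "\<exists>C. \<forall>v\<in>smooth_vectors \<A> \<pi>. norm (B (dpi_free ex \<pi> p v)) \<le> C * norm v" for p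
      using dpi_free_bounded[OF B, of "smooth_vectors \<A> \<pi>" "\<lambda>v. v" norm p] 5[OF \<open>IV\<close>] by simp
    then show V
      by (simp add: V cadj bounded_op_on_def dpi_env_def)
  qed
  have 7: "V \<longrightarrow> IV"
  proof
    assume V
    have "\<exists>C. \<forall>v\<in>smooth_vectors \<A> \<pi>. norm (B (word xs v)) \<le> C * norm v" for xs
    proof -
      \<comment> \<open>The word \<open>xs\<close> of real Lie algebra elements as a monomial over
        the complexification. By \<open>dpi_env_class\<close> its class acts as the word itself,
        whatever representative is chosen.\<close>
      define q :: "('e \<times> 'e) free_algebra" where "q = Poly_Mapping.single (Word (map (\<lambda>x. (x, 0)) xs)) 1"
      have "dpi_cplx ex \<pi> (x, 0) v = dpi ex \<pi> x v" for x v
        by (simp add: dpi_cplx_def dpi_zero_left)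
      then have "cword (map (\<lambda>x. (x, 0)) xs) v = word xs v" for v
        by (induction xs) simp_all
      then have "dpi_env ex \<pi> (env_rel (lie_bracket G c) `` {q}) v = word xs v" if "v \<in> smooth_vectors \<A> \<pi>" for v
        using dpi_env_class[OF that, of q] by (simp add: q_def)
      moreover have "env_rel (lie_bracket G c) `` {q} \<in> env_algebra (lie_bracket G c)"
        unfolding env_algebra_def by (rule quotientI) simp
      ultimately show ?thesis
        using \<open>V\<close> unfolding V cadj bounded_op_on_def by fastforce
    qed
    then show IV
      unfolding IV B_def by (rule dom_infty_of_words_bounded)
  qed
  have 8: "III \<longrightarrow> I" if met: "metrizable_space (euclidean :: 'e topology)"
  proof
    assume III
    then have Av: "A v \<in> smooth_vectors \<A> \<pi>" for v by (auto simp: III)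
    have "smooth_map \<A> lcs_atlas (\<lambda>g. \<pi> g o\<^sub>L A)"
    proof (rule smooth_mapI)
      fix U \<phi> assume U: "(U, \<phi>) \<in> \<A>"
      show "smooth_on (\<phi> ` U) (\<lambda>a. \<pi> (inv_into U \<phi> a) o\<^sub>L A)"
        by (rule smooth_on_strong_imp_norm[OF met]) (simp add: smooth_map_chart[OF smooth_vectorsD[OF Av] U])
    qed
    then show I by (simp add: I)
  qed
  have 9: "IV \<longrightarrow> II" if "metrizable_space (euclidean :: 'e topology)" "Baire_space (euclidean :: 'e topology)"
    using smooth_map_of_words_bounded[OF that, of B] 5 by (auto simp: II cadj)
  have 10: "bounded_op_on UNIV (\<lambda>v. dpi_env ex \<pi> D (A v))" if III for D
  proof -
    have Av: "A v \<in> smooth_vectors \<A> \<pi>" for v using \<open>III\<close> by (auto simp: III)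
    \<comment> \<open>The identity operator takes the place of \<open>L\<close> in
      \<open>dpi_free_bounded\<close>, now with the values of \<open>A\<close> as the family of
      smooth vectors.\<close>
    have "\<exists>C. \<forall>w\<in>UNIV. norm (id_blinfun (word xs (A w))) \<le> C * norm w" for xs
    proof -
      \<comment> \<open>Up to sign, a word applied after \<open>A\<close> is adjoint to
        \<open>A*\<close> applied after the reversed word, which (iv) bounds on smooth
        vectors.\<close>
      obtain C where C: "\<And>v. v \<in> smooth_vectors \<A> \<pi> \<Longrightarrow> norm (B (word (rev xs) v)) \<le> C * norm v"
        using 5 4 \<open>III\<close> by blast
      have "norm (word xs (A w)) \<le> \<bar>C\<bar> * norm w" for w
      proof (rule norm_dense_leI[OF dense])
        fix v assume v: "v \<in> smooth_vectors \<A> \<pi>"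
        have "\<bar>ip v (word xs (A w))\<bar> = \<bar>ip (A w) (word (rev xs) v)\<bar>"
          using word_skew[OF v Av, of xs w] by (simp add: ip_commute[of v] abs_mult power_abs)
        also have "\<dots> = \<bar>ip w (B (word (rev xs) v))\<bar>" by (simp add: ipB)
        also have "\<dots> \<le> norm w * norm (B (word (rev xs) v))" by (rule abs_ip_le_norm)
        also have "\<dots> \<le> norm w * (\<bar>C\<bar> * norm v)"
          using C[OF v] by (intro mult_left_mono order_trans[OF C[OF v]] mult_right_mono) auto
        finally show "ip v (word xs (A w)) \<le> \<bar>C\<bar> * norm w * norm v"
          by (simp add: mult_ac)
      qed simp
      then show ?thesis by auto
    qed
    moreover have "clinear_op (id_blinfun :: 'h \<Rightarrow>\<^sub>L 'h)"
      by (simp add: clinear_op_def)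
    ultimately have "\<exists>C. \<forall>w\<in>UNIV. norm (id_blinfun (dpi_free ex \<pi> p (A w))) \<le> C * norm w" for p
      using dpi_free_bounded[of id_blinfun UNIV "blinfun_apply A" norm p] Av by blast
    then show ?thesis
      by (simp add: bounded_op_on_def dpi_env_def)
  qed
  show ?thesis
    using 1 2 3 4 6 7 8 9 10 frechet_space_metrizable_Baire[where 'e = 'e] by blast
qed

end
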